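(* For each $k=1,2,3,4$ there is a dual adjunction between the category of left ample (resp. right ample, ample) complete restriction monoids and their morphisms of type $k$ and the category of left cancellative (resp. right cancellative, cancellative) étale topological categories and morphisms of type $k$.
   Context: A dual adjunction between two categories is an adjunction between the opposite of the first and the second. **Complete restriction monoids.** An Ehresmann semigroup is a semigroup $S$ with a non-empty set $E$ of idempotents (the projections) and maps $\lambda,\rho:S\to E$ such that: $E$ is a commutative subsemigroup; $\lambda(a)=\rho(a)=a$ for $a\in E$; $a\lambda(a)=a$ and $\rho(a)a=a$; $\lambda(\lambda(a)b)=\lambda(ab)$ and $\rho(a\rho(b))=\rho(ab)$. It is a restriction semigroup if moreover $fa=a\lambda(fa)$ and $af=\rho(af)a$ for all $a\in S$, $f\in E$. Natural partial order: $a\le b$ iff $a=gb=bf$ for some $f,g\in E$. Elements $a,b$ are compatible if $a\lambda(b)=b\lambda(a)$ and $\rho(b)a=\rho(a)b$; a non-empty subset is compatible if any two of its elements are compatible. A complete restriction monoid is a restriction semigroup that is a monoid, such that $E$ is a frame and $S$ has joins of all non-empty compatible subsets. $S$ is right ample if $ac=bc$ implies $a\rho(c)=b\rho(c)$; left ample if $ca=cb$ implies $\lambda(c)a=\lambda(c)b$; ample if both. A morphism $\varphi:S\to T$ is a semigroup homomorphism commuting with $\lambda,\rho$ whose restriction to projections is a frame morphism $E_S\to E_T$. It is proper if every $t\in T$ is $t=\bigvee X$ for some $X\subseteq T$ such that for each $x\in X$ there is $s\in S$ with $\varphi(s)\ge x$; a $\wedge$-morphism if it preserves binary meets. Types: 1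 morphisms; 2 proper morphisms; 3 $\wedge$-morphisms; 4 proper $\wedge$-morphisms. **Étale topological categories.** A topological category $C=(C_1,C_0,u,d,r,m)$ is an internal category in topological spaces ($u$ unit, $d$ domain, $r$ codomain, $m$ defined on $C_1\times_{C_0}C_1=\{(a,b):d(a)=r(b)\}$). It is étale if $d,r$ are local homeomorphisms and $u,m$ are open. It is right cancellative if $ac=bc$ (with $d(a)=d(b)=r(c)$) implies $a=b$; left cancellative if $ca=cb$ (with $r(a)=r(b)=d(c)$) implies $a=b$; cancellative if both. A relational covering morphism $f=(f_1,f_0):C\to D$ consists of a continuous $f_0:C_0\to D_0$ and a function $f_1:C_1\to\mathcal P(D_1)$ (power set) such that: (RM1) $b\in f_1(a)$ implies $d(b)=f_0d(a)$ and $r(b)=f_0r(a)$; (RM2) if $(a,b)\in C_1\times_{C_0}C_1$, $(s,t)\in D_1\times_{D_0}D_1$, $s\in f_1(a)$, $t\in f_1(b)$, then $st\in f_1(ab)$; (RM3) if $d(a)=d(b)$ or $r(a)=r(b)$, and $f_1(a)\cap f_1(b)\ne\varnothing$, then $a=b$; (RM4) if $p=f_0(q)$ and $d(s)=p$ (resp. $r(s)=p$) with $q\in C_0$, $s\in D_1$, there is $t\in C_1$ with $d(t)=q$ (resp. $r(t)=q$) and $s\in f_1(t)$; (RM5) $\{x\in C_1:f_1(x)\cap A\ne\varnothing\}$ is open for every open $A\subseteq D_1$; (RM6) $uf_0(t)\in f_1u(t)$ for $t\in C_0$. Composition: $(gf)_1(a)=\bigcup_{b\in f_1(a)}g_1(b)$,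 $(gf)_0=g_0f_0$. Types: 1 all relational covering morphisms; 2 those with $|f_1(c)|\ge1$ for all $c$; 3 those with $|f_1(c)|\le1$; 4 those with $|f_1(c)|=1$. *)

theory Defs
  imports "HOL-Analysis.Analysis" "HOL-Algebra.Complete_Lattice" "HOL-Algebra.Group"
begin

section \<open>Categories, functors and adjunctions\<close>

text \<open>Arrows carry no source and target of their own, so composition is indexed by the
  three objects involved: \<open>Comp A x y z g f\<close> is the composite of \<open>f \<in> Mor A x y\<close>
  followed by \<open>g \<in> Mor A y z\<close>.\<close>

record ('o, 'm) cat =
  Obj :: "'o set"
  Mor :: "'o \<Rightarrow> 'o \<Rightarrow> 'm set"
  Ide :: "'o \<Rightarrow> 'm"
  Comp :: "'o \<Rightarrow> 'o \<Rightarrow> 'o \<Rightarrow> 'm \<Rightarrow> 'm \<Rightarrow> 'm"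

definition is_category :: "('o, 'm) cat \<Rightarrow> bool" where
  "is_category A \<longleftrightarrow>
     (\<forall>x\<in>Obj A. Ide A x \<in> Mor A x x) \<and>
     (\<forall>x\<in>Obj A. \<forall>y\<in>Obj A. \<forall>z\<in>Obj A. \<forall>f\<in>Mor A x y. \<forall>g\<in>Mor A y z.
        Comp A x y z g f \<in> Mor A x z) \<and>
     (\<forall>x\<in>Obj A. \<forall>y\<in>Obj A. \<forall>f\<in>Mor A x y.
        Comp A x x y f (Ide A x) = f \<and> Comp A x y y (Ide A y) f = f) \<and>
     (\<forall>w\<in>Obj A. \<forall>x\<in>Obj A. \<forall>y\<in>Obj A. \<forall>z\<in>Obj A.
        \<forall>f\<in>Mor A w x. \<forall>g\<in>Mor A x y. \<forall>h\<in>Mor A y z.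
        Comp A w y z h (Comp A w x y g f) = Comp A w x z (Comp A x y z h g) f)"

definition opposite :: "('o, 'm) cat \<Rightarrow> ('o, 'm) cat" where
  "opposite A = \<lparr>Obj = Obj A, Mor = (\<lambda>x y. Mor A y x), Ide = Ide A,
                 Comp = (\<lambda>x y z g f. Comp A z y x f g)\<rparr>"

definition is_functor ::
  "('o, 'm) cat \<Rightarrow> ('p, 'n) cat \<Rightarrow> ('o \<Rightarrow> 'p) \<Rightarrow> ('o \<Rightarrow> 'o \<Rightarrow> 'm \<Rightarrow> 'n) \<Rightarrow> bool" where
  "is_functor A B F Fm \<longleftrightarrow>
     is_category A \<and> is_category B \<and>
     (\<forall>x\<in>Obj A. F x \<in> Obj B) \<and>
     (\<forall>x\<in>Obj A. \<forall>y\<in>Obj A. \<forall>f\<in>Mor A x y. Fm x y f \<in> Mor B (F x) (F y)) \<and>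
     (\<forall>x\<in>Obj A. Fm x x (Ide A x) = Ide B (F x)) \<and>
     (\<forall>x\<in>Obj A. \<forall>y\<in>Obj A. \<forall>z\<in>Obj A. \<forall>f\<in>Mor A x y. \<forall>g\<in>Mor A y z.
        Fm x z (Comp A x y z g f) = Comp B (F x) (F y) (F z) (Fm y z g) (Fm x y f))"

text \<open>\<open>L : X \<rightarrow> Y\<close> is left adjoint to \<open>R : Y \<rightarrow> X\<close>, with hom-set bijection \<open>\<Phi>\<close>.\<close>

definition adjunction ::
  "('o, 'm) cat \<Rightarrow> ('p, 'n) cat \<Rightarrow> ('o \<Rightarrow> 'p) \<Rightarrow> ('o \<Rightarrow> 'o \<Rightarrow> 'm \<Rightarrow> 'n) \<Rightarrow>
   ('p \<Rightarrow> 'o) \<Rightarrow> ('p \<Rightarrow> 'p \<Rightarrow> 'n \<Rightarrow> 'm) \<Rightarrow> ('o \<Rightarrow> 'p \<Rightarrow> 'n \<Rightarrow> 'm) \<Rightarrow> bool" where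
  "adjunction X Y L Lm R Rm \<Phi> \<longleftrightarrow>
     is_functor X Y L Lm \<and> is_functor Y X R Rm \<and>
     (\<forall>x\<in>Obj X. \<forall>y\<in>Obj Y. bij_betw (\<Phi> x y) (Mor Y (L x) y) (Mor X x (R y))) \<and>
     (\<forall>x\<in>Obj X. \<forall>x'\<in>Obj X. \<forall>y\<in>Obj Y. \<forall>y'\<in>Obj Y.
        \<forall>h\<in>Mor X x' x. \<forall>g\<in>Mor Y (L x) y. \<forall>k\<in>Mor Y y y'.
          \<Phi> x' y' (Comp Y (L x') y y' k (Comp Y (L x') (L x) y g (Lm x' x h)))
          = Comp X x' (R y) (R y') (Rm y y' k) (Comp X x' x (R y) (\<Phi> x y g) h))"

text \<open>A universe of small sets, relative to which the large categories below are formed.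
  It is closed under subsets, images and, up to a bijection, power sets; no infinite small
  set is demanded. The small sets of ZF set theory form an instance, and so do the finite
  sets of natural numbers.\<close>

definition universe :: "('u set \<Rightarrow> bool) \<Rightarrow> bool" where
  "universe small \<longleftrightarrow>
     (\<forall>A B. small A \<and> B \<subseteq> A \<longrightarrow> small B) \<and>
     (\<forall>A (f :: 'u \<Rightarrow> 'u). small A \<longrightarrow> small (f ` A)) \<and>
     (\<forall>A. small A \<longrightarrow> (\<exists>j :: 'u set \<Rightarrow> 'u. inj_on j (Pow A) \<and> small (j ` Pow A)))"


section \<open>Complete restriction monoids\<close>

record 'a crm = "'a monoid" +
  Proj :: "'a set"
  lam :: "'a \<Rightarrow> 'a"
  rho :: "'a \<Rightarrow> 'a"

text \<open>The product is assumed associative separately, as part of being a monoid.\<close>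

definition ehresmann :: "'a crm \<Rightarrow> bool" where
  "ehresmann S \<longleftrightarrow>
     Proj S \<noteq> {} \<and> Proj S \<subseteq> carrier S \<and>
     lam S \<in> carrier S \<rightarrow> Proj S \<and> rho S \<in> carrier S \<rightarrow> Proj S \<and>
     (\<forall>e\<in>Proj S. e \<otimes>\<^bsub>S\<^esub> e = e) \<and>
     (\<forall>e\<in>Proj S. \<forall>f\<in>Proj S. e \<otimes>\<^bsub>S\<^esub> f \<in> Proj S \<and> e \<otimes>\<^bsub>S\<^esub> f = f \<otimes>\<^bsub>S\<^esub> e) \<and>
     (\<forall>e\<in>Proj S. lam S e = e \<and> rho S e = e) \<and>
     (\<forall>a\<in>carrier S. a \<otimes>\<^bsub>S\<^esub> lam S a = a \<and> rho S a \<otimes>\<^bsub>S\<^esub> a = a) \<and>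
     (\<forall>a\<in>carrier S. \<forall>b\<in>carrier S.
        lam S (lam S a \<otimes>\<^bsub>S\<^esub> b) = lam S (a \<otimes>\<^bsub>S\<^esub> b) \<and>
        rho S (a \<otimes>\<^bsub>S\<^esub> rho S b) = rho S (a \<otimes>\<^bsub>S\<^esub> b))"

definition restriction_monoid :: "'a crm \<Rightarrow> bool" where
  "restriction_monoid S \<longleftrightarrow>
     monoid S \<and> ehresmann S \<and>
     (\<forall>a\<in>carrier S. \<forall>f\<in>Proj S.
        f \<otimes>\<^bsub>S\<^esub> a = a \<otimes>\<^bsub>S\<^esub> lam S (f \<otimes>\<^bsub>S\<^esub> a) \<and>
        a \<otimes>\<^bsub>S\<^esub> f = rho S (a \<otimes>\<^bsub>S\<^esub> f) \<otimes>\<^bsub>S\<^esub> a)"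

definition natural_le :: "'a crm \<Rightarrow> 'a \<Rightarrow> 'a \<Rightarrow> bool" where
  "natural_le S a b \<longleftrightarrow> (\<exists>g\<in>Proj S. \<exists>f\<in>Proj S. a = g \<otimes>\<^bsub>S\<^esub> b \<and> a = b \<otimes>\<^bsub>S\<^esub> f)"

definition natural_order :: "'a crm \<Rightarrow> 'a gorder" where
  "natural_order S = \<lparr>carrier = carrier S, eq = (=), le = natural_le S\<rparr>"

definition proj_order :: "'a crm \<Rightarrow> 'a gorder" where
  "proj_order S = \<lparr>carrier = Proj S, eq = (=), le = natural_le S\<rparr>"

definition is_frame :: "'a gorder \<Rightarrow> bool" where
  "is_frame L \<longleftrightarrow>
     complete_lattice L \<and>
     (\<forall>x\<in>carrier L. \<forall>A\<subseteq>carrier L. x \<sqinter>\<^bsub>L\<^esub> (\<Squnion>\<^bsub>L\<^esub> A) = \<Squnion>\<^bsub>L\<^esub> ((\<lambda>a. x \<sqinter>\<^bsub>L\<^esub> a) ` A))"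

definition frame_morphism :: "'a gorder \<Rightarrow> 'b gorder \<Rightarrow> ('a \<Rightarrow> 'b) \<Rightarrow> bool" where
  "frame_morphism L M h \<longleftrightarrow>
     h \<in> carrier L \<rightarrow> carrier M \<and>
     h \<top>\<^bsub>L\<^esub> = \<top>\<^bsub>M\<^esub> \<and>
     (\<forall>x\<in>carrier L. \<forall>y\<in>carrier L. h (x \<sqinter>\<^bsub>L\<^esub> y) = h x \<sqinter>\<^bsub>M\<^esub> h y) \<and>
     (\<forall>A\<subseteq>carrier L. h (\<Squnion>\<^bsub>L\<^esub> A) = \<Squnion>\<^bsub>M\<^esub> (h ` A))"

definition compatible :: "'a crm \<Rightarrow> 'a \<Rightarrow> 'a \<Rightarrow> bool" where
  "compatible S a b \<longleftrightarrow>
     a \<otimes>\<^bsub>S\<^esub> lam S b = b \<otimes>\<^bsub>S\<^esub> lam S a \<and> rho S b \<otimes>\<^bsub>S\<^esub> a = rho S a \<otimes>\<^bsub>S\<^esub> b"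

definition is_join :: "'a crm \<Rightarrow> 'a \<Rightarrow> 'a set \<Rightarrow> bool" where
  "is_join S t X \<longleftrightarrow> least (natural_order S) t (Upper (natural_order S) X)"

definition is_meet :: "'a crm \<Rightarrow> 'a \<Rightarrow> 'a set \<Rightarrow> bool" where
  "is_meet S t X \<longleftrightarrow> greatest (natural_order S) t (Lower (natural_order S) X)"

definition complete_restriction_monoid :: "'a crm \<Rightarrow> bool" where
  "complete_restriction_monoid S \<longleftrightarrow>
     restriction_monoid S \<and> is_frame (proj_order S) \<and>
     (\<forall>X\<subseteq>carrier S. X \<noteq> {} \<and> (\<forall>a\<in>X. \<forall>b\<in>X. compatible S a b) \<longrightarrow> (\<exists>t. is_join S t X))"

definition right_ample :: "'a crm \<Rightarrow> bool" where
  "right_ample S \<longleftrightarrow>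
     (\<forall>a\<in>carrier S. \<forall>b\<in>carrier S. \<forall>c\<in>carrier S.
        a \<otimes>\<^bsub>S\<^esub> c = b \<otimes>\<^bsub>S\<^esub> c \<longrightarrow> a \<otimes>\<^bsub>S\<^esub> rho S c = b \<otimes>\<^bsub>S\<^esub> rho S c)"

definition left_ample :: "'a crm \<Rightarrow> bool" where
  "left_ample S \<longleftrightarrow>
     (\<forall>a\<in>carrier S. \<forall>b\<in>carrier S. \<forall>c\<in>carrier S.
        c \<otimes>\<^bsub>S\<^esub> a = c \<otimes>\<^bsub>S\<^esub> b \<longrightarrow> lam S c \<otimes>\<^bsub>S\<^esub> a = lam S c \<otimes>\<^bsub>S\<^esub> b)"

definition ample :: "'a crm \<Rightarrow> bool" where
  "ample S \<longleftrightarrow> left_ample S \<and> right_ample S"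

definition crm_morphism :: "'a crm \<Rightarrow> 'b crm \<Rightarrow> ('a \<Rightarrow> 'b) \<Rightarrow> bool" where
  "crm_morphism S T \<phi> \<longleftrightarrow>
     \<phi> \<in> hom S T \<and>
     (\<forall>a\<in>carrier S. \<phi> (lam S a) = lam T (\<phi> a) \<and> \<phi> (rho S a) = rho T (\<phi> a)) \<and>
     frame_morphism (proj_order S) (proj_order T) \<phi>"

definition proper_morphism :: "'a crm \<Rightarrow> 'b crm \<Rightarrow> ('a \<Rightarrow> 'b) \<Rightarrow> bool" where
  "proper_morphism S T \<phi> \<longleftrightarrow>
     (\<forall>t\<in>carrier T. \<exists>X\<subseteq>carrier T. is_join T t X \<and>
        (\<forall>x\<in>X. \<exists>s\<in>carrier S. natural_le T x (\<phi> s)))"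

text \<open>Elements \<open>a\<close> and \<open>b\<close> with a common lower bound have a meet, namely the join of the
  (compatible) set of all their common lower bounds. If they have no common lower bound,
  which can happen only when the bottom projection is not a zero of \<open>S\<close>, the set is empty
  and its join is by convention the bottom projection. This makes the meet a total operation.\<close>

definition wedge :: "'a crm \<Rightarrow> 'a \<Rightarrow> 'a \<Rightarrow> 'a" where
  "wedge S a b =
     (if \<exists>m. is_meet S m {a, b} then THE m. is_meet S m {a, b} else \<bottom>\<^bsub>proj_order S\<^esub>)"

definition wedge_morphism :: "'a crm \<Rightarrow> 'b crm \<Rightarrow> ('a \<Rightarrow> 'b) \<Rightarrow> bool" where
  "wedge_morphism S T \<phi> \<longleftrightarrow>
     (\<forall>a\<in>carrier S. \<forall>b\<in>carrier S. \<phi> (wedge S a b) = wedge T (\<phi> a) (\<phi> b))"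

definition crm_mor :: "nat \<Rightarrow> 'a crm \<Rightarrow> 'b crm \<Rightarrow> ('a \<Rightarrow> 'b) set" where
  "crm_mor k S T =
     {\<phi> \<in> extensional (carrier S). crm_morphism S T \<phi> \<and>
        (k \<in> {2, 4} \<longrightarrow> proper_morphism S T \<phi>) \<and>
        (k \<in> {3, 4} \<longrightarrow> wedge_morphism S T \<phi>)}"

text \<open>Small complete restriction monoids satisfying \<open>P\<close>, with morphisms of type \<open>k\<close>.\<close>

definition CRM :: "('u set \<Rightarrow> bool) \<Rightarrow> ('u crm \<Rightarrow> bool) \<Rightarrow> nat \<Rightarrow> ('u crm, 'u \<Rightarrow> 'u) cat" where
  "CRM small P k =
     \<lparr>Obj = {S. small (carrier S) \<and> complete_restriction_monoid S \<and> P S},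
      Mor = crm_mor k,
      Ide = (\<lambda>S. restrict id (carrier S)),
      Comp = (\<lambda>S T U \<psi> \<phi>. compose (carrier S) \<psi> \<phi>)\<rparr>"


section \<open>Etale topological categories\<close>

text \<open>\<open>comp C a b\<close> is meaningful only when \<open>dom C a = cod C b\<close>.\<close>

record ('c, 'o) tcat =
  arr :: "'c topology"
  obj :: "'o topology"
  unit :: "'o \<Rightarrow> 'c"
  dom :: "'c \<Rightarrow> 'o"
  cod :: "'c \<Rightarrow> 'o"
  comp :: "'c \<Rightarrow> 'c \<Rightarrow> 'c"

definition composable :: "('c, 'o) tcat \<Rightarrow> ('c \<times> 'c) topology" where
  "composable C = subtopology (prod_topology (arr C) (arr C)) {(a, b). dom C a = cod C b}"

definition topological_category :: "('c, 'o) tcat \<Rightarrow> bool" where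
  "topological_category C \<longleftrightarrow>
     continuous_map (obj C) (arr C) (unit C) \<and>
     continuous_map (arr C) (obj C) (dom C) \<and>
     continuous_map (arr C) (obj C) (cod C) \<and>
     continuous_map (composable C) (arr C) (\<lambda>(a, b). comp C a b) \<and>
     (\<forall>x\<in>topspace (obj C). dom C (unit C x) = x \<and> cod C (unit C x) = x) \<and>
     (\<forall>(a, b)\<in>topspace (composable C).
        dom C (comp C a b) = dom C b \<and> cod C (comp C a b) = cod C a) \<and>
     (\<forall>a\<in>topspace (arr C).
        comp C a (unit C (dom C a)) = a \<and> comp C (unit C (cod C a)) a = a) \<and>
     (\<forall>a\<in>topspace (arr C). \<forall>b\<in>topspace (arr C). \<forall>c\<in>topspace (arr C).
        dom C a = cod C b \<and> dom C b = cod C c \<longrightarrow>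
        comp C (comp C a b) c = comp C a (comp C b c))"

definition local_homeomorphism :: "'a topology \<Rightarrow> 'b topology \<Rightarrow> ('a \<Rightarrow> 'b) \<Rightarrow> bool" where
  "local_homeomorphism X Y f \<longleftrightarrow>
     f \<in> topspace X \<rightarrow> topspace Y \<and>
     (\<forall>x\<in>topspace X. \<exists>U. openin X U \<and> x \<in> U \<and> openin Y (f ` U) \<and>
        homeomorphic_map (subtopology X U) (subtopology Y (f ` U)) f)"

definition etale :: "('c, 'o) tcat \<Rightarrow> bool" where
  "etale C \<longleftrightarrow>
     topological_category C \<and>
     local_homeomorphism (arr C) (obj C) (dom C) \<and>
     local_homeomorphism (arr C) (obj C) (cod C) \<and>
     open_map (obj C) (arr C) (unit C) \<and>
     open_map (composable C) (arr C) (\<lambda>(a, b). comp C a b)"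

definition right_cancellative :: "('c, 'o) tcat \<Rightarrow> bool" where
  "right_cancellative C \<longleftrightarrow>
     (\<forall>a\<in>topspace (arr C). \<forall>b\<in>topspace (arr C). \<forall>c\<in>topspace (arr C).
        dom C a = cod C c \<and> dom C b = cod C c \<and> comp C a c = comp C b c \<longrightarrow> a = b)"

definition left_cancellative :: "('c, 'o) tcat \<Rightarrow> bool" where
  "left_cancellative C \<longleftrightarrow>
     (\<forall>a\<in>topspace (arr C). \<forall>b\<in>topspace (arr C). \<forall>c\<in>topspace (arr C).
        cod C a = dom C c \<and> cod C b = dom C c \<and> comp C c a = comp C c b \<longrightarrow> a = b)"

definition cancellative :: "('c, 'o) tcat \<Rightarrow> bool" where
  "cancellative C \<longleftrightarrow> left_cancellative C \<and> right_cancellative C"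

text \<open>A relational covering morphism is a pair \<open>(f\<^sub>1, f\<^sub>0)\<close>.\<close>

type_synonym ('c, 'o, 'd, 'p) rel_mor = "('c \<Rightarrow> 'd set) \<times> ('o \<Rightarrow> 'p)"

definition relational_covering ::
  "('c, 'o) tcat \<Rightarrow> ('d, 'p) tcat \<Rightarrow> ('c, 'o, 'd, 'p) rel_mor \<Rightarrow> bool" where
  "relational_covering C D = (\<lambda>(f1, f0).
     continuous_map (obj C) (obj D) f0 \<and>
     (\<forall>a\<in>topspace (arr C). f1 a \<subseteq> topspace (arr D)) \<and>
     (\<forall>a\<in>topspace (arr C). \<forall>b\<in>f1 a. dom D b = f0 (dom C a) \<and> cod D b = f0 (cod C a)) \<and>
     (\<forall>(a, b)\<in>topspace (composable C). \<forall>(s, t)\<in>topspace (composable D).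
        s \<in> f1 a \<and> t \<in> f1 b \<longrightarrow> comp D s t \<in> f1 (comp C a b)) \<and>
     (\<forall>a\<in>topspace (arr C). \<forall>b\<in>topspace (arr C).
        (dom C a = dom C b \<or> cod C a = cod C b) \<and> f1 a \<inter> f1 b \<noteq> {} \<longrightarrow> a = b) \<and>
     (\<forall>q\<in>topspace (obj C). \<forall>s\<in>topspace (arr D).
        (dom D s = f0 q \<longrightarrow> (\<exists>t\<in>topspace (arr C). dom C t = q \<and> s \<in> f1 t)) \<and>
        (cod D s = f0 q \<longrightarrow> (\<exists>t\<in>topspace (arr C). cod C t = q \<and> s \<in> f1 t))) \<and>
     (\<forall>A. openin (arr D) A \<longrightarrow> openin (arr C) {x \<in> topspace (arr C). f1 x \<inter> A \<noteq> {}}) \<and>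
     (\<forall>t\<in>topspace (obj C). unit D (f0 t) \<in> f1 (unit C t)))"

definition etale_mor ::
  "nat \<Rightarrow> ('c, 'o) tcat \<Rightarrow> ('d, 'p) tcat \<Rightarrow> ('c, 'o, 'd, 'p) rel_mor set" where
  "etale_mor k C D =
     {(f1, f0). f1 \<in> extensional (topspace (arr C)) \<and> f0 \<in> extensional (topspace (obj C)) \<and>
        relational_covering C D (f1, f0) \<and>
        (k \<in> {2, 4} \<longrightarrow> (\<forall>c\<in>topspace (arr C). f1 c \<noteq> {})) \<and>
        (k \<in> {3, 4} \<longrightarrow> (\<forall>c\<in>topspace (arr C). \<forall>s\<in>f1 c. \<forall>t\<in>f1 c. s = t))}"

definition rel_ide :: "('c, 'o) tcat \<Rightarrow> ('c, 'o, 'c, 'o) rel_mor" where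
  "rel_ide C = (restrict (\<lambda>a. {a}) (topspace (arr C)), restrict id (topspace (obj C)))"

definition rel_comp ::
  "('c, 'o) tcat \<Rightarrow> ('d, 'p, 'e, 'q) rel_mor \<Rightarrow> ('c, 'o, 'd, 'p) rel_mor \<Rightarrow> ('c, 'o, 'e, 'q) rel_mor"
where
  "rel_comp C g f =
     (restrict (\<lambda>a. \<Union>b\<in>fst f a. fst g b) (topspace (arr C)),
      compose (topspace (obj C)) (snd g) (snd f))"

text \<open>Small etale topological categories satisfying \<open>Q\<close>, with morphisms of type \<open>k\<close>.\<close>

definition ETALE ::
  "('u set \<Rightarrow> bool) \<Rightarrow> (('u, 'u) tcat \<Rightarrow> bool) \<Rightarrow> nat \<Rightarrow>
   (('u, 'u) tcat, ('u, 'u, 'u, 'u) rel_mor) cat" where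
  "ETALE small Q k =
     \<lparr>Obj = {C. small (topspace (arr C)) \<and> small (topspace (obj C)) \<and> etale C \<and> Q C},
      Mor = etale_mor k,
      Ide = rel_ide,
      Comp = (\<lambda>C D E g f. rel_comp C g f)\<rparr>"


section \<open>Open local bisections\<close>

definition bisections :: "('c, 'o) tcat \<Rightarrow> 'c set crm" where
  "bisections C =
     \<lparr>carrier = {A. openin (arr C) A \<and> inj_on (dom C) A \<and> inj_on (cod C) A},
      mult = (\<lambda>A B. {comp C a b | a b. a \<in> A \<and> b \<in> B \<and> dom C a = cod C b}),
      one = unit C ` topspace (obj C),
      Proj = {A. openin (arr C) A \<and> A \<subseteq> unit C ` topspace (obj C)},
      lam = (\<lambda>A. unit C ` dom C ` A),
      rho = (\<lambda>A. unit C ` cod C ` A)\<rparr>"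

definition crm_iso :: "'a crm \<Rightarrow> 'b crm \<Rightarrow> ('a \<Rightarrow> 'b) \<Rightarrow> bool" where
  "crm_iso S T \<phi> \<longleftrightarrow>
     \<phi> \<in> iso S T \<and> \<phi> ` Proj S = Proj T \<and>
     (\<forall>a\<in>carrier S. \<phi> (lam S a) = lam T (\<phi> a) \<and> \<phi> (rho S a) = rho T (\<phi> a))"

text \<open>A functor \<open>G\<close> from (a category of) etale categories to the opposite of complete
  restriction monoids is naturally isomorphic to the one taking open local bisections, which
  sends \<open>f : C \<rightarrow> D\<close> to the inverse image map \<open>A \<mapsto> {x. f\<^sub>1 x \<inter> A \<noteq> {}}\<close>. The monoid of
  bisections itself lives one power set higher than \<open>C\<close>, whence ``isomorphic''.\<close>

definition is_bisection_functor ::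
  "(('u, 'u) tcat, ('u, 'u, 'u, 'u) rel_mor) cat \<Rightarrow> (('u, 'u) tcat \<Rightarrow> 'u crm) \<Rightarrow>
   (('u, 'u) tcat \<Rightarrow> ('u, 'u) tcat \<Rightarrow> ('u, 'u, 'u, 'u) rel_mor \<Rightarrow> 'u \<Rightarrow> 'u) \<Rightarrow> bool" where
  "is_bisection_functor B G Gm \<longleftrightarrow>
     (\<exists>\<iota>. (\<forall>C\<in>Obj B. crm_iso (G C) (bisections C) (\<iota> C)) \<and>
          (\<forall>C\<in>Obj B. \<forall>D\<in>Obj B. \<forall>f\<in>Mor B C D. \<forall>x\<in>carrier (G D).
             \<iota> C (Gm C D f x) = {c \<in> topspace (arr C). fst f c \<inter> \<iota> D x \<noteq> {}}))"

end

theory Submission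
  imports Defs
begin

text \<open>
  The functor \<open>G\<close> sends an etale category \<open>C\<close> to its monoid of open local bisections and a
  relational covering to the inverse image map. Its adjoint \<open>F\<close> sends a complete restriction
  monoid \<open>S\<close> to its category of germs: the objects are the completely prime filters \<open>p\<close> of
  projections, and the arrows with domain \<open>p\<close> are the germs at \<open>p\<close> of the elements \<open>s\<close> with
  \<open>\<lambda> s \<in> p\<close>, where \<open>s\<close> and \<open>t\<close> have the same germ if \<open>s e = t e\<close> for some \<open>e \<in> p\<close>. The
  codomain of the germ of \<open>s\<close> is the filter of all \<open>f\<close> with \<open>\<lambda> (f s) \<in> p\<close>. It is completely
  prime because \<open>f \<mapsto> \<lambda> (f s)\<close> preserves joins, being a left adjoint up to restriction
  (\<open>l_mult_le_iff\<close>). The germs of one element form a bisection, and these bisections are a base of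
  the topology (\<open>etale_germ_cat\<close>).

  By \<open>dual_adjunction_of_universal_arrows\<close> it suffices to find, for each \<open>S\<close>, a universal
  morphism from \<open>S\<close> to the bisections of some category. It is the map \<open>\<eta>\<close> that sends \<open>s\<close> to the
  set of its germs (\<open>eta_crm_mor\<close>, \<open>eta_universal\<close>). Given a morphism \<open>\<phi>\<close> from \<open>S\<close> to the
  bisections of \<open>D\<close>, a relational covering \<open>f\<close> from \<open>D\<close> to the category of germs induces \<open>\<phi>\<close>
  precisely if \<open>f\<close> relates \<open>c\<close> to a germ of \<open>s\<close> whenever \<open>c \<in> \<phi> s\<close>, and only then. On units this
  says that \<open>f\<close> sends an object \<open>q\<close> to the filter of all projections \<open>e\<close> such that \<open>\<phi> e\<close> contains
  the unit at \<open>q\<close>. So \<open>f\<close> must relate \<open>c\<close> to the germs, at the filter of its domain, of the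
  elements \<open>s\<close> with \<open>c \<in> \<phi> s\<close>, and this formula does define a relational covering.

  The four types of morphisms match because they constrain the number of such germs: there is at
  least one for each \<open>c\<close> if the values of \<open>\<phi>\<close> cover \<open>D\<close>, which is properness, and at most one if
  \<open>\<phi>\<close> preserves meets, since a common germ of \<open>s\<close> and \<open>t\<close> is a germ of their meet. The map \<open>\<eta>\<close> is
  itself proper and preserves meets. The ampleness and cancellation conditions correspond to each
  other under both functors.

  A bisection is a set of arrows, and a germ is a set of elements, whereas the objects of the two
  categories all live on one type. Both constructions are therefore carried out relative to an
  injection of the subsets of a small set into that type.
\<close>

section \<open>Adjunctions from universal arrows\<close>

text \<open>A contravariant functor has a dual adjoint as soon as each object \<open>S\<close> of its target has
  a universal arrow \<open>\<eta> S\<close> into a value of the functor: the adjoint is then determined on morphisms,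
  and all its laws hold because both sides of each have the same image under the injective map
  \<open>f \<mapsto> G f \<circ> \<eta> S\<close>.\<close>

lemma dual_adjunction_of_universal_arrows:
  fixes X :: "('o, 'm) cat" and Z :: "('p, 'n) cat"
  assumes G: "is_functor X (opposite Z) G Gm"
    and Z: "is_category Z"
    and F: "\<And>S. S \<in> Obj Z \<Longrightarrow> F S \<in> Obj X"
    and \<eta>: "\<And>S. S \<in> Obj Z \<Longrightarrow> \<eta> S \<in> Mor Z S (G (F S))"
    and univ: "\<And>C S \<phi>. \<lbrakk>C \<in> Obj X; S \<in> Obj Z; \<phi> \<in> Mor Z S (G C)\<rbrakk> \<Longrightarrow>
       \<exists>!f. f \<in> Mor X C (F S) \<and> Comp Z S (G (F S)) (G C) (Gm C (F S) f) (\<eta> S) = \<phi>"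
  shows "\<exists>Fm \<Phi>. adjunction X (opposite Z) G Gm F Fm \<Phi>"
proof -
  let ?Y = "opposite Z"
  define ev where "ev C S f = Comp Z S (G (F S)) (G C) (Gm C (F S) f) (\<eta> S)" for C S f
  define \<Phi> where "\<Phi> C S \<phi> = (THE f. f \<in> Mor X C (F S) \<and> ev C S f = \<phi>)" for C S \<phi>
  define Fm where "Fm S T k = \<Phi> (F S) T (Comp Z T S (G (F S)) (\<eta> S) k)" for S T k
  have X: "is_category X" and Y: "is_category ?Y" using G unfolding is_functor_def by auto
  have Xc: "Comp X x y z g f \<in> Mor X x z"
    if "x \<in> Obj X" "y \<in> Obj X" "z \<in> Obj X" "f \<in> Mor X x y" "g \<in> Mor X y z" for x y z f g
    using X that unfolding is_category_def by blast
  have Xi: "Ide X x \<in> Mor X x x" if "x \<in> Obj X" for x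
    using X that unfolding is_category_def by blast
  have Zc: "Comp Z x y z g f \<in> Mor Z x z"
    if "x \<in> Obj Z" "y \<in> Obj Z" "z \<in> Obj Z" "f \<in> Mor Z x y" "g \<in> Mor Z y z" for x y z f g
    using Z that unfolding is_category_def by blast
  have Za: "Comp Z w y z h (Comp Z w x y g f) = Comp Z w x z (Comp Z x y z h g) f"
    if "w \<in> Obj Z" "x \<in> Obj Z" "y \<in> Obj Z" "z \<in> Obj Z"
      "f \<in> Mor Z w x" "g \<in> Mor Z x y" "h \<in> Mor Z y z" for w x y z f g h
    using Z that unfolding is_category_def by blast
  have Zi: "Comp Z x x y f (Ide Z x) = f" "Comp Z x y y (Ide Z y) f = f"
    if "x \<in> Obj Z" "y \<in> Obj Z" "f \<in> Mor Z x y" for x y f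
    using Z that unfolding is_category_def by blast+
  have GO: "G x \<in> Obj Z" if "x \<in> Obj X" for x
    using G that unfolding is_functor_def by (auto simp: opposite_def)
  have GM: "Gm x y f \<in> Mor Z (G y) (G x)" if "x \<in> Obj X" "y \<in> Obj X" "f \<in> Mor X x y" for x y f
    using G that unfolding is_functor_def by (auto simp: opposite_def)
  have GI: "Gm x x (Ide X x) = Ide Z (G x)" if "x \<in> Obj X" for x
    using G that unfolding is_functor_def by (auto simp: opposite_def)
  have GC: "Gm x z (Comp X x y z g f) = Comp Z (G z) (G y) (G x) (Gm x y f) (Gm y z g)"
    if "x \<in> Obj X" "y \<in> Obj X" "z \<in> Obj X" "f \<in> Mor X x y" "g \<in> Mor X y z" for x y z f g
    using G that unfolding is_functor_def by (auto simp: opposite_def)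
  have ev_mor: "ev C S f \<in> Mor Z S (G C)"
    if "C \<in> Obj X" "S \<in> Obj Z" "f \<in> Mor X C (F S)" for C S f
    unfolding ev_def using that by (intro Zc[of _ "G (F S)"] GO GM F \<eta>) auto
  have un: "\<exists>!f. f \<in> Mor X C (F S) \<and> ev C S f = \<phi>"
    if "C \<in> Obj X" "S \<in> Obj Z" "\<phi> \<in> Mor Z S (G C)" for C S \<phi>
    unfolding ev_def using univ that by blast
  have \<Phi>_mor: "\<Phi> C S \<phi> \<in> Mor X C (F S)" and ev_\<Phi>: "ev C S (\<Phi> C S \<phi>) = \<phi>"
    if "C \<in> Obj X" "S \<in> Obj Z" "\<phi> \<in> Mor Z S (G C)" for C S \<phi>
    using theI'[OF un[OF that]] unfolding \<Phi>_def by auto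
  have ev_inj: "f = g" if "C \<in> Obj X" "S \<in> Obj Z" "f \<in> Mor X C (F S)" "g \<in> Mor X C (F S)"
    "ev C S f = ev C S g" for C S f g
    using un[OF that(1,2) ev_mor[OF that(1,2,4)]] that by metis
  have ev_id: "ev (F S) S (Ide X (F S)) = \<eta> S" if "S \<in> Obj Z" for S
    unfolding ev_def using that by (simp add: GI Zi GO F \<eta>)
  have ev_comp: "ev C' S (Comp X C' C (F S) f h) = Comp Z S (G C) (G C') (Gm C' C h) (ev C S f)"
    if "C \<in> Obj X" "C' \<in> Obj X" "S \<in> Obj Z" "h \<in> Mor X C' C" "f \<in> Mor X C (F S)" for C C' S h f
    unfolding ev_def using that by (simp add: GC F Za[OF _ GO GO GO \<eta> GM GM])
  have Fm_mor: "Fm S T k \<in> Mor X (F S) (F T)" and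
    ev_Fm: "ev (F S) T (Fm S T k) = Comp Z T S (G (F S)) (\<eta> S) k"
    if "S \<in> Obj Z" "T \<in> Obj Z" "k \<in> Mor Z T S" for S T k
  proof -
    have m: "Comp Z T S (G (F S)) (\<eta> S) k \<in> Mor Z T (G (F S))"
      using that by (intro Zc[of _ S] GO F \<eta>)
    show "Fm S T k \<in> Mor X (F S) (F T)" "ev (F S) T (Fm S T k) = Comp Z T S (G (F S)) (\<eta> S) k"
      unfolding Fm_def using \<Phi>_mor ev_\<Phi> m F that by auto
  qed
  have ev_Fm_comp: "ev C T (Comp X C (F S) (F T) (Fm S T k) f) = Comp Z T S (G C) (ev C S f) k"
    if "C \<in> Obj X" "S \<in> Obj Z" "T \<in> Obj Z" "k \<in> Mor Z T S" "f \<in> Mor X C (F S)" for C S T k f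
  proof -
    have "ev C T (Comp X C (F S) (F T) (Fm S T k) f)
        = Comp Z T (G (F S)) (G C) (Gm C (F S) f) (Comp Z T S (G (F S)) (\<eta> S) k)"
      using that by (simp add: ev_comp F Fm_mor ev_Fm)
    also have "\<dots> = Comp Z T S (G C) (ev C S f) k"
      unfolding ev_def using that by (simp add: Za[OF _ _ GO GO _ \<eta> GM] F)
    finally show ?thesis .
  qed
  have "is_functor ?Y X F Fm"
    unfolding is_functor_def
  proof (intro conjI ballI X Y)
    fix S assume S: "S \<in> Obj ?Y"
    then have S: "S \<in> Obj Z" by (simp add: opposite_def)
    then show "F S \<in> Obj X" by (rule F)
    have i: "Ide Z S \<in> Mor Z S S" using Z S unfolding is_category_def by blast
    have "Fm S S (Ide Z S) = Ide X (F S)"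
      using S i by (intro ev_inj[of "F S" S]) (auto simp: F Fm_mor Xi ev_Fm ev_id Zi GO \<eta>)
    then show "Fm S S (Ide ?Y S) = Ide X (F S)" by (simp add: opposite_def)
  next
    fix S T k assume "S \<in> Obj ?Y" "T \<in> Obj ?Y" "k \<in> Mor ?Y S T"
    then show "Fm S T k \<in> Mor X (F S) (F T)" by (simp add: opposite_def Fm_mor)
  next
    fix S T U k k' assume "S \<in> Obj ?Y" "T \<in> Obj ?Y" "U \<in> Obj ?Y" "k \<in> Mor ?Y S T" "k' \<in> Mor ?Y T U"
    then have o: "S \<in> Obj Z" "T \<in> Obj Z" "U \<in> Obj Z" "k \<in> Mor Z T S" "k' \<in> Mor Z U T"
      by (auto simp: opposite_def)
    have "Fm S U (Comp Z U T S k k') = Comp X (F S) (F T) (F U) (Fm T U k') (Fm S T k)"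
      using o by (intro ev_inj[of "F S" U])
        (auto simp: F Fm_mor ev_Fm ev_Fm_comp Xc[of _ "F T"] Zc[of _ T] Za[OF _ _ _ GO _ _ \<eta>])
    then show "Fm S U (Comp ?Y S T U k' k) = Comp X (F S) (F T) (F U) (Fm T U k') (Fm S T k)"
      by (simp add: opposite_def)
  qed
  moreover have "bij_betw (\<Phi> C S) (Mor Z S (G C)) (Mor X C (F S))"
    if "C \<in> Obj X" "S \<in> Obj Z" for C S
  proof (rule bij_betw_byWitness[where f' = "ev C S"])
    show "\<forall>\<phi>\<in>Mor Z S (G C). ev C S (\<Phi> C S \<phi>) = \<phi>" using ev_\<Phi> that by blast
    show "\<forall>f\<in>Mor X C (F S). \<Phi> C S (ev C S f) = f"
      using ev_\<Phi> that ev_mor \<Phi>_mor by (metis ev_inj)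
  qed (use that ev_mor \<Phi>_mor in auto)
  moreover have "\<Phi> C' S' (Comp Z S' S (G C') (Comp Z S (G C) (G C') (Gm C' C h) g) k)
      = Comp X C' (F S) (F S') (Fm S S' k) (Comp X C' C (F S) (\<Phi> C S g) h)"
    if "C \<in> Obj X" "C' \<in> Obj X" "S \<in> Obj Z" "S' \<in> Obj Z" "h \<in> Mor X C' C" "g \<in> Mor Z S (G C)"
      "k \<in> Mor Z S' S" for C C' S S' h g k
  proof -
    have m: "Comp Z S (G C) (G C') (Gm C' C h) g \<in> Mor Z S (G C')"
      using that by (intro Zc[of _ "G C"] GO GM) auto
    then have m': "Comp Z S' S (G C') (Comp Z S (G C) (G C') (Gm C' C h) g) k \<in> Mor Z S' (G C')"
      using that by (intro Zc[of _ S] GO GM) auto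
    have x: "Comp X C' C (F S) (\<Phi> C S g) h \<in> Mor X C' (F S)"
      using that by (intro Xc[of _ C] F \<Phi>_mor) auto
    then have x': "Comp X C' (F S) (F S') (Fm S S' k) (Comp X C' C (F S) (\<Phi> C S g) h) \<in> Mor X C' (F S')"
      using that by (intro Xc[of _ "F S"] F Fm_mor) auto
    show ?thesis
      using that m m' x x'
      by (intro ev_inj[of C' S']) (auto simp: \<Phi>_mor ev_\<Phi> ev_Fm_comp ev_comp)
  qed
  ultimately have "adjunction X ?Y G Gm F Fm \<Phi>"
    unfolding adjunction_def using G by (auto simp: opposite_def)
  then show ?thesis by blast
qed

section \<open>Order in complete restriction monoids\<close>

lemma is_join_iff:
  assumes "X \<subseteq> carrier S"
  shows "is_join S t X \<longleftrightarrow> t \<in> carrier S \<and> (\<forall>x\<in>X. natural_le S x t) \<and>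
    (\<forall>u\<in>carrier S. (\<forall>x\<in>X. natural_le S x u) \<longrightarrow> natural_le S t u)"
proof -
  have "Upper (natural_order S) X = {u \<in> carrier S. \<forall>x\<in>X. natural_le S x u}"
    using assms by (auto simp: Upper_def natural_order_def)
  then show ?thesis unfolding is_join_def least_def by (auto simp: natural_order_def)
qed

lemma is_meet_iff:
  assumes "a \<in> carrier S" "b \<in> carrier S"
  shows "is_meet S m {a, b} \<longleftrightarrow> m \<in> carrier S \<and> natural_le S m a \<and> natural_le S m b \<and>
    (\<forall>u\<in>carrier S. natural_le S u a \<and> natural_le S u b \<longrightarrow> natural_le S u m)"
  using assms unfolding is_meet_def greatest_def Lower_def natural_order_def by auto

locale restriction_mon =
  fixes S :: "'a crm" (structure)
  assumes rm: "restriction_monoid S"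
begin

abbreviation E where "E \<equiv> Proj S"
abbreviation l where "l \<equiv> lam S"
abbreviation r where "r \<equiv> rho S"
abbreviation nle (infix "\<preceq>" 50) where "a \<preceq> b \<equiv> natural_le S a b"

lemma mon: "monoid S" and ehr: "ehresmann S"
  using rm unfolding restriction_monoid_def by auto

lemma mult_closed [simp]: "a \<in> carrier S \<Longrightarrow> b \<in> carrier S \<Longrightarrow> a \<otimes> b \<in> carrier S"
  using mon by (rule monoid.m_closed)

lemma one_closed [simp]: "\<one> \<in> carrier S"
  using mon by (rule monoid.one_closed)

lemma mult_one [simp]: "a \<in> carrier S \<Longrightarrow> a \<otimes> \<one> = a" "a \<in> carrier S \<Longrightarrow> \<one> \<otimes> a = a"
  using mon by (auto simp: monoid.l_one monoid.r_one)

lemma assoc: "a \<in> carrier S \<Longrightarrow> b \<in> carrier S \<Longrightarrow> c \<in> carrier S \<Longrightarrow> (a \<otimes> b) \<otimes> c = a \<otimes> (b \<otimes> c)"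
  using mon by (rule monoid.m_assoc)

lemma E_carrier [simp]: "e \<in> E \<Longrightarrow> e \<in> carrier S"
  using ehr unfolding ehresmann_def by blast

lemma lr_closed [simp]: "a \<in> carrier S \<Longrightarrow> l a \<in> E" "a \<in> carrier S \<Longrightarrow> r a \<in> E"
  using ehr unfolding ehresmann_def by blast+

lemma E_idem [simp]: "e \<in> E \<Longrightarrow> e \<otimes> e = e"
  using ehr unfolding ehresmann_def by blast

lemma E_mult [simp]: "e \<in> E \<Longrightarrow> f \<in> E \<Longrightarrow> e \<otimes> f \<in> E"
  using ehr unfolding ehresmann_def by blast

lemma E_comm: "e \<in> E \<Longrightarrow> f \<in> E \<Longrightarrow> e \<otimes> f = f \<otimes> e"
  using ehr unfolding ehresmann_def by blast

lemma lr_E [simp]: "e \<in> E \<Longrightarrow> l e = e" "e \<in> E \<Longrightarrow> r e = e"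
  using ehr unfolding ehresmann_def by blast+

lemma lr_absorb [simp]: "a \<in> carrier S \<Longrightarrow> a \<otimes> l a = a" "a \<in> carrier S \<Longrightarrow> r a \<otimes> a = a"
  using ehr unfolding ehresmann_def by blast+

lemma l_mult: "a \<in> carrier S \<Longrightarrow> b \<in> carrier S \<Longrightarrow> l (l a \<otimes> b) = l (a \<otimes> b)"
  using ehr unfolding ehresmann_def by blast

lemma r_mult: "a \<in> carrier S \<Longrightarrow> b \<in> carrier S \<Longrightarrow> r (a \<otimes> r b) = r (a \<otimes> b)"
  using ehr unfolding ehresmann_def by blast

lemma push_l: "a \<in> carrier S \<Longrightarrow> f \<in> E \<Longrightarrow> f \<otimes> a = a \<otimes> l (f \<otimes> a)"
  using rm unfolding restriction_monoid_def by blast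

lemma push_r: "a \<in> carrier S \<Longrightarrow> f \<in> E \<Longrightarrow> a \<otimes> f = r (a \<otimes> f) \<otimes> a"
  using rm unfolding restriction_monoid_def by blast

lemma one_E [simp]: "\<one> \<in> E"
  by (metis E_carrier lr_absorb(1) lr_closed(1) mult_one(2) one_closed)

lemma l_proj [simp]: "a \<in> carrier S \<Longrightarrow> e \<in> E \<Longrightarrow> l (a \<otimes> e) = l a \<otimes> e"
  by (metis E_carrier E_mult l_mult lr_E(1) lr_closed(1))

lemma r_proj [simp]: "a \<in> carrier S \<Longrightarrow> e \<in> E \<Longrightarrow> r (e \<otimes> a) = e \<otimes> r a"
  by (metis E_carrier E_mult r_mult lr_E(2) lr_closed(2))

lemma le_iff_r: "b \<in> carrier S \<Longrightarrow> a \<preceq> b \<longleftrightarrow> (\<exists>e\<in>E. a = b \<otimes> e)"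
  unfolding natural_le_def using push_r lr_closed(2) E_carrier mult_closed by metis

lemma le_iff_l: "b \<in> carrier S \<Longrightarrow> a \<preceq> b \<longleftrightarrow> (\<exists>e\<in>E. a = e \<otimes> b)"
  unfolding natural_le_def using push_l lr_closed(1) E_carrier mult_closed by metis

lemma le_l: "a \<in> carrier S \<Longrightarrow> b \<in> carrier S \<Longrightarrow> a \<preceq> b \<longleftrightarrow> a = b \<otimes> l a"
proof
  assume b: "b \<in> carrier S" and "a \<preceq> b"
  then obtain e where e: "e \<in> E" "a = b \<otimes> e" using le_iff_r by blast
  have "b \<otimes> l a = b \<otimes> (l b \<otimes> e)" using e b by simp
  also have "\<dots> = (b \<otimes> l b) \<otimes> e" using e b by (intro assoc[symmetric]) auto
  finally show "a = b \<otimes> l a" using e b by simp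
qed (use le_iff_r lr_closed in blast)

lemma le_r: "a \<in> carrier S \<Longrightarrow> b \<in> carrier S \<Longrightarrow> a \<preceq> b \<longleftrightarrow> a = r a \<otimes> b"
proof
  assume b: "b \<in> carrier S" and "a \<preceq> b"
  then obtain e where e: "e \<in> E" "a = e \<otimes> b" using le_iff_l by blast
  have "r a \<otimes> b = (e \<otimes> r b) \<otimes> b" using e b by simp
  also have "\<dots> = e \<otimes> (r b \<otimes> b)" using e b by (intro assoc) auto
  finally show "a = r a \<otimes> b" using e b by simp
qed (use le_iff_l lr_closed in blast)

lemma le_refl [simp]: "a \<in> carrier S \<Longrightarrow> a \<preceq> a"
  by (simp add: le_l)

lemma le_antisym: "a \<in> carrier S \<Longrightarrow> b \<in> carrier S \<Longrightarrow> a \<preceq> b \<Longrightarrow> b \<preceq> a \<Longrightarrow> a = b"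
proof -
  assume c: "a \<in> carrier S" "b \<in> carrier S" and "a \<preceq> b" "b \<preceq> a"
  then have ab: "a = b \<otimes> l a" and ba: "b = a \<otimes> l b" using le_l by blast+
  have "l a = l b \<otimes> l a" using arg_cong[OF ab, of l] c by simp
  moreover have "l b = l a \<otimes> l b" using arg_cong[OF ba, of l] c by simp
  ultimately have "l a = l b" using c E_comm lr_closed(1) by metis
  then show "a = b" using ab c by simp
qed

lemma le_trans: "a \<preceq> b \<Longrightarrow> b \<preceq> c \<Longrightarrow> c \<in> carrier S \<Longrightarrow> a \<preceq> c"
proof -
  assume "a \<preceq> b" "b \<preceq> c" and c: "c \<in> carrier S"
  then obtain e where e: "e \<in> E" "b = c \<otimes> e" using le_iff_r by blast
  then obtain f where f: "f \<in> E" "a = b \<otimes> f" using \<open>a \<preceq> b\<close> c le_iff_r[of b] by auto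
  then have "a = c \<otimes> (e \<otimes> f)" using e c by (simp add: assoc)
  then show "a \<preceq> c" using le_iff_r e f c E_mult by blast
qed

lemma le_closed: "a \<preceq> b \<Longrightarrow> b \<in> carrier S \<Longrightarrow> a \<in> carrier S"
  using le_iff_r by auto

lemma le_E_iff: "e \<in> E \<Longrightarrow> f \<in> E \<Longrightarrow> e \<preceq> f \<longleftrightarrow> e \<otimes> f = e"
  using le_r[of e f] by auto

lemma mult_le_l [simp]: "a \<in> carrier S \<Longrightarrow> e \<in> E \<Longrightarrow> e \<otimes> a \<preceq> a"
  using le_iff_l by blast

lemma mult_le_r [simp]: "a \<in> carrier S \<Longrightarrow> e \<in> E \<Longrightarrow> a \<otimes> e \<preceq> a"
  using le_iff_r by blast

lemma mult_mono:
  assumes "a \<preceq> a'" "b \<preceq> b'" "a' \<in> carrier S" "b' \<in> carrier S"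
  shows "a \<otimes> b \<preceq> a' \<otimes> b'"
proof -
  obtain e f where e: "e \<in> E" "a = e \<otimes> a'" and f: "f \<in> E" "b = b' \<otimes> f"
    using assms le_iff_l le_iff_r by metis
  have "a \<otimes> b = e \<otimes> ((a' \<otimes> b') \<otimes> f)"
    using e f assms by (simp add: assoc)
  moreover have "e \<otimes> ((a' \<otimes> b') \<otimes> f) \<preceq> (a' \<otimes> b') \<otimes> f" "(a' \<otimes> b') \<otimes> f \<preceq> a' \<otimes> b'"
    using e f assms by auto
  ultimately show ?thesis using le_trans assms by (metis mult_closed)
qed

lemma l_mono: "a \<preceq> b \<Longrightarrow> b \<in> carrier S \<Longrightarrow> l a \<preceq> l b"
  using le_iff_r by auto

lemma r_mono: "a \<preceq> b \<Longrightarrow> b \<in> carrier S \<Longrightarrow> r a \<preceq> r b"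
proof -
  assume "a \<preceq> b" and b: "b \<in> carrier S"
  then obtain e where "e \<in> E" "a = e \<otimes> b" using le_iff_l by blast
  then show "r a \<preceq> r b" using b by simp
qed

lemma E_le_glb: "e \<in> E \<Longrightarrow> f \<in> E \<Longrightarrow> g \<in> E \<Longrightarrow> g \<preceq> e \<otimes> f \<longleftrightarrow> g \<preceq> e \<and> g \<preceq> f"
proof -
  assume e: "e \<in> E" and f: "f \<in> E" and g: "g \<in> E"
  have "e \<otimes> f \<preceq> e" "e \<otimes> f \<preceq> f" using e f by auto
  moreover have "g \<preceq> e \<otimes> f" if "g \<preceq> e" "g \<preceq> f"
    using mult_mono[OF that] e f g by simp
  ultimately show ?thesis using le_trans e f E_carrier by meson
qed

lemma proj_partial_order: "partial_order (proj_order S)"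
  by unfold_locales (auto simp: proj_order_def intro: le_antisym le_trans)

lemma meet_E:
  assumes "e \<in> E" "f \<in> E"
  shows "e \<sqinter>\<^bsub>proj_order S\<^esub> f = e \<otimes> f"
proof -
  have "greatest (proj_order S) (e \<otimes> f) (Lower (proj_order S) {e, f})"
    using assms by (auto simp: greatest_def Lower_def E_le_glb proj_order_def)
  then show ?thesis unfolding meet_def inf_def
    using partial_order.greatest_unique[OF proj_partial_order] by (metis (mono_tags, lifting) someI_ex)
qed

lemma compatible_below:
  assumes "a \<preceq> c" "b \<preceq> c" "c \<in> carrier S"
  shows "compatible S a b"
proof -
  have c: "a \<in> carrier S" "b \<in> carrier S" using assms le_closed by auto
  have "a \<otimes> l b = c \<otimes> (l a \<otimes> l b)" "b \<otimes> l a = c \<otimes> (l b \<otimes> l a)"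
    using assms c le_l assoc lr_closed(1) E_carrier by metis+
  moreover have "r b \<otimes> a = (r b \<otimes> r a) \<otimes> c" "r a \<otimes> b = (r a \<otimes> r b) \<otimes> c"
    using assms c le_r assoc lr_closed(2) E_carrier by metis+
  ultimately show ?thesis unfolding compatible_def using c E_comm lr_closed by metis
qed

end

text \<open>A frame structure on the projections amounts to joins over which multiplication
  distributes: meets are products, and arbitrary meets are joins of lower bounds.\<close>

lemma is_frame_criterion:
  fixes S :: "'a crm" (structure)
  assumes "restriction_monoid S"
    and jn: "\<And>A. A \<subseteq> Proj S \<Longrightarrow> j A \<in> Proj S \<and> (\<forall>e\<in>Proj S. natural_le S (j A) e \<longleftrightarrow> (\<forall>a\<in>A. natural_le S a e))"
    and dist: "\<And>A e. A \<subseteq> Proj S \<Longrightarrow> e \<in> Proj S \<Longrightarrow> e \<otimes> j A = j ((\<lambda>a. e \<otimes> a) ` A)"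
  shows "is_frame (proj_order S)"
    and "A \<subseteq> Proj S \<Longrightarrow> \<Squnion>\<^bsub>proj_order S\<^esub> A = j A"
proof -
  interpret restriction_mon S by unfold_locales fact
  interpret L: partial_order "proj_order S" by (rule proj_partial_order)
  have le[simp]: "le (proj_order S) = natural_le S" and car[simp]: "carrier (proj_order S) = E"
    by (auto simp: proj_order_def)
  have up: "a \<preceq> j A" if "A \<subseteq> E" "a \<in> A" for a A
    using jn[OF that(1)] that E_carrier le_refl by blast
  have lub: "least (proj_order S) (j A) (Upper (proj_order S) A)" if "A \<subseteq> E" for A
    using that jn[OF that] up unfolding least_def Upper_def by auto
  show S: "\<Squnion>\<^bsub>proj_order S\<^esub> A = j A" if "A \<subseteq> E" for A
    using lub[OF that] L.least_unique unfolding sup_def by (metis (mono_tags, lifting) someI_ex)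
  have "complete_lattice (proj_order S)"
  proof (rule L.complete_latticeI)
    fix A assume A: "A \<subseteq> carrier (proj_order S)"
    show "\<exists>s. least (proj_order S) s (Upper (proj_order S) A)" using lub A by auto
    let ?B = "{e\<in>E. \<forall>a\<in>A. e \<preceq> a}"
    have "greatest (proj_order S) (j ?B) (Lower (proj_order S) A)"
      unfolding greatest_def Lower_def using A jn[of ?B] up[where A="?B"] by (auto simp: subset_iff)
    then show "\<exists>i. greatest (proj_order S) i (Lower (proj_order S) A)" by blast
  qed
  moreover have "(\<lambda>a. e \<sqinter>\<^bsub>proj_order S\<^esub> a) ` A = (\<lambda>a. e \<otimes> a) ` A" if "A \<subseteq> E" "e \<in> E" for A e
    using meet_E that by (intro image_cong) auto
  moreover have "(\<lambda>a. e \<otimes> a) ` A \<subseteq> E" if "A \<subseteq> E" "e \<in> E" for A e using that by auto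
  ultimately show "is_frame (proj_order S)"
    unfolding is_frame_def using S dist jn meet_E by auto
qed

locale complete_restriction_mon = restriction_mon +
  assumes crm: "complete_restriction_monoid S"
begin

abbreviation Lub ("\<Or>") where "\<Or> \<equiv> Lattice.sup (proj_order S)"

lemma frame: "is_frame (proj_order S)"
  using crm unfolding complete_restriction_monoid_def by blast

sublocale L: complete_lattice "proj_order S"
  using frame unfolding is_frame_def by blast

lemma Lub_closed [simp]: "A \<subseteq> E \<Longrightarrow> \<Or> A \<in> E"
  using L.sup_closed[of A] by (simp add: proj_order_def)

lemma Lub_upper: "A \<subseteq> E \<Longrightarrow> a \<in> A \<Longrightarrow> a \<preceq> \<Or> A"
  using L.sup_upper[of A] by (auto simp: proj_order_def)

lemma Lub_le_iff: "A \<subseteq> E \<Longrightarrow> e \<in> E \<Longrightarrow> \<Or> A \<preceq> e \<longleftrightarrow> (\<forall>a\<in>A. a \<preceq> e)"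
  using L.sup_least[of A e] L.sup_upper[of A] le_trans[of _ "\<Or> A" e]
  by (auto simp: proj_order_def Upper_def)

lemma top_E: "\<top>\<^bsub>proj_order S\<^esub> = \<one>"
proof -
  have t: "\<top>\<^bsub>proj_order S\<^esub> \<in> E" using L.top_closed by (simp add: proj_order_def)
  have "\<one> \<preceq> \<top>\<^bsub>proj_order S\<^esub>" using L.top_higher[of \<one>] by (simp add: proj_order_def)
  then show ?thesis using t by (simp add: le_E_iff)
qed

lemma bot_E: "\<bottom>\<^bsub>proj_order S\<^esub> = \<Or> {}"
  using L.sup_least[of "{}" "\<bottom>\<^bsub>proj_order S\<^esub>"] L.bottom_lower[of "\<Or> {}"] L.bottom_closed L.sup_closed[of "{}"]
  by (intro le_antisym) (auto simp: proj_order_def Upper_def)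

lemma Lub_dist: "A \<subseteq> E \<Longrightarrow> e \<in> E \<Longrightarrow> e \<otimes> \<Or> A = \<Or> ((\<lambda>a. e \<otimes> a) ` A)"
proof -
  assume A: "A \<subseteq> E" "e \<in> E"
  then have "e \<sqinter>\<^bsub>proj_order S\<^esub> \<Or> A = \<Or> ((\<lambda>a. e \<sqinter>\<^bsub>proj_order S\<^esub> a) ` A)"
    using frame unfolding is_frame_def by (auto simp: proj_order_def)
  moreover have "(\<lambda>a. e \<sqinter>\<^bsub>proj_order S\<^esub> a) ` A = (\<lambda>a. e \<otimes> a) ` A"
    using A meet_E by (intro image_cong) auto
  ultimately show ?thesis using A meet_E by simp
qed

lemma Lub_eqI:
  "A \<subseteq> E \<Longrightarrow> e \<in> E \<Longrightarrow> (\<And>a. a \<in> A \<Longrightarrow> a \<preceq> e) \<Longrightarrow>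
     (\<And>f. f \<in> E \<Longrightarrow> (\<And>a. a \<in> A \<Longrightarrow> a \<preceq> f) \<Longrightarrow> e \<preceq> f) \<Longrightarrow> \<Or> A = e"
  using Lub_le_iff[of A e] Lub_upper[of A] by (intro le_antisym) auto

lemma ex_join: "X \<subseteq> carrier S \<Longrightarrow> X \<noteq> {} \<Longrightarrow> (\<And>a b. a \<in> X \<Longrightarrow> b \<in> X \<Longrightarrow> compatible S a b) \<Longrightarrow> \<exists>t. is_join S t X"
  using crm unfolding complete_restriction_monoid_def by blast

text \<open>Restricting \<open>u\<close> to the join of the \<open>\<rho> x\<close> gives an upper bound of \<open>X\<close>; conversely, the join
  of a non-empty \<open>X\<close>, which exists once \<open>X\<close> is bounded, is a restriction of every upper bound.
  Hence joins below \<open>u\<close> can be computed in the frame of projections.\<close>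

lemma Lub_of_join:
  assumes X: "X \<subseteq> carrier S" and j: "is_join S u X"
  shows "\<Or> (r ` X) = r u"
proof -
  have u: "u \<in> carrier S" and ub: "\<And>x. x \<in> X \<Longrightarrow> x \<preceq> u"
    and lst: "\<And>v. v \<in> carrier S \<Longrightarrow> (\<And>x. x \<in> X \<Longrightarrow> x \<preceq> v) \<Longrightarrow> u \<preceq> v"
    using j is_join_iff[OF X] by auto
  have rX: "r ` X \<subseteq> E" using X by auto
  show ?thesis
  proof (rule Lub_eqI[OF rX])
    fix f assume f: "f \<in> E" and *: "\<And>a. a \<in> r ` X \<Longrightarrow> a \<preceq> f"
    have "x \<preceq> f \<otimes> u" if "x \<in> X" for x
    proof -
      have "x \<in> carrier S" using that X by blast
      have "x = r x \<otimes> u" using le_r ub that X u by blast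
      also have "\<dots> \<preceq> f \<otimes> u" using * that f u by (intro mult_mono) auto
      finally show ?thesis .
    qed
    then have "u \<preceq> f \<otimes> u" using lst f u by auto
    then have "r u \<preceq> f \<otimes> r u" using r_mono[of u "f \<otimes> u"] f u by simp
    then show "r u \<preceq> f" using E_le_glb f u lr_closed(2) by metis
  qed (use u ub r_mono lr_closed(2) in auto)
qed

lemma join_of_Lub:
  assumes X: "X \<noteq> {}" and u: "u \<in> carrier S" and ub: "\<And>x. x \<in> X \<Longrightarrow> x \<preceq> u"
    and L: "r u \<preceq> \<Or> (r ` X)"
  shows "is_join S u X"
proof -
  have Xc: "X \<subseteq> carrier S" using ub u le_closed by blast
  obtain t where t: "is_join S t X"
    using ex_join[OF Xc X] compatible_below ub u by blast
  then have tc: "t \<in> carrier S" and "t \<preceq> u" using is_join_iff[OF Xc] u ub by auto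
  moreover have "r u \<preceq> r t" using Lub_of_join[OF Xc t] L by simp
  ultimately have "r u = r t" "t = r t \<otimes> u"
    using le_antisym[of "r u" "r t"] r_mono[of t u] le_r[of t u] tc u by auto
  then have "t = u" using u lr_absorb(2) by metis
  then show ?thesis using t by simp
qed

text \<open>The map \<open>f \<mapsto> l (f \<otimes> a)\<close> on projections is, up to restriction to \<open>r a\<close>, left adjoint to
  \<open>e \<mapsto> r (a \<otimes> e)\<close>, and hence preserves joins. This is what transports completely prime
  filters along \<open>a\<close>.\<close>

lemma l_mult_le_iff:
  assumes "a \<in> carrier S" "f \<in> E" "e \<in> E"
  shows "l (f \<otimes> a) \<preceq> e \<longleftrightarrow> f \<otimes> r a \<preceq> r (a \<otimes> e)"
proof
  assume "l (f \<otimes> a) \<preceq> e"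
  then have "l (f \<otimes> a) \<otimes> e = l (f \<otimes> a)" using assms by (simp add: le_E_iff)
  then have "f \<otimes> a = f \<otimes> a \<otimes> e"
    using assms assoc[of "f \<otimes> a" "l (f \<otimes> a)" e] by simp
  also have "\<dots> \<preceq> a \<otimes> e" using assms by (simp add: assoc)
  finally have "r (f \<otimes> a) \<preceq> r (a \<otimes> e)" using assms by (intro r_mono) auto
  then show "f \<otimes> r a \<preceq> r (a \<otimes> e)" using assms by simp
next
  assume *: "f \<otimes> r a \<preceq> r (a \<otimes> e)"
  have "f \<otimes> a = (f \<otimes> r a) \<otimes> a" using assms by (simp add: assoc)
  also have "\<dots> \<preceq> r (a \<otimes> e) \<otimes> a" using assms * by (intro mult_mono) auto
  also have "r (a \<otimes> e) \<otimes> a = a \<otimes> e" using push_r assms by simp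
  finally have "l (f \<otimes> a) \<preceq> l (a \<otimes> e)" using assms by (intro l_mono) auto
  then show "l (f \<otimes> a) \<preceq> e" using assms E_le_glb by simp
qed

lemma l_mult_Lub:
  assumes a: "a \<in> carrier S" and F: "F \<subseteq> E"
  shows "l (\<Or> F \<otimes> a) = \<Or> ((\<lambda>f. l (f \<otimes> a)) ` F)"
proof -
  have c: "\<And>f. f \<in> F \<Longrightarrow> f \<in> E" using F by auto
  have d: "\<Or> F \<otimes> r a = \<Or> ((\<lambda>f. f \<otimes> r a) ` F)"
  proof -
    have "\<Or> F \<otimes> r a = r a \<otimes> \<Or> F" using F a E_comm by simp
    also have "\<dots> = \<Or> ((\<lambda>f. r a \<otimes> f) ` F)" using F a Lub_dist by simp
    also have "(\<lambda>f. r a \<otimes> f) ` F = (\<lambda>f. f \<otimes> r a) ` F" using c a E_comm by (intro image_cong) auto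
    finally show ?thesis .
  qed
  have i: "(\<lambda>f. f \<otimes> r a) ` F \<subseteq> E" using c a by auto
  have "l (\<Or> F \<otimes> a) \<preceq> e \<longleftrightarrow> (\<forall>f\<in>F. l (f \<otimes> a) \<preceq> e)" if e: "e \<in> E" for e
    using a F c e d by (simp add: l_mult_le_iff Lub_le_iff[OF i])
  note * = this
  have m: "(\<lambda>f. l (f \<otimes> a)) ` F \<subseteq> E" and m': "l (\<Or> F \<otimes> a) \<in> E" using a F c by auto
  show ?thesis
  proof (rule Lub_eqI[OF m m', symmetric])
    fix x assume "x \<in> (\<lambda>f. l (f \<otimes> a)) ` F"
    then show "x \<preceq> l (\<Or> F \<otimes> a)" using *[OF m'] m' by auto
  qed (use * in auto)
qed

text \<open>Two elements with a common lower bound have a meet, namely the join of the common lower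
  bounds.\<close>

lemma meet_exists:
  assumes a: "a \<in> carrier S" and b: "b \<in> carrier S" and c: "c \<preceq> a" "c \<preceq> b"
  shows "is_meet S (wedge S a b) {a, b}"
proof -
  let ?X = "{x. x \<preceq> a \<and> x \<preceq> b}"
  have X: "?X \<subseteq> carrier S" using le_closed a by blast
  obtain t where t: "is_join S t ?X"
    using ex_join[OF X] c compatible_below a by blast
  have m: "is_meet S t {a, b}"
    using t a b unfolding is_join_iff[OF X] is_meet_iff[OF a b] by auto
  moreover have "m' = t" if "is_meet S m' {a, b}" for m'
    using m that unfolding is_meet_iff[OF a b] using le_antisym by blast
  ultimately have "(THE m. is_meet S m {a, b}) = t" by blast
  then show ?thesis using m unfolding wedge_def by auto
qed

lemma wedge_cases:
  assumes a: "a \<in> carrier S" and b: "b \<in> carrier S"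
  shows "is_meet S (wedge S a b) {a, b} \<or> (\<nexists>c. c \<preceq> a \<and> c \<preceq> b) \<and> wedge S a b = \<Or> {}"
proof (cases "\<exists>c. c \<preceq> a \<and> c \<preceq> b")
  case True
  then show ?thesis using meet_exists a b by blast
next
  case False
  then have "\<not> (\<exists>m. is_meet S m {a, b})" using is_meet_iff[OF a b] by blast
  then show ?thesis using False bot_E unfolding wedge_def by auto
qed

end

text \<open>Reversing the product and exchanging \<open>\<lambda>\<close> and \<open>\<rho>\<close> changes neither the order nor the frame,
  which makes every statement available in two mirror-image forms.\<close>

definition op_crm :: "'a crm \<Rightarrow> 'a crm" where
  "op_crm S = \<lparr>carrier = carrier S, mult = (\<lambda>a b. b \<otimes>\<^bsub>S\<^esub> a), one = \<one>\<^bsub>S\<^esub>, Proj = Proj S,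
     lam = rho S, rho = lam S\<rparr>"

lemma op_crm_simps [simp]:
  "carrier (op_crm S) = carrier S" "mult (op_crm S) a b = b \<otimes>\<^bsub>S\<^esub> a" "one (op_crm S) = \<one>\<^bsub>S\<^esub>"
  "Proj (op_crm S) = Proj S" "lam (op_crm S) = rho S" "rho (op_crm S) = lam S"
  by (auto simp: op_crm_def)

lemma natural_le_op [simp]: "natural_le (op_crm S) = natural_le S"
  unfolding natural_le_def by (auto simp: fun_eq_iff)

lemma proj_order_op [simp]: "proj_order (op_crm S) = proj_order S"
  and natural_order_op [simp]: "natural_order (op_crm S) = natural_order S"
  unfolding proj_order_def natural_order_def by auto

lemma (in complete_restriction_mon) op: "complete_restriction_mon (op_crm S)"
proof -
  have "monoid (op_crm S)"
    by (rule monoidI) (auto simp: assoc)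
  moreover have "ehresmann (op_crm S)"
    unfolding ehresmann_def using lr_closed one_E
    by (auto simp: E_comm l_mult r_mult simp del: one_E)
  moreover have "f \<otimes> a = a \<otimes> l (f \<otimes> a)" "a \<otimes> f = r (a \<otimes> f) \<otimes> a" if "a \<in> carrier S" "f \<in> E" for a f
    using push_l push_r that by auto
  ultimately have r: "restriction_monoid (op_crm S)"
    unfolding restriction_monoid_def by auto
  have "compatible (op_crm S) a b = compatible S a b" for a b
    unfolding compatible_def by auto
  then have "complete_restriction_monoid (op_crm S)"
    using r crm unfolding complete_restriction_monoid_def is_join_def by auto
  with r show ?thesis by unfold_locales
qed

lemma complete_restriction_monI:
  "complete_restriction_monoid S \<Longrightarrow> complete_restriction_mon S"
  unfolding complete_restriction_monoid_def
  by unfold_locales (auto simp: complete_restriction_monoid_def)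

section \<open>Germs in a complete restriction monoid\<close>

definition cprime_filter :: "'a crm \<Rightarrow> 'a set \<Rightarrow> bool" where
  "cprime_filter S p \<longleftrightarrow> p \<subseteq> Proj S \<and> \<one>\<^bsub>S\<^esub> \<in> p \<and> (\<forall>e\<in>p. \<forall>f\<in>p. e \<otimes>\<^bsub>S\<^esub> f \<in> p) \<and>
     (\<forall>e\<in>p. \<forall>f\<in>Proj S. natural_le S e f \<longrightarrow> f \<in> p) \<and>
     (\<forall>A\<subseteq>Proj S. \<Squnion>\<^bsub>proj_order S\<^esub> A \<in> p \<longrightarrow> (\<exists>a\<in>A. a \<in> p))"

text \<open>The germ of \<open>a\<close> at \<open>p\<close> is the equivalence class of \<open>a\<close> under agreement near \<open>p\<close>. For
  \<open>lam S a \<in> p\<close> the filter \<open>p\<close> can be recovered from the class alone, as \<open>src\<close>, so that a bare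
  set of elements can serve as an arrow of the category of germs.\<close>

definition germ :: "'a crm \<Rightarrow> 'a set \<Rightarrow> 'a \<Rightarrow> 'a set" where
  "germ S p a = {b \<in> carrier S. \<exists>e\<in>p. a \<otimes>\<^bsub>S\<^esub> e = b \<otimes>\<^bsub>S\<^esub> e}"

definition is_germ :: "'a crm \<Rightarrow> 'a set \<Rightarrow> bool" where
  "is_germ S A \<longleftrightarrow> (\<exists>p a. cprime_filter S p \<and> a \<in> carrier S \<and> lam S a \<in> p \<and> A = germ S p a)"

definition src :: "'a crm \<Rightarrow> 'a set \<Rightarrow> 'a set" where
  "src S A = {e \<in> Proj S. \<exists>a\<in>A. a \<otimes>\<^bsub>S\<^esub> e = a}"

definition tgt :: "'a crm \<Rightarrow> 'a set \<Rightarrow> 'a set" where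
  "tgt S A = {e \<in> Proj S. \<exists>a\<in>A. e \<otimes>\<^bsub>S\<^esub> a = a}"

text \<open>The products of elements of two germs are only cofinal in the product germ: they need not
  form an upward closed set, whence the closure.\<close>

definition germ_mult :: "'a crm \<Rightarrow> 'a set \<Rightarrow> 'a set \<Rightarrow> 'a set" where
  "germ_mult S A B = {s \<in> carrier S. \<exists>a\<in>A. \<exists>b\<in>B. natural_le S (a \<otimes>\<^bsub>S\<^esub> b) s}"

context complete_restriction_mon
begin

lemma filterD:
  assumes "cprime_filter S p"
  shows "e \<in> p \<Longrightarrow> e \<in> E" "\<one> \<in> p" "e \<in> p \<Longrightarrow> f \<in> p \<Longrightarrow> e \<otimes> f \<in> p"
    "e \<in> p \<Longrightarrow> e \<preceq> f \<Longrightarrow> f \<in> E \<Longrightarrow> f \<in> p" "A \<subseteq> E \<Longrightarrow> \<Or> A \<in> p \<Longrightarrow> \<exists>a\<in>A. a \<in> p"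
  using assms unfolding cprime_filter_def by blast+

lemma filter_mult_iff: "cprime_filter S p \<Longrightarrow> e \<in> E \<Longrightarrow> f \<in> E \<Longrightarrow> e \<otimes> f \<in> p \<longleftrightarrow> e \<in> p \<and> f \<in> p"
  using filterD(3,4)[of p] mult_le_l[of f e] mult_le_r[of e f] by (metis E_carrier)

lemma germ_self [simp]: "cprime_filter S p \<Longrightarrow> a \<in> carrier S \<Longrightarrow> a \<in> germ S p a"
  unfolding germ_def using filterD(2) by auto

text \<open>Agreement near \<open>p\<close> is transitive, because two neighbourhoods in a filter have a common
  refinement; hence every element of a germ represents it.\<close>

lemma germ_mem:
  assumes p: "cprime_filter S p" and a: "a \<in> carrier S" "l a \<in> p" and b: "b \<in> germ S p a"
  shows "b \<in> carrier S" "l b \<in> p" "germ S p b = germ S p a"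
proof -
  obtain e where e: "e \<in> p" "a \<otimes> e = b \<otimes> e" and bc: "b \<in> carrier S"
    using b unfolding germ_def by blast
  have eE: "e \<in> E" using p e filterD(1) by blast
  have "l b \<otimes> e = l a \<otimes> e" using arg_cong[OF e(2), of l] a bc eE by simp
  then show "l b \<in> p" using filter_mult_iff[OF p] a bc e eE lr_closed(1) by metis
  have *: "x \<otimes> (f \<otimes> e) = y \<otimes> (f \<otimes> e)"
    if "x \<otimes> e = y \<otimes> e" "x \<in> carrier S" "y \<in> carrier S" "f \<in> E" for x y f
  proof -
    have "x \<otimes> (f \<otimes> e) = (x \<otimes> e) \<otimes> f" "y \<otimes> (f \<otimes> e) = (y \<otimes> e) \<otimes> f"
      using that(2-) eE E_comm[of f e] by (simp_all add: assoc)
    then show ?thesis using that by simp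
  qed
  have **: "x \<otimes> (f \<otimes> e) = y \<otimes> (f \<otimes> e)"
    if "x \<otimes> f = y \<otimes> f" "x \<in> carrier S" "y \<in> carrier S" "f \<in> E" for x y f
    using that eE by (simp add: assoc[symmetric])
  have "c \<in> germ S p b \<longleftrightarrow> c \<in> germ S p a" for c
  proof
    assume "c \<in> germ S p b"
    then obtain f where f: "f \<in> p" "b \<otimes> f = c \<otimes> f" "c \<in> carrier S" unfolding germ_def by blast
    then have "a \<otimes> (f \<otimes> e) = c \<otimes> (f \<otimes> e)"
      using *[OF e(2), of f] **[of b f c] a bc filterD(1)[OF p] by simp
    then show "c \<in> germ S p a" unfolding germ_def using f e filterD(3)[OF p] by blast
  next
    assume "c \<in> germ S p a"
    then obtain f where f: "f \<in> p" "a \<otimes> f = c \<otimes> f" "c \<in> carrier S" unfolding germ_def by blast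
    then have "b \<otimes> (f \<otimes> e) = c \<otimes> (f \<otimes> e)"
      using *[OF e(2), of f] **[of a f c] a bc filterD(1)[OF p] by simp
    then show "c \<in> germ S p b" unfolding germ_def using f e filterD(3)[OF p] by blast
  qed
  then show "germ S p b = germ S p a" by blast
  show "b \<in> carrier S" by (fact bc)
qed

lemma germ_restrict:
  assumes p: "cprime_filter S p" and a: "a \<in> carrier S" and e: "e \<in> p"
  shows "a \<otimes> e \<in> germ S p a"
  unfolding germ_def using assms filterD(1)[OF p e] by (auto simp: assoc intro!: bexI[of _ e])

lemma germ_up:
  assumes p: "cprime_filter S p" and a: "a \<in> carrier S" "l a \<in> p" and b: "b \<in> germ S p a"
    and c: "b \<preceq> c" "c \<in> carrier S"
  shows "c \<in> germ S p a"
proof -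
  note bp = germ_mem[OF p a b]
  have "b \<otimes> l b = c \<otimes> l b" using c bp le_l by simp
  then have "c \<in> germ S p b" unfolding germ_def using bp c by blast
  then show ?thesis using bp by simp
qed

lemma src_germ:
  assumes p: "cprime_filter S p" and a: "a \<in> carrier S" "l a \<in> p"
  shows "src S (germ S p a) = p"
proof (intro equalityI subsetI)
  fix e assume "e \<in> src S (germ S p a)"
  then obtain b where b: "e \<in> E" "b \<in> germ S p a" "b \<otimes> e = b" unfolding src_def by blast
  note bp = germ_mem[OF p a b(2)]
  have "l (b \<otimes> e) = l b \<otimes> e" using bp b(1) by simp
  then have "l b \<otimes> e = l b" using b(3) by simp
  then show "e \<in> p" using bp b filter_mult_iff[OF p, of "l b" e] by simp
next
  fix e assume e: "e \<in> p"
  then have "(a \<otimes> e) \<otimes> e = a \<otimes> e" using a filterD(1)[OF p e] by (simp add: assoc)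
  then show "e \<in> src S (germ S p a)"
    unfolding src_def using germ_restrict[OF p a(1) e] filterD(1)[OF p e] by blast
qed

text \<open>The element \<open>f \<otimes> a\<close> is the restriction of \<open>a\<close> to \<open>l (f \<otimes> a)\<close>, and so belongs to the germ of
  \<open>a\<close> at \<open>p\<close> exactly when \<open>l (f \<otimes> a) \<in> p\<close>.\<close>

lemma tgt_germ:
  assumes p: "cprime_filter S p" and a: "a \<in> carrier S" "l a \<in> p"
  shows "tgt S (germ S p a) = {f \<in> E. l (f \<otimes> a) \<in> p}"
proof (intro equalityI subsetI)
  fix f assume "f \<in> tgt S (germ S p a)"
  then obtain b where f: "f \<in> E" and b: "b \<in> germ S p a" "f \<otimes> b = b" unfolding tgt_def by blast
  then obtain e where e: "e \<in> p" "a \<otimes> e = b \<otimes> e" "b \<in> carrier S" unfolding germ_def by blast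
  have eE: "e \<in> E" using p e filterD(1) by blast
  have "(f \<otimes> a) \<otimes> e = f \<otimes> (b \<otimes> e)" using f a eE e by (simp add: assoc)
  also have "\<dots> = (f \<otimes> b) \<otimes> e" using f e eE by (simp add: assoc)
  also have "\<dots> = a \<otimes> e" using b e by simp
  finally have "l (f \<otimes> a) \<otimes> e = l a \<otimes> e" using arg_cong[of _ _ l] f a eE by (metis E_carrier l_proj mult_closed)
  then have "l (f \<otimes> a) \<in> p" using filter_mult_iff[OF p] f a e eE by (metis E_carrier lr_closed(1) mult_closed)
  then show "f \<in> {f \<in> E. l (f \<otimes> a) \<in> p}" using f by simp
next
  fix f assume "f \<in> {f \<in> E. l (f \<otimes> a) \<in> p}"
  then have f: "f \<in> E" "l (f \<otimes> a) \<in> p" by auto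
  then have "f \<otimes> a \<in> germ S p a" using germ_restrict[OF p a(1) f(2)] push_l a by simp
  moreover have "f \<otimes> (f \<otimes> a) = f \<otimes> a" using f a by (simp add: assoc[symmetric])
  ultimately show "f \<in> tgt S (germ S p a)" unfolding tgt_def using f by blast
qed

text \<open>Complete primality survives because \<open>f \<mapsto> l (f \<otimes> a)\<close> preserves joins. This is the
  codomain of the germ of \<open>a\<close> at \<open>p\<close>.\<close>

lemma filter_pull:
  assumes p: "cprime_filter S p" and a: "a \<in> carrier S" "l a \<in> p"
  shows "cprime_filter S {f \<in> E. l (f \<otimes> a) \<in> p}"
  unfolding cprime_filter_def
proof (intro conjI ballI allI impI)
  show "\<one> \<in> {f \<in> E. l (f \<otimes> a) \<in> p}" using a by simp
next
  fix e f assume "e \<in> {f \<in> E. l (f \<otimes> a) \<in> p}" "f \<in> {f \<in> E. l (f \<otimes> a) \<in> p}"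
  then have e: "e \<in> E" "l (e \<otimes> a) \<in> p" and f: "f \<in> E" "l (f \<otimes> a) \<in> p" by auto
  have "(e \<otimes> f) \<otimes> a = e \<otimes> (a \<otimes> l (f \<otimes> a))" using e f a push_l[of a f] by (simp add: assoc)
  also have "\<dots> = (e \<otimes> a) \<otimes> l (f \<otimes> a)" using e f a by (intro assoc[symmetric]) auto
  finally have "l ((e \<otimes> f) \<otimes> a) = l (e \<otimes> a) \<otimes> l (f \<otimes> a)" using e f a by simp
  then show "e \<otimes> f \<in> {f \<in> E. l (f \<otimes> a) \<in> p}" using e f filterD(3)[OF p] by simp
next
  fix e f assume "e \<in> {f \<in> E. l (f \<otimes> a) \<in> p}" and f: "f \<in> E" "e \<preceq> f"
  then have "l (e \<otimes> a) \<in> p" "l (e \<otimes> a) \<preceq> l (f \<otimes> a)" using a by (auto intro!: l_mono mult_mono)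
  then show "f \<in> {f \<in> E. l (f \<otimes> a) \<in> p}" using f a filterD(4)[OF p] by auto
next
  fix F assume F: "F \<subseteq> E" and "\<Or> F \<in> {f \<in> E. l (f \<otimes> a) \<in> p}"
  then have "\<Or> ((\<lambda>f. l (f \<otimes> a)) ` F) \<in> p" using a l_mult_Lub by simp
  moreover have "(\<lambda>f. l (f \<otimes> a)) ` F \<subseteq> E" using F a by auto
  ultimately show "\<exists>f\<in>F. f \<in> {f \<in> E. l (f \<otimes> a) \<in> p}" using filterD(5)[OF p] F by blast
qed auto

lemma germ_isI: "cprime_filter S p \<Longrightarrow> a \<in> carrier S \<Longrightarrow> l a \<in> p \<Longrightarrow> is_germ S (germ S p a)"
  unfolding is_germ_def by blast

lemma is_germD:
  assumes A: "is_germ S A"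
  shows "cprime_filter S (src S A)" "\<exists>a. a \<in> A" "cprime_filter S (tgt S A)"
    and "a \<in> A \<Longrightarrow> a \<in> carrier S" "a \<in> A \<Longrightarrow> l a \<in> src S A" "a \<in> A \<Longrightarrow> germ S (src S A) a = A"
    and "a \<in> A \<Longrightarrow> tgt S A = {f \<in> E. l (f \<otimes> a) \<in> src S A}"
    and "a \<in> A \<Longrightarrow> a \<preceq> b \<Longrightarrow> b \<in> carrier S \<Longrightarrow> b \<in> A"
    and "a \<in> A \<Longrightarrow> e \<in> src S A \<Longrightarrow> a \<otimes> e \<in> A"
proof -
  obtain p a0 where p: "cprime_filter S p" and a0: "a0 \<in> carrier S" "l a0 \<in> p" and g: "A = germ S p a0"
    using A unfolding is_germ_def by blast
  have s: "src S A = p" using src_germ p a0 g by simp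
  show "cprime_filter S (src S A)" "cprime_filter S (tgt S A)"
    using p s g a0 tgt_germ filter_pull by auto
  show "\<exists>a. a \<in> A" using p a0 g germ_self by blast
  show "a \<in> carrier S" if "a \<in> A" using that unfolding g germ_def by blast
  show la: "l a \<in> src S A" and gA: "germ S (src S A) a = A" if "a \<in> A"
    using that germ_mem[OF p a0] g s by auto
  show "tgt S A = {f \<in> E. l (f \<otimes> a) \<in> src S A}" if "a \<in> A"
    using that g tgt_germ[OF p germ_mem(1,2)[OF p a0]] germ_mem(3)[OF p a0] s by simp
  show "b \<in> A" if "a \<in> A" "a \<preceq> b" "b \<in> carrier S"
    using that g germ_up[OF p a0] by simp
  show "a \<otimes> e \<in> A" if "a \<in> A" "e \<in> src S A"
    using germ_restrict[OF p, of a e] gA[OF that(1)] germ_mem(1)[OF p a0, of a] that s g by simp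
qed

text \<open>A germ is determined by its source and one of its elements. Hence the domain map is
  injective on the germs containing a given element.\<close>

lemma germ_eq_src: "is_germ S A \<Longrightarrow> is_germ S B \<Longrightarrow> a \<in> A \<Longrightarrow> a \<in> B \<Longrightarrow> src S A = src S B \<Longrightarrow> A = B"
  by (metis is_germD(6))

lemma ex_germ_src:
  "cprime_filter S p \<Longrightarrow> a \<in> carrier S \<Longrightarrow> l a \<in> p \<Longrightarrow> \<exists>A. is_germ S A \<and> a \<in> A \<and> src S A = p"
  using germ_isI germ_self src_germ by blast

lemma cprime_filter_op [simp]: "cprime_filter (op_crm S) p \<longleftrightarrow> cprime_filter S p"
proof -
  have "(\<forall>e\<in>p. \<forall>f\<in>p. f \<otimes> e \<in> p) \<longleftrightarrow> (\<forall>e\<in>p. \<forall>f\<in>p. e \<otimes> f \<in> p)" by blast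
  then show ?thesis unfolding cprime_filter_def by simp
qed

text \<open>Two elements that agree when restricted on the right by \<open>e \<in> p\<close> also agree when restricted
  on the left by \<open>r (a \<otimes> e)\<close>. Thus a germ at \<open>src\<close> is also a germ, in the opposite monoid, at
  \<open>tgt\<close>.\<close>

lemma is_germ_op_imp:
  assumes A: "is_germ S A"
  shows "is_germ (op_crm S) A"
proof -
  obtain a where a: "a \<in> A" using is_germD(2)[OF A] by blast
  let ?p = "src S A" and ?q = "tgt S A"
  note p = is_germD(1)[OF A] and ac = is_germD(4,5)[OF A a] and q = is_germD(7)[OF A a]
  have "cprime_filter (op_crm S) ?q" using is_germD(3)[OF A] by simp
  moreover have "r a \<in> ?q" using q ac by simp
  moreover have "A = germ (op_crm S) ?q a"
  proof (intro equalityI subsetI)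
    fix b assume b: "b \<in> A"
    then have "b \<in> germ S ?p a" using is_germD(6)[OF A a] by simp
    then obtain e where e: "e \<in> ?p" "a \<otimes> e = b \<otimes> e" and bc: "b \<in> carrier S" unfolding germ_def by blast
    have eE: "e \<in> E" using p e filterD(1) by blast
    have f: "r (a \<otimes> e) \<otimes> a = a \<otimes> e" "r (a \<otimes> e) \<otimes> b = a \<otimes> e"
      using push_r[of a e] push_r[of b e] e ac bc eE by auto
    have "l (a \<otimes> e) \<in> ?p" using ac eE e(1) filterD(3)[OF p] by simp
    then have "l (r (a \<otimes> e) \<otimes> a) \<in> ?p" using f by simp
    then have "r (a \<otimes> e) \<in> ?q" using q ac eE by simp
    then show "b \<in> germ (op_crm S) ?q a" unfolding germ_def using f bc
      by (auto intro!: bexI[of _ "r (a \<otimes> e)"])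
  next
    fix b assume "b \<in> germ (op_crm S) ?q a"
    then obtain f where f: "f \<in> E" "l (f \<otimes> a) \<in> ?p" "f \<otimes> a = f \<otimes> b" and bc: "b \<in> carrier S"
      unfolding germ_def using q by auto
    then have "a \<otimes> l (f \<otimes> a) = b \<otimes> l (f \<otimes> a)" using push_l[of a f] push_l[of b f] ac by simp
    then have "b \<in> germ S ?p a" unfolding germ_def using bc f by blast
    then show "b \<in> A" using is_germD(6)[OF A a] by simp
  qed
  ultimately show ?thesis unfolding is_germ_def using ac by auto
qed

end

lemma op_crm_op_crm [simp]: "op_crm (op_crm S) = S"
  by (simp add: op_crm_def)

lemma src_tgt_op [simp]: "src (op_crm S) = tgt S" "tgt (op_crm S) = src S"
  by (auto simp: src_def tgt_def fun_eq_iff)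

context complete_restriction_mon
begin

lemma is_germ_op [simp]: "is_germ (op_crm S) A \<longleftrightarrow> is_germ S A"
  using is_germ_op_imp complete_restriction_mon.is_germ_op_imp[OF op, of A] by auto

lemma germ_eq_tgt: "is_germ S A \<Longrightarrow> is_germ S B \<Longrightarrow> a \<in> A \<Longrightarrow> a \<in> B \<Longrightarrow> tgt S A = tgt S B \<Longrightarrow> A = B"
  using complete_restriction_mon.germ_eq_src[OF op, of A B a] by simp

lemma ex_germ_tgt:
  "cprime_filter S p \<Longrightarrow> a \<in> carrier S \<Longrightarrow> r a \<in> p \<Longrightarrow> \<exists>A. is_germ S A \<and> a \<in> A \<and> tgt S A = p"
  using complete_restriction_mon.ex_germ_src[OF op, of p a] by simp

lemma r_tgt: "is_germ S A \<Longrightarrow> a \<in> A \<Longrightarrow> r a \<in> tgt S A"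
  using complete_restriction_mon.is_germD(5)[OF op, of A a] by simp

lemma tgt_germ_mult_left: "is_germ S A \<Longrightarrow> a \<in> A \<Longrightarrow> e \<in> tgt S A \<Longrightarrow> e \<otimes> a \<in> A"
  using complete_restriction_mon.is_germD(9)[OF op, of A a e] by simp

lemma germ_meet:
  assumes A: "is_germ S A" and a: "a \<in> A" and b: "b \<in> A"
  shows "\<exists>c\<in>A. c \<preceq> a \<and> c \<preceq> b"
proof -
  have "b \<in> germ S (src S A) a" using b is_germD(6)[OF A a] by simp
  then obtain e where e: "e \<in> src S A" "a \<otimes> e = b \<otimes> e" unfolding germ_def by blast
  then have "e \<in> E" using filterD(1) is_germD(1)[OF A] by blast
  then show ?thesis
    using e is_germD(4,9)[OF A] a b mult_le_r by (intro bexI[of _ "a \<otimes> e"]) metis+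
qed

text \<open>The product of germs is the germ of the product. The point is that it does not depend on
  the representatives: if \<open>a\<close>, \<open>a'\<close> agree after \<open>f\<close> and \<open>b\<close>, \<open>b'\<close> after \<open>e\<close>, then \<open>a \<otimes> b\<close> and
  \<open>a' \<otimes> b'\<close> agree after \<open>l (f \<otimes> b) \<otimes> e\<close>.\<close>

lemma germ_mult:
  assumes A: "is_germ S A" and B: "is_germ S B" and AB: "src S A = tgt S B"
    and a: "a \<in> A" and b: "b \<in> B"
  shows "l (a \<otimes> b) \<in> src S B" "germ_mult S A B = germ S (src S B) (a \<otimes> b)"
proof -
  let ?p = "src S B"
  note p = is_germD(1)[OF B] and ac = is_germD(4)[OF A] and bc = is_germD(4)[OF B]
  note fp = filterD(1)[OF p]
  have "l a \<in> tgt S B" using AB is_germD(5)[OF A a] by simp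
  then have "l (l a \<otimes> b) \<in> ?p" using is_germD(7)[OF B b] by simp
  then show lab: "l (a \<otimes> b) \<in> ?p" using l_mult ac[OF a] bc[OF b] by simp
  show "germ_mult S A B = germ S ?p (a \<otimes> b)"
  proof (intro equalityI subsetI)
    fix s assume "s \<in> germ_mult S A B"
    then obtain a' b' where s: "s \<in> carrier S" and a': "a' \<in> A" and b': "b' \<in> B" and le: "a' \<otimes> b' \<preceq> s"
      unfolding germ_mult_def by blast
    have "a' \<in> germ S (src S A) a" "b' \<in> germ S ?p b"
      using a a' b b' is_germD(6)[OF A] is_germD(6)[OF B] by blast+
    then obtain e f where e: "e \<in> ?p" "b \<otimes> e = b' \<otimes> e" and f: "f \<in> src S A" "a \<otimes> f = a' \<otimes> f"
      unfolding germ_def by blast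
    have fE: "f \<in> E" "l (f \<otimes> b) \<in> ?p" using f(1) AB is_germD(7)[OF B b] by auto
    have eE: "e \<in> E" using e fp by blast
    let ?e = "l (f \<otimes> b) \<otimes> e"
    have m: "x \<otimes> (l (f \<otimes> y) \<otimes> e) = f \<otimes> (y \<otimes> e)" if "x = y" "y \<in> carrier S" for x y
      using that fE eE push_l[of y f] by (simp add: assoc[symmetric])
    have "l (f \<otimes> b) \<otimes> e = l ((f \<otimes> b) \<otimes> e)" using fE eE bc b by simp
    also have "(f \<otimes> b) \<otimes> e = (f \<otimes> b') \<otimes> e" using fE eE bc b b' e by (simp add: assoc)
    also have "l ((f \<otimes> b') \<otimes> e) = l (f \<otimes> b') \<otimes> e" using fE eE bc b' by simp
    finally have l: "l (f \<otimes> b) \<otimes> e = l (f \<otimes> b') \<otimes> e" .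
    have "(a \<otimes> b) \<otimes> ?e = a \<otimes> (f \<otimes> (b \<otimes> e))"
      using m[of b b] ac[OF a] bc[OF b] fE eE by (simp add: assoc)
    also have "\<dots> = (a \<otimes> f) \<otimes> (b \<otimes> e)" using ac[OF a] bc[OF b] fE eE by (simp add: assoc)
    also have "\<dots> = (a' \<otimes> f) \<otimes> (b' \<otimes> e)" using e f by simp
    also have "\<dots> = a' \<otimes> (f \<otimes> (b' \<otimes> e))" using ac[OF a'] bc[OF b'] fE eE by (simp add: assoc)
    also have "\<dots> = (a' \<otimes> b') \<otimes> ?e"
      using m[of b' b'] ac[OF a'] bc[OF b'] fE eE l by (simp add: assoc)
    finally have "a' \<otimes> b' \<in> germ S ?p (a \<otimes> b)"
      unfolding germ_def using filterD(3)[OF p fE(2) e(1)] ac[OF a'] bc[OF b'] by auto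
    then show "s \<in> germ S ?p (a \<otimes> b)"
      using germ_up[OF p _ lab _ le s] ac[OF a] bc[OF b] by simp
  next
    fix s assume "s \<in> germ S ?p (a \<otimes> b)"
    then obtain e where s: "s \<in> carrier S" and e: "e \<in> ?p" "(a \<otimes> b) \<otimes> e = s \<otimes> e" unfolding germ_def by blast
    have "a \<otimes> (b \<otimes> e) = s \<otimes> e" using e fp[OF e(1)] ac[OF a] bc[OF b] by (simp add: assoc)
    then have "a \<otimes> (b \<otimes> e) \<preceq> s" using s fp[OF e(1)] by simp
    then show "s \<in> germ_mult S A B"
      unfolding germ_mult_def using s a is_germD(9)[OF B b e(1)] by blast
  qed
qed

lemma germ_mult_is_germ:
  assumes A: "is_germ S A" and B: "is_germ S B" and AB: "src S A = tgt S B"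
  shows "is_germ S (germ_mult S A B)" "src S (germ_mult S A B) = src S B"
    "tgt S (germ_mult S A B) = tgt S A" "a \<in> A \<Longrightarrow> b \<in> B \<Longrightarrow> a \<otimes> b \<in> germ_mult S A B"
proof -
  obtain a0 b0 where a: "a0 \<in> A" and b: "b0 \<in> B" using is_germD(2) A B by blast
  note g = germ_mult[OF A B AB a b]
  note p = is_germD(1)[OF B] and ac = is_germD(4)[OF A a] and bc = is_germD(4)[OF B b]
  show "is_germ S (germ_mult S A B)" "src S (germ_mult S A B) = src S B"
    using g germ_isI[OF p] src_germ[OF p] ac bc by auto
  have "tgt S (germ_mult S A B) = {f \<in> E. l (f \<otimes> (a0 \<otimes> b0)) \<in> src S B}"
    using g tgt_germ[OF p] ac bc by simp
  also have "\<dots> = {f \<in> E. l (l (f \<otimes> a0) \<otimes> b0) \<in> src S B}"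
  proof (intro Collect_cong conj_cong refl)
    fix f assume "f \<in> E"
    then show "(l (f \<otimes> (a0 \<otimes> b0)) \<in> src S B) = (l (l (f \<otimes> a0) \<otimes> b0) \<in> src S B)"
      using ac bc l_mult[of "f \<otimes> a0" b0] by (simp add: assoc)
  qed
  also have "\<dots> = {f \<in> E. l (f \<otimes> a0) \<in> tgt S B}"
    unfolding is_germD(7)[OF B b] using ac by auto
  also have "\<dots> = tgt S A" unfolding AB[symmetric] by (rule is_germD(7)[OF A a, symmetric])
  finally show "tgt S (germ_mult S A B) = tgt S A" .
  show "a \<otimes> b \<in> germ_mult S A B" if "a \<in> A" "b \<in> B"
  proof -
    have "a \<otimes> b \<in> carrier S" using that is_germD(4) A B by auto
    then show ?thesis using that le_refl[of "a \<otimes> b"] unfolding germ_mult_def by blast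
  qed
qed

lemma germ_one:
  assumes p: "cprime_filter S p"
  shows "is_germ S (germ S p \<one>)" "src S (germ S p \<one>) = p" "tgt S (germ S p \<one>) = p" "e \<in> p \<Longrightarrow> e \<in> germ S p \<one>"
  using germ_isI[OF p, of \<one>] src_germ[OF p, of \<one>] tgt_germ[OF p, of \<one>] filterD(1,2)[OF p]
    germ_restrict[OF p, of \<one> e]
  by auto

text \<open>A germ represented by a projection is a unit, since a projection \<open>e\<close> agrees with \<open>\<one>\<close> on \<open>e\<close>.\<close>

lemma germ_of_projection:
  assumes A: "is_germ S A" and e: "e \<in> A" "e \<in> E"
  shows "A = germ S (src S A) \<one>" "e \<in> src S A"
proof -
  show e': "e \<in> src S A" using is_germD(5)[OF A e(1)] e by simp
  show "A = germ S (src S A) \<one>"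
    using germ_eq_src[OF A germ_one(1)[OF is_germD(1)[OF A]] e(1)] germ_one(2,4)[OF is_germD(1)[OF A]] e' by simp
qed

end

section \<open>The etale category of germs\<close>

text \<open>Both spaces of the category of germs carry a topology given by a base that is closed under
  intersection only up to refinement.\<close>

definition base_topology :: "'a set \<Rightarrow> 'a set set \<Rightarrow> 'a topology" where
  "base_topology X B = topology (\<lambda>V. V \<subseteq> X \<and> (\<forall>x\<in>V. \<exists>N\<in>B. x \<in> N \<and> N \<subseteq> V))"

definition base_of :: "'a set \<Rightarrow> 'a set set \<Rightarrow> bool" where
  "base_of X B \<longleftrightarrow> \<Union>B = X \<and> (\<forall>M\<in>B. \<forall>N\<in>B. \<forall>x\<in>M \<inter> N. \<exists>K\<in>B. x \<in> K \<and> K \<subseteq> M \<inter> N)"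

lemma openin_base_topology:
  assumes "base_of X B"
  shows "openin (base_topology X B) V \<longleftrightarrow> V \<subseteq> X \<and> (\<forall>x\<in>V. \<exists>N\<in>B. x \<in> N \<and> N \<subseteq> V)"
proof -
  have "istopology (\<lambda>V. V \<subseteq> X \<and> (\<forall>x\<in>V. \<exists>N\<in>B. x \<in> N \<and> N \<subseteq> V))"
    unfolding istopology_def
  proof (intro conjI allI impI)
    fix U V assume U: "U \<subseteq> X \<and> (\<forall>x\<in>U. \<exists>N\<in>B. x \<in> N \<and> N \<subseteq> U)"
      and V: "V \<subseteq> X \<and> (\<forall>x\<in>V. \<exists>N\<in>B. x \<in> N \<and> N \<subseteq> V)"
    show "U \<inter> V \<subseteq> X" using U by blast
    show "\<forall>x\<in>U \<inter> V. \<exists>N\<in>B. x \<in> N \<and> N \<subseteq> U \<inter> V"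
    proof
      fix x assume x: "x \<in> U \<inter> V"
      then obtain M N where M: "M \<in> B" "x \<in> M" "M \<subseteq> U" and N: "N \<in> B" "x \<in> N" "N \<subseteq> V"
        using U V by blast
      then obtain K where "K \<in> B" "x \<in> K" "K \<subseteq> M \<inter> N" using assms unfolding base_of_def by blast
      then show "\<exists>N\<in>B. x \<in> N \<and> N \<subseteq> U \<inter> V" using M N by blast
    qed
  next
    fix K assume "\<forall>V\<in>K. V \<subseteq> X \<and> (\<forall>x\<in>V. \<exists>N\<in>B. x \<in> N \<and> N \<subseteq> V)"
    then show "\<Union>K \<subseteq> X" "\<forall>x\<in>\<Union>K. \<exists>N\<in>B. x \<in> N \<and> N \<subseteq> \<Union>K" by (blast, meson Union_iff Union_upper order_trans)
  qed
  then show ?thesis unfolding base_topology_def by simp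
qed

lemma topspace_base_topology:
  assumes "base_of X B" shows "topspace (base_topology X B) = X"
proof -
  have "openin (base_topology X B) X" using assms unfolding openin_base_topology[OF assms] base_of_def by blast
  then show ?thesis using openin_base_topology[OF assms] openin_subset
    by (metis openin_topspace subset_antisym)
qed

lemma openin_base: "base_of X B \<Longrightarrow> N \<in> B \<Longrightarrow> openin (base_topology X B) N"
  by (auto simp: openin_base_topology) (auto simp: base_of_def)

lemma continuous_map_baseI:
  assumes "base_of Y B" "f \<in> topspace X \<rightarrow> Y"
    and "\<And>N x. N \<in> B \<Longrightarrow> x \<in> topspace X \<Longrightarrow> f x \<in> N \<Longrightarrow> \<exists>M. openin X M \<and> x \<in> M \<and> f ` M \<subseteq> N"
  shows "continuous_map X (base_topology Y B) f"
  unfolding continuous_map topspace_base_topology[OF assms(1)]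
proof (intro conjI allI impI)
  fix V assume V: "openin (base_topology Y B) V"
  show "openin X {x \<in> topspace X. f x \<in> V}"
  proof (subst openin_subopen, intro ballI)
    fix x assume "x \<in> {x \<in> topspace X. f x \<in> V}"
    then have x: "x \<in> topspace X" "f x \<in> V" by auto
    then obtain N where N: "N \<in> B" "f x \<in> N" "N \<subseteq> V"
      using V openin_base_topology[OF assms(1)] by metis
    obtain M where "openin X M" "x \<in> M" "f ` M \<subseteq> N" using assms(3)[OF N(1) x(1) N(2)] by metis
    moreover from this(3) have "f ` M \<subseteq> V" using N(3) by (rule subset_trans)
    ultimately show "\<exists>T. openin X T \<and> x \<in> T \<and> T \<subseteq> {x \<in> topspace X. f x \<in> V}"
      using openin_subset[of X M] by (intro exI[of _ M]) auto
  qed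
qed (use assms(2) in auto)

lemma open_map_baseI:
  assumes "base_of X B" "\<And>N. N \<in> B \<Longrightarrow> openin Y (f ` N)"
  shows "open_map (base_topology X B) Y f"
  unfolding open_map_def
proof (intro allI impI)
  fix V assume V: "openin (base_topology X B) V"
  show "openin Y (f ` V)"
  proof (subst openin_subopen, intro ballI)
    fix y assume "y \<in> f ` V"
    then obtain x N where "x \<in> V" "y = f x" "N \<in> B" "x \<in> N" "N \<subseteq> V"
      using V openin_base_topology[OF assms(1)] by blast
    then show "\<exists>T. openin Y T \<and> y \<in> T \<and> T \<subseteq> f ` V" using assms(2) by (intro exI[of _ "f ` N"]) blast
  qed
qed

text \<open>A continuous open map is a local homeomorphism once it is locally injective. This is the form in
  which the domain and codomain maps of the category of germs are checked.\<close>

lemma local_homeomorphismI: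
  assumes c: "continuous_map X Y f" and o: "open_map X Y f"
    and i: "\<And>x. x \<in> topspace X \<Longrightarrow> \<exists>U. openin X U \<and> x \<in> U \<and> inj_on f U"
  shows "local_homeomorphism X Y f"
  unfolding local_homeomorphism_def
proof (intro conjI ballI)
  show "f \<in> topspace X \<rightarrow> topspace Y" using c by (simp add: continuous_map_def)
  fix x assume "x \<in> topspace X"
  then obtain U where U: "openin X U" "x \<in> U" "inj_on f U" using i by blast
  have UX: "U \<subseteq> topspace X" using U openin_subset by blast
  have fU: "openin Y (f ` U)" using o U unfolding open_map_def by blast
  have "homeomorphic_map (subtopology X U) (subtopology Y (f ` U)) f"
  proof (rule bijective_open_imp_homeomorphic_map)
    show "continuous_map (subtopology X U) (subtopology Y (f ` U)) f"
      using c UX by (auto simp: continuous_map_in_subtopology continuous_map_from_subtopology)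
    show "open_map (subtopology X U) (subtopology Y (f ` U)) f"
      using o U fU unfolding open_map_def by (auto simp: openin_open_subtopology)
    show "f ` topspace (subtopology X U) = topspace (subtopology Y (f ` U))"
      using UX openin_subset[OF fU] by (auto simp: topspace_subtopology)
    show "inj_on f (topspace (subtopology X U))"
      using U by (simp add: topspace_subtopology inj_on_def)
  qed
  then show "\<exists>U. openin X U \<and> x \<in> U \<and> openin Y (f ` U) \<and> homeomorphic_map (subtopology X U) (subtopology Y (f ` U)) f"
    using U fU by blast
qed

text \<open>Sets of elements are stored as points of a type that need not have room for all of them:
  \<open>j\<close> is injective on the subsets of \<open>D\<close>, and \<open>decode\<close> is its inverse.\<close>

definition decode :: "('a set \<Rightarrow> 'b) \<Rightarrow> 'a set \<Rightarrow> 'b \<Rightarrow> 'a set" where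
  "decode j D = inv_into (Pow D) j"

lemma decode [simp]: "inj_on j (Pow D) \<Longrightarrow> A \<subseteq> D \<Longrightarrow> decode j D (j A) = A"
  unfolding decode_def by (simp add: inv_into_f_f)

definition germ_cat :: "('a set \<Rightarrow> 'b) \<Rightarrow> 'a crm \<Rightarrow> ('b, 'b) tcat" where
  "germ_cat j S = \<lparr>
     arr = base_topology (j ` {A. is_germ S A}) ((\<lambda>s. j ` {A. is_germ S A \<and> s \<in> A}) ` carrier S),
     obj = base_topology (j ` {p. cprime_filter S p}) ((\<lambda>e. j ` {p. cprime_filter S p \<and> e \<in> p}) ` Proj S),
     unit = (\<lambda>x. j (germ S (decode j (carrier S) x) \<one>\<^bsub>S\<^esub>)),
     dom = (\<lambda>x. j (src S (decode j (carrier S) x))),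
     cod = (\<lambda>x. j (tgt S (decode j (carrier S) x))),
     comp = (\<lambda>x y. j (germ_mult S (decode j (carrier S) x) (decode j (carrier S) y)))\<rparr>"

locale germs = complete_restriction_mon +
  fixes j :: "'a set \<Rightarrow> 'b"
  assumes j: "inj_on j (Pow (carrier S))"
begin

abbreviation U where "U s \<equiv> j ` {A. is_germ S A \<and> s \<in> A}"
abbreviation V where "V e \<equiv> j ` {p. cprime_filter S p \<and> e \<in> p}"

lemma germ_sub: "is_germ S A \<Longrightarrow> A \<subseteq> carrier S"
  using is_germD(4) by blast

lemma filter_sub: "cprime_filter S p \<Longrightarrow> p \<subseteq> carrier S"
  using filterD(1) by auto

lemma decode_germ [simp]: "is_germ S A \<Longrightarrow> decode j (carrier S) (j A) = A"
  using j germ_sub by simp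

lemma decode_filter [simp]: "cprime_filter S p \<Longrightarrow> decode j (carrier S) (j p) = p"
  using j filter_sub by simp

lemma j_germ_eq: "is_germ S A \<Longrightarrow> is_germ S B \<Longrightarrow> j A = j B \<longleftrightarrow> A = B"
  by (metis decode_germ)

lemma j_filter_eq: "cprime_filter S p \<Longrightarrow> cprime_filter S q \<Longrightarrow> j p = j q \<longleftrightarrow> p = q"
  by (metis decode_filter)

lemma in_U [simp]: "is_germ S A \<Longrightarrow> j A \<in> U s \<longleftrightarrow> s \<in> A"
  using j_germ_eq by blast

lemma in_V [simp]: "cprime_filter S p \<Longrightarrow> j p \<in> V e \<longleftrightarrow> e \<in> p"
  using j_filter_eq by blast

lemma base_U: "base_of (j ` {A. is_germ S A}) (U ` carrier S)"
  unfolding base_of_def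
proof (intro conjI ballI)
  show "\<Union> (U ` carrier S) = j ` {A. is_germ S A}"
  proof (intro equalityI subsetI)
    fix x assume "x \<in> j ` {A. is_germ S A}"
    then obtain A where A: "is_germ S A" "x = j A" by blast
    then obtain a where "a \<in> A" using is_germD(2) by blast
    then show "x \<in> \<Union> (U ` carrier S)" using A is_germD(4) by (intro UN_I[of a]) auto
  qed auto
  fix M N x assume "M \<in> U ` carrier S" "N \<in> U ` carrier S" "x \<in> M \<inter> N"
  then obtain s t A where s: "M = U s" "N = U t" "s \<in> carrier S" "t \<in> carrier S"
    and A: "is_germ S A" "x = j A" "s \<in> A" "t \<in> A"
    using in_U by blast
  then obtain m where m: "m \<in> A" "m \<preceq> s" "m \<preceq> t" using germ_meet by blast
  have "U m \<subseteq> U s \<inter> U t" using is_germD(8) s m by blast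
  then show "\<exists>K\<in>U ` carrier S. x \<in> K \<and> K \<subseteq> M \<inter> N"
    using A s m is_germD(4) by (intro bexI[of _ "U m"]) auto
qed

lemma base_V: "base_of (j ` {p. cprime_filter S p}) (V ` E)"
  unfolding base_of_def
proof (intro conjI ballI)
  show "\<Union> (V ` E) = j ` {p. cprime_filter S p}"
    using filterD(2) one_E by blast
  fix M N x assume "M \<in> V ` E" "N \<in> V ` E" "x \<in> M \<inter> N"
  then obtain e f p where s: "M = V e" "N = V f" "e \<in> E" "f \<in> E"
    and p: "cprime_filter S p" "x = j p" "e \<in> p" "f \<in> p"
    using in_V by blast
  have "V (e \<otimes> f) \<subseteq> V e \<inter> V f" using filter_mult_iff s by blast
  then show "\<exists>K\<in>V ` E. x \<in> K \<and> K \<subseteq> M \<inter> N"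
    using p s filter_mult_iff by (intro bexI[of _ "V (e \<otimes> f)"]) auto
qed

abbreviation C where "C \<equiv> germ_cat j S"

lemma C_simps:
  "cprime_filter S p \<Longrightarrow> unit C (j p) = j (germ S p \<one>)"
  "is_germ S A \<Longrightarrow> dom C (j A) = j (src S A)"
  "is_germ S A \<Longrightarrow> cod C (j A) = j (tgt S A)"
  "is_germ S A \<Longrightarrow> is_germ S B \<Longrightarrow> comp C (j A) (j B) = j (germ_mult S A B)"
  by (auto simp: germ_cat_def)

lemma dom_eq_cod [simp]:
  "is_germ S A \<Longrightarrow> is_germ S B \<Longrightarrow> dom C (j A) = cod C (j B) \<longleftrightarrow> src S A = tgt S B"
  using C_simps j_filter_eq is_germD(1,3) by simp

lemma arr_C: "arr C = base_topology (j ` {A. is_germ S A}) (U ` carrier S)"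
  and obj_C: "obj C = base_topology (j ` {p. cprime_filter S p}) (V ` E)"
  by (auto simp: germ_cat_def)

lemma topspace_C [simp]:
  "topspace (arr C) = j ` {A. is_germ S A}" "topspace (obj C) = j ` {p. cprime_filter S p}"
  unfolding arr_C obj_C by (simp_all add: topspace_base_topology base_U base_V)

lemma open_U: "s \<in> carrier S \<Longrightarrow> openin (arr C) (U s)"
  and open_V: "e \<in> E \<Longrightarrow> openin (obj C) (V e)"
  unfolding arr_C obj_C by (auto intro: openin_base base_U base_V)

lemma topspace_composable_C:
  "topspace (composable C) = {(j A, j B) | A B. is_germ S A \<and> is_germ S B \<and> src S A = tgt S B}"
  unfolding composable_def by (auto simp: topspace_subtopology) blast

lemma dom_U: "s \<in> carrier S \<Longrightarrow> dom C ` U s = V (l s)"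
proof (intro equalityI subsetI)
  fix x assume s: "s \<in> carrier S" and "x \<in> V (l s)"
  then obtain p where p: "cprime_filter S p" "x = j p" "l s \<in> p" by blast
  then obtain A where "is_germ S A" "s \<in> A" "src S A = p" using ex_germ_src s by blast
  then show "x \<in> dom C ` U s" using p C_simps(2) by (intro image_eqI[of _ _ "j A"]) auto
qed (auto simp: C_simps is_germD(1,5))

lemma cod_U: "s \<in> carrier S \<Longrightarrow> cod C ` U s = V (r s)"
proof (intro equalityI subsetI)
  fix x assume s: "s \<in> carrier S" and "x \<in> V (r s)"
  then obtain p where p: "cprime_filter S p" "x = j p" "r s \<in> p" by blast
  then obtain A where "is_germ S A" "s \<in> A" "tgt S A = p" using ex_germ_tgt s by blast
  then show "x \<in> cod C ` U s" using p C_simps(3) by (intro image_eqI[of _ _ "j A"]) auto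
qed (auto simp: C_simps is_germD(3) r_tgt)

lemma unit_V: "e \<in> E \<Longrightarrow> unit C ` V e = U e"
proof (intro equalityI subsetI)
  fix x assume e: "e \<in> E" and "x \<in> U e"
  then obtain A where A: "is_germ S A" "x = j A" "e \<in> A" by blast
  note g = germ_of_projection[OF A(1,3) e]
  have "x = unit C (j (src S A))" using A g is_germD(1) C_simps(1) by metis
  then show "x \<in> unit C ` V e" using g A is_germD(1) by blast
next
  fix x assume "x \<in> unit C ` V e"
  then show "x \<in> U e" using germ_one C_simps(1) by force
qed

text \<open>A germ of \<open>s \<otimes> t\<close> factors: take the germ of \<open>t\<close> at the given source, and then the germ of
  \<open>s\<close> at the target of the former. Thus composition is open.\<close>

lemma comp_U:
  assumes s: "s \<in> carrier S" "t \<in> carrier S"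
  shows "(\<lambda>(a, b). comp C a b) ` ((U s \<times> U t) \<inter> topspace (composable C)) = U (s \<otimes> t)"
proof (intro equalityI subsetI)
  fix x assume "x \<in> (\<lambda>(a, b). comp C a b) ` ((U s \<times> U t) \<inter> topspace (composable C))"
  then obtain A B where "is_germ S A" "is_germ S B" "src S A = tgt S B" "s \<in> A" "t \<in> B"
    "x = comp C (j A) (j B)"
    unfolding topspace_composable_C using j_germ_eq by auto
  then show "x \<in> U (s \<otimes> t)" using C_simps(4) germ_mult_is_germ by auto
next
  fix x assume "x \<in> U (s \<otimes> t)"
  then obtain D where D: "is_germ S D" "x = j D" "s \<otimes> t \<in> D" by blast
  let ?p = "src S D"
  note p = is_germD(1)[OF D(1)]
  have st: "l (s \<otimes> t) \<in> ?p" using is_germD(5) D by blast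
  have "l (s \<otimes> t) \<preceq> l t" using s l_mono[of "l s \<otimes> t" t] l_mult[of s t] by simp
  then have "l t \<in> ?p" using filterD(4)[OF p st] s by simp
  then obtain B where B: "is_germ S B" "t \<in> B" "src S B = ?p" using ex_germ_src[OF p s(2)] by blast
  have "l s \<in> tgt S B" using is_germD(7)[OF B(1,2)] s st l_mult B(3) by simp
  then obtain A where A: "is_germ S A" "s \<in> A" "src S A = tgt S B"
    using ex_germ_src[OF is_germD(3)[OF B(1)] s(1)] by blast
  note g = germ_mult_is_germ[OF A(1) B(1) A(3)]
  have "germ_mult S A B = D" using germ_eq_src[OF g(1) D(1) g(4)[OF A(2) B(2)] D(3)] g(2) B(3) by simp
  then have "x = comp C (j A) (j B)" using C_simps(4) A B D by simp
  then show "x \<in> (\<lambda>(a, b). comp C a b) ` ((U s \<times> U t) \<inter> topspace (composable C))"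
    unfolding topspace_composable_C using A B by (intro image_eqI[of _ _ "(j A, j B)"]) auto
qed

lemma inj_dom_U: "inj_on (dom C) (U s)"
proof (rule inj_onI)
  fix x y assume "x \<in> U s" "y \<in> U s" "dom C x = dom C y"
  then obtain A B where "is_germ S A" "is_germ S B" "s \<in> A" "s \<in> B" "x = j A" "y = j B" "dom C (j A) = dom C (j B)"
    by auto
  moreover from this have "src S A = src S B" using C_simps(2) j_filter_eq is_germD(1) by metis
  ultimately show "x = y" using germ_eq_src by metis
qed

lemma inj_cod_U: "inj_on (cod C) (U s)"
proof (rule inj_onI)
  fix x y assume "x \<in> U s" "y \<in> U s" "cod C x = cod C y"
  then obtain A B where "is_germ S A" "is_germ S B" "s \<in> A" "s \<in> B" "x = j A" "y = j B" "cod C (j A) = cod C (j B)"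
    by auto
  moreover from this have "tgt S A = tgt S B" using C_simps(3) j_filter_eq is_germD(3) by metis
  ultimately show "x = y" using germ_eq_tgt by metis
qed

lemma ex_U: "x \<in> topspace (arr C) \<Longrightarrow> \<exists>s\<in>carrier S. x \<in> U s"
proof -
  assume "x \<in> topspace (arr C)"
  then have "x \<in> \<Union> (U ` carrier S)" using base_U unfolding base_of_def topspace_C by (metis (lifting))
  then show ?thesis by (rule UN_E) blast
qed

lemma topological_category_germ_cat: "topological_category C"
  unfolding topological_category_def
proof (intro conjI)
  show "continuous_map (obj C) (arr C) (unit C)"
    unfolding arr_C
  proof (rule continuous_map_baseI[OF base_U])
    show "unit C \<in> topspace (obj C) \<rightarrow> j ` {A. is_germ S A}"
      using C_simps(1) germ_one(1) by auto
    fix N x assume "N \<in> U ` carrier S" "x \<in> topspace (obj C)" "unit C x \<in> N"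
    then obtain s p where s: "s \<in> carrier S" "N = U s" and p: "cprime_filter S p" "x = j p"
      and x: "unit C x \<in> U s" by auto
    have "j (germ S p \<one>) \<in> U s" using x p C_simps(1) by simp
    then have "s \<in> germ S p \<one>" using in_U[OF germ_one(1)[OF p(1)]] by blast
    note p = p this
    then obtain e where e: "e \<in> p" "\<one> \<otimes> e = s \<otimes> e" unfolding germ_def by blast
    then have "e \<in> E" using filterD(1) p by blast
    then have "e \<preceq> s" using e s by (metis mult_le_r mult_one(2) E_carrier)
    then have "U e \<subseteq> U s" using is_germD(8) s by blast
    then show "\<exists>M. openin (obj C) M \<and> x \<in> M \<and> unit C ` M \<subseteq> N"
      using s p e open_V unit_V \<open>e \<in> E\<close> by (intro exI[of _ "V e"]) auto
  qed
  show "continuous_map (arr C) (obj C) (dom C)"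
    unfolding obj_C
  proof (rule continuous_map_baseI[OF base_V])
    show "dom C \<in> topspace (arr C) \<rightarrow> j ` {p. cprime_filter S p}" using C_simps(2) is_germD(1) by auto
    fix N x assume "N \<in> V ` E" "x \<in> topspace (arr C)" "dom C x \<in> N"
    then obtain e A where e: "e \<in> E" "N = V e" and A: "is_germ S A" "x = j A"
      and x: "dom C x \<in> V e" by auto
    have "j (src S A) \<in> V e" using x A C_simps(2) by simp
    then have "e \<in> src S A" using in_V[OF is_germD(1)[OF A(1)]] by blast
    note A = A this
    then obtain a where a: "a \<in> A" "a \<otimes> e = a" unfolding src_def by blast
    then have "dom C ` U a \<subseteq> N" using C_simps(2) is_germD(1) e unfolding src_def by force
    then show "\<exists>M. openin (arr C) M \<and> x \<in> M \<and> dom C ` M \<subseteq> N"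
      using a A open_U is_germD(4) by (intro exI[of _ "U a"]) auto
  qed
  show "continuous_map (arr C) (obj C) (cod C)"
    unfolding obj_C
  proof (rule continuous_map_baseI[OF base_V])
    show "cod C \<in> topspace (arr C) \<rightarrow> j ` {p. cprime_filter S p}" using C_simps(3) is_germD(3) by auto
    fix N x assume "N \<in> V ` E" "x \<in> topspace (arr C)" "cod C x \<in> N"
    then obtain e A where e: "e \<in> E" "N = V e" and A: "is_germ S A" "x = j A"
      and x: "cod C x \<in> V e" by auto
    have "j (tgt S A) \<in> V e" using x A C_simps(3) by simp
    then have "e \<in> tgt S A" using in_V[OF is_germD(3)[OF A(1)]] by blast
    note A = A this
    then obtain a where a: "a \<in> A" "e \<otimes> a = a" unfolding tgt_def by blast
    then have "cod C ` U a \<subseteq> N" using C_simps(3) is_germD(3) e unfolding tgt_def by force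
    then show "\<exists>M. openin (arr C) M \<and> x \<in> M \<and> cod C ` M \<subseteq> N"
      using a A open_U is_germD(4) by (intro exI[of _ "U a"]) auto
  qed
  show "continuous_map (composable C) (arr C) (\<lambda>(a, b). comp C a b)"
    unfolding arr_C
  proof (rule continuous_map_baseI[OF base_U])
    show "(\<lambda>(a, b). comp C a b) \<in> topspace (composable C) \<rightarrow> j ` {A. is_germ S A}"
      unfolding topspace_composable_C using C_simps(4) germ_mult_is_germ(1) by auto
    fix N x assume "N \<in> U ` carrier S" "x \<in> topspace (composable C)" "(\<lambda>(a, b). comp C a b) x \<in> N"
    then obtain s A B where s: "s \<in> carrier S" "N = U s"
      and A: "is_germ S A" "is_germ S B" "src S A = tgt S B" "x = (j A, j B)"
      and x: "comp C (j A) (j B) \<in> U s"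
      unfolding topspace_composable_C by auto
    have "j (germ_mult S A B) \<in> U s" using x A C_simps(4) by simp
    then have "s \<in> germ_mult S A B" using in_U[OF germ_mult_is_germ(1)[OF A(1-3)]] by blast
    note A = A this
    then obtain a b where a: "a \<in> A" "b \<in> B" "a \<otimes> b \<preceq> s" unfolding germ_mult_def by blast
    then have ab: "a \<in> carrier S" "b \<in> carrier S" using A is_germD(4) by blast+
    have "U (a \<otimes> b) \<subseteq> U s" using a s is_germD(8) by blast
    moreover have o: "openin (prod_topology (arr C) (arr C)) (U a \<times> U b)"
      using open_U ab by (simp add: openin_prod_Times_iff)
    have "openin (composable C) ((U a \<times> U b) \<inter> topspace (composable C))"
      using o openin_subset[OF o] unfolding composable_def openin_subtopology topspace_subtopology by blast
    ultimately show "\<exists>M. openin (composable C) M \<and> x \<in> M \<and> (\<lambda>(a, b). comp C a b) ` M \<subseteq> N"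
      using comp_U[OF ab] s A a unfolding topspace_composable_C
      by (intro exI[of _ "(U a \<times> U b) \<inter> topspace (composable C)"]) (auto simp: topspace_composable_C)
  qed
  show "\<forall>x\<in>topspace (obj C). dom C (unit C x) = x \<and> cod C (unit C x) = x"
    using C_simps germ_one by auto
  show "\<forall>(a, b)\<in>topspace (composable C). dom C (comp C a b) = dom C b \<and> cod C (comp C a b) = cod C a"
    unfolding topspace_composable_C using C_simps germ_mult_is_germ by auto
  show "\<forall>a\<in>topspace (arr C). comp C a (unit C (dom C a)) = a \<and> comp C (unit C (cod C a)) a = a"
  proof
    fix x assume "x \<in> topspace (arr C)"
    then obtain A where A: "is_germ S A" "x = j A" by auto
    obtain a where a: "a \<in> A" using is_germD(2) A by blast
    note p = is_germD(1)[OF A(1)] and q = is_germD(3)[OF A(1)]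
    have ac: "a \<in> carrier S" using is_germD(4) A a by blast
    have "germ_mult S A (germ S (src S A) \<one>) = A"
      using germ_mult(2)[OF A(1) germ_one(1)[OF p] _ a germ_self[OF p one_closed]] germ_one[OF p] ac
        is_germD(6)[OF A(1) a] by simp
    moreover have "germ_mult S (germ S (tgt S A) \<one>) A = A"
      using germ_mult(2)[OF germ_one(1)[OF q] A(1) _ germ_self[OF q one_closed] a] germ_one[OF q] ac
        is_germD(6)[OF A(1) a] by simp
    ultimately show "comp C x (unit C (dom C x)) = x \<and> comp C (unit C (cod C x)) x = x"
      using A p q germ_one by (simp add: C_simps)
  qed
  show "\<forall>a\<in>topspace (arr C). \<forall>b\<in>topspace (arr C). \<forall>c\<in>topspace (arr C).
        dom C a = cod C b \<and> dom C b = cod C c \<longrightarrow> comp C (comp C a b) c = comp C a (comp C b c)"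
  proof (intro ballI impI)
    fix x y z assume "x \<in> topspace (arr C)" "y \<in> topspace (arr C)" "z \<in> topspace (arr C)"
      "dom C x = cod C y \<and> dom C y = cod C z"
    then obtain A B D where A: "is_germ S A" "x = j A" and B: "is_germ S B" "y = j B"
      and D: "is_germ S D" "z = j D" and e: "src S A = tgt S B" "src S B = tgt S D" by auto
    obtain a b d where a: "a \<in> A" "b \<in> B" "d \<in> D"
      using is_germD(2)[OF A(1)] is_germD(2)[OF B(1)] is_germD(2)[OF D(1)] by blast
    note AB = germ_mult_is_germ[OF A(1) B(1) e(1)] and BD = germ_mult_is_germ[OF B(1) D(1) e(2)]
    have "germ_mult S (germ_mult S A B) D = germ S (src S D) ((a \<otimes> b) \<otimes> d)"
      using germ_mult(2)[OF AB(1) D(1) _ AB(4)[OF a(1,2)] a(3)] AB e by simp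
    moreover have "germ_mult S A (germ_mult S B D) = germ S (src S D) (a \<otimes> (b \<otimes> d))"
      using germ_mult(2)[OF A(1) BD(1) _ a(1) BD(4)[OF a(2,3)]] BD e by simp
    moreover have "a \<in> carrier S" "b \<in> carrier S" "d \<in> carrier S" using A B D a is_germD(4) by blast+
    ultimately show "comp C (comp C x y) z = comp C x (comp C y z)"
      using A B D AB BD by (simp add: C_simps assoc)
  qed
qed

lemma etale_germ_cat: "etale C"
proof -
  note t = topological_category_germ_cat
  have d: "open_map (arr C) (obj C) (dom C)" "open_map (arr C) (obj C) (cod C)"
    unfolding arr_C by (rule open_map_baseI[OF base_U]; use dom_U cod_U open_V in auto)+
  have u: "open_map (obj C) (arr C) (unit C)"
    unfolding obj_C by (rule open_map_baseI[OF base_V]) (use unit_V open_U in auto)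
  have m: "open_map (composable C) (arr C) (\<lambda>(a, b). comp C a b)"
    unfolding open_map_def
  proof (intro allI impI, subst openin_subopen, intro ballI)
    fix W z assume W: "openin (composable C) W" and z: "z \<in> (\<lambda>(a, b). comp C a b) ` W"
    then obtain x y where xy: "(x, y) \<in> W" "z = comp C x y" by auto
    obtain W' where W': "openin (prod_topology (arr C) (arr C)) W'" "W = W' \<inter> {(a, b). dom C a = cod C b}"
      using W unfolding composable_def openin_subtopology by blast
    have "(x, y) \<in> W'" using W'(2) xy(1) by blast
    then obtain X Y where X: "openin (arr C) X" "openin (arr C) Y" "x \<in> X" "y \<in> Y" "X \<times> Y \<subseteq> W'"
      using W'(1)[unfolded openin_prod_topology_alt] by metis
    then obtain s t where s: "s \<in> carrier S" "x \<in> U s" "U s \<subseteq> X" and t: "t \<in> carrier S" "y \<in> U t" "U t \<subseteq> Y"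
      unfolding arr_C openin_base_topology[OF base_U] by blast
    have "(U s \<times> U t) \<inter> topspace (composable C) \<subseteq> W"
      using s t X W' unfolding composable_def topspace_subtopology by blast
    then have "U (s \<otimes> t) \<subseteq> (\<lambda>(a, b). comp C a b) ` W" using comp_U[OF s(1) t(1)] by blast
    moreover have "(x, y) \<in> (U s \<times> U t) \<inter> topspace (composable C)"
      using xy s t openin_subset[OF W] by blast
    then have "z \<in> U (s \<otimes> t)" using comp_U[OF s(1) t(1)] xy by force
    ultimately show "\<exists>T. openin (arr C) T \<and> z \<in> T \<and> T \<subseteq> (\<lambda>(a, b). comp C a b) ` W"
      using open_U s t by (intro exI[of _ "U (s \<otimes> t)"]) auto
  qed
  have "local_homeomorphism (arr C) (obj C) (dom C)" "local_homeomorphism (arr C) (obj C) (cod C)"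
    using t d ex_U open_U inj_dom_U inj_cod_U unfolding topological_category_def
    by (meson local_homeomorphismI)+
  then show ?thesis unfolding etale_def using t u m by blast
qed

text \<open>Representatives of equal products agree after restriction, so left ampleness cancels the
  representative \<open>d\<close> up to the factor \<open>l d\<close>. This factor belongs to the common codomain of the two
  germs and does not change them. The right-handed version is the mirror image.\<close>

lemma left_cancellative_germ_cat:
  assumes "left_ample S" shows "left_cancellative C"
  unfolding left_cancellative_def
proof (intro ballI impI)
  fix x y z assume "x \<in> topspace (arr C)" "y \<in> topspace (arr C)" "z \<in> topspace (arr C)"
    and xyz: "cod C x = dom C z \<and> cod C y = dom C z \<and> comp C z x = comp C z y"
  then obtain A B D where A: "is_germ S A" "x = j A" and B: "is_germ S B" "y = j B"
    and D: "is_germ S D" "z = j D" by auto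
  have e: "dom C (j D) = cod C (j A)" "dom C (j D) = cod C (j B)" "comp C (j D) (j A) = comp C (j D) (j B)"
    using xyz A(2) B(2) D(2) by simp_all
  have e': "src S D = tgt S A" "src S D = tgt S B"
    using e(1,2) dom_eq_cod[OF D(1) A(1)] dom_eq_cod[OF D(1) B(1)] by blast+
  note DA = germ_mult_is_germ[OF D(1) A(1) e'(1)] and DB = germ_mult_is_germ[OF D(1) B(1) e'(2)]
  have m: "germ_mult S D A = germ_mult S D B" using e A B D DA DB by (simp add: C_simps j_germ_eq)
  then have sAB: "src S A = src S B" using DA DB by simp
  obtain a b d where a: "a \<in> A" "b \<in> B" "d \<in> D"
      using is_germD(2)[OF A(1)] is_germD(2)[OF B(1)] is_germD(2)[OF D(1)] by blast
  then have c: "a \<in> carrier S" "b \<in> carrier S" "d \<in> carrier S" using A B D is_germD(4) by blast+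
  have "d \<otimes> b \<in> germ S (src S A) (d \<otimes> a)"
    using germ_mult(2)[OF D(1) A(1) e'(1) a(3,1)] DB(4)[OF a(3,2)] m by simp
  then obtain e where e: "e \<in> src S A" "(d \<otimes> a) \<otimes> e = (d \<otimes> b) \<otimes> e" unfolding germ_def by blast
  have eE: "e \<in> E" using e A filterD(1)[OF is_germD(1)] by blast
  have "d \<otimes> (a \<otimes> e) = d \<otimes> (b \<otimes> e)" using e c eE by (simp add: assoc)
  then have eq: "l d \<otimes> (a \<otimes> e) = l d \<otimes> (b \<otimes> e)"
    using assms[unfolded left_ample_def, rule_format, of "a \<otimes> e" "b \<otimes> e" d] c eE by simp
  have ld: "l d \<in> tgt S A" "l d \<in> tgt S B" using is_germD(5)[OF D(1) a(3)] e' by auto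
  have "a \<otimes> e \<in> A" "b \<otimes> e \<in> B" using is_germD(9) A B a e sAB by auto
  then have "l d \<otimes> (a \<otimes> e) \<in> A" "l d \<otimes> (b \<otimes> e) \<in> B" using tgt_germ_mult_left ld A B by auto
  then have "A = B" using germ_eq_src[OF A(1) B(1)] sAB eq by metis
  then show "x = y" using A B by simp
qed

lemma right_cancellative_germ_cat:
  assumes "right_ample S" shows "right_cancellative C"
  unfolding right_cancellative_def
proof (intro ballI impI)
  fix x y z assume "x \<in> topspace (arr C)" "y \<in> topspace (arr C)" "z \<in> topspace (arr C)"
    and xyz: "dom C x = cod C z \<and> dom C y = cod C z \<and> comp C x z = comp C y z"
  then obtain A B D where A: "is_germ S A" "x = j A" and B: "is_germ S B" "y = j B"
    and D: "is_germ S D" "z = j D" by auto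
  have e: "dom C (j A) = cod C (j D)" "dom C (j B) = cod C (j D)" "comp C (j A) (j D) = comp C (j B) (j D)"
    using xyz A(2) B(2) D(2) by simp_all
  have e': "src S A = tgt S D" "src S B = tgt S D"
    using e(1,2) dom_eq_cod[OF A(1) D(1)] dom_eq_cod[OF B(1) D(1)] by blast+
  note AD = germ_mult_is_germ[OF A(1) D(1) e'(1)] and BD = germ_mult_is_germ[OF B(1) D(1) e'(2)]
  have m: "germ_mult S A D = germ_mult S B D" using e A B D AD BD by (simp add: C_simps j_germ_eq)
  obtain a b d where a: "a \<in> A" "b \<in> B" "d \<in> D"
      using is_germD(2)[OF A(1)] is_germD(2)[OF B(1)] is_germD(2)[OF D(1)] by blast
  then have c: "a \<in> carrier S" "b \<in> carrier S" "d \<in> carrier S" using A B D is_germD(4) by blast+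
  have "b \<otimes> d \<in> germ S (src S D) (a \<otimes> d)"
    using germ_mult(2)[OF A(1) D(1) e'(1) a(1,3)] BD(4)[OF a(2,3)] m by simp
  then obtain e where e: "e \<in> src S D" "(a \<otimes> d) \<otimes> e = (b \<otimes> d) \<otimes> e" unfolding germ_def by blast
  have eE: "e \<in> E" using e D filterD(1)[OF is_germD(1)] by blast
  have "a \<otimes> (d \<otimes> e) = b \<otimes> (d \<otimes> e)" using e c eE by (simp add: assoc)
  then have eq: "a \<otimes> r (d \<otimes> e) = b \<otimes> r (d \<otimes> e)"
    using assms[unfolded right_ample_def, rule_format, of a b "d \<otimes> e"] c eE by simp
  have "d \<otimes> e \<in> D" using is_germD(9) D a e by blast
  then have "r (d \<otimes> e) \<in> tgt S D" using r_tgt D by blast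
  then have "a \<otimes> r (d \<otimes> e) \<in> A" "b \<otimes> r (d \<otimes> e) \<in> B" using is_germD(9) A B a e' by auto
  then have "A = B" using germ_eq_src[OF A(1) B(1)] e' eq by metis
  then show "x = y" using A B by simp
qed

end

section \<open>The monoid of open local bisections\<close>

lemma local_homeomorphismD:
  assumes "local_homeomorphism X Y f"
  shows "open_map X Y f" "x \<in> topspace X \<Longrightarrow> \<exists>U. openin X U \<and> x \<in> U \<and> inj_on f U"
proof -
  have *: "\<exists>U. openin X U \<and> x \<in> U \<and> openin Y (f ` U) \<and> homeomorphic_map (subtopology X U) (subtopology Y (f ` U)) f"
    if "x \<in> topspace X" for x
    using assms that unfolding local_homeomorphism_def by blast
  show "open_map X Y f" unfolding open_map_def
  proof (intro allI impI, subst openin_subopen, intro ballI)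
    fix V y assume V: "openin X V" and "y \<in> f ` V"
    then obtain x where x: "x \<in> V" "y = f x" "x \<in> topspace X" using openin_subset by blast
    then obtain U where U: "openin X U" "x \<in> U" "openin Y (f ` U)"
      "homeomorphic_map (subtopology X U) (subtopology Y (f ` U)) f" using * by blast
    have "openin (subtopology X U) (U \<inter> V)" using U V by (simp add: openin_open_subtopology openin_Int)
    then have "openin (subtopology Y (f ` U)) (f ` (U \<inter> V))"
      using homeomorphic_imp_open_map[OF U(4)] unfolding open_map_def by blast
    then have "openin Y (f ` (U \<inter> V))" using U(3) openin_trans_full by blast
    then show "\<exists>T. openin Y T \<and> y \<in> T \<and> T \<subseteq> f ` V" using x U by (intro exI[of _ "f ` (U \<inter> V)"]) auto
  qed
  show "\<exists>U. openin X U \<and> x \<in> U \<and> inj_on f U" if x: "x \<in> topspace X"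
  proof -
    obtain U where U: "openin X U" "x \<in> U" "homeomorphic_map (subtopology X U) (subtopology Y (f ` U)) f"
      using *[OF x] by blast
    have "inj_on f (topspace X \<inter> U)"
      using homeomorphic_imp_injective_map[OF U(3)] by (simp add: topspace_subtopology)
    then show ?thesis using U openin_subset by (metis Int_absorb1)
  qed
qed

locale etale_category =
  fixes C :: "('c, 'o) tcat"
  assumes etale: "etale C"
begin

abbreviation "Bis \<equiv> carrier (bisections C)"
abbreviation "units \<equiv> unit C ` topspace (obj C)"
abbreviation bmult (infixl "\<cdot>" 70) where "A \<cdot> B \<equiv> A \<otimes>\<^bsub>bisections C\<^esub> B"

lemma tc: "topological_category C" using etale unfolding etale_def by blast

lemma cat [simp]:
  "x \<in> topspace (obj C) \<Longrightarrow> unit C x \<in> topspace (arr C)"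
  "a \<in> topspace (arr C) \<Longrightarrow> dom C a \<in> topspace (obj C)"
  "a \<in> topspace (arr C) \<Longrightarrow> cod C a \<in> topspace (obj C)"
  "x \<in> topspace (obj C) \<Longrightarrow> dom C (unit C x) = x"
  "x \<in> topspace (obj C) \<Longrightarrow> cod C (unit C x) = x"
  "a \<in> topspace (arr C) \<Longrightarrow> comp C a (unit C (dom C a)) = a"
  "a \<in> topspace (arr C) \<Longrightarrow> comp C (unit C (cod C a)) a = a"
  using tc unfolding topological_category_def by (auto dest!: continuous_map_image_subset_topspace)

lemma topspace_composable:
  "topspace (composable C) = {(a, b). a \<in> topspace (arr C) \<and> b \<in> topspace (arr C) \<and> dom C a = cod C b}"
  unfolding composable_def by (auto simp: topspace_subtopology)

lemma comp [simp]:
  assumes "a \<in> topspace (arr C)" "b \<in> topspace (arr C)" "dom C a = cod C b"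
  shows "comp C a b \<in> topspace (arr C)" "dom C (comp C a b) = dom C b" "cod C (comp C a b) = cod C a"
proof -
  have ab: "(a, b) \<in> topspace (composable C)" using assms topspace_composable by blast
  then show "dom C (comp C a b) = dom C b" "cod C (comp C a b) = cod C a"
    using tc unfolding topological_category_def by blast+
  have "continuous_map (composable C) (arr C) (\<lambda>(a, b). comp C a b)"
    using tc unfolding topological_category_def by blast
  from continuous_map_image_subset_topspace[OF this] show "comp C a b \<in> topspace (arr C)" using ab by auto
qed

lemma comp_assoc:
  "a \<in> topspace (arr C) \<Longrightarrow> b \<in> topspace (arr C) \<Longrightarrow> c \<in> topspace (arr C) \<Longrightarrow>
    dom C a = cod C b \<Longrightarrow> dom C b = cod C c \<Longrightarrow> comp C (comp C a b) c = comp C a (comp C b c)"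
  using tc unfolding topological_category_def by blast

lemma open_dom: "openin (arr C) A \<Longrightarrow> openin (obj C) (dom C ` A)"
  and open_cod: "openin (arr C) A \<Longrightarrow> openin (obj C) (cod C ` A)"
  and open_unit: "openin (obj C) X \<Longrightarrow> openin (arr C) (unit C ` X)"
  using etale local_homeomorphismD(1) unfolding etale_def open_map_def by blast+

lemma open_comp:
  assumes "openin (arr C) A" "openin (arr C) B"
  shows "openin (arr C) {comp C a b | a b. a \<in> A \<and> b \<in> B \<and> dom C a = cod C b}"
proof -
  have "openin (composable C) ((A \<times> B) \<inter> {(a, b). dom C a = cod C b})"
    using assms unfolding composable_def openin_subtopology
    by (intro exI[of _ "A \<times> B"]) (simp add: openin_prod_Times_iff)
  then have "openin (arr C) ((\<lambda>(a, b). comp C a b) ` ((A \<times> B) \<inter> {(a, b). dom C a = cod C b}))"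
    using etale unfolding etale_def open_map_def by blast
  moreover have "(\<lambda>(a, b). comp C a b) ` ((A \<times> B) \<inter> {(a, b). dom C a = cod C b})
      = {comp C a b | a b. a \<in> A \<and> b \<in> B \<and> dom C a = cod C b}" by auto
  ultimately show ?thesis by simp
qed

lemma bis_iff: "A \<in> Bis \<longleftrightarrow> openin (arr C) A \<and> inj_on (dom C) A \<and> inj_on (cod C) A"
  by (simp add: bisections_def)

lemma bis_sub: "A \<in> Bis \<Longrightarrow> a \<in> A \<Longrightarrow> a \<in> topspace (arr C)"
  using bis_iff openin_subset by blast

lemma bis_dom: "A \<in> Bis \<Longrightarrow> a \<in> A \<Longrightarrow> b \<in> A \<Longrightarrow> dom C a = dom C b \<Longrightarrow> a = b"
  and bis_cod: "A \<in> Bis \<Longrightarrow> a \<in> A \<Longrightarrow> b \<in> A \<Longrightarrow> cod C a = cod C b \<Longrightarrow> a = b"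
  using bis_iff by (auto dest: inj_onD)

lemma bis_subset: "A \<in> Bis \<Longrightarrow> openin (arr C) B \<Longrightarrow> B \<subseteq> A \<Longrightarrow> B \<in> Bis"
  using bis_iff inj_on_subset by metis

text \<open>A neighbourhood on which the domain map is injective meets one on which the codomain map is
  injective in a bisection.\<close>

lemma ex_bis: "c \<in> topspace (arr C) \<Longrightarrow> \<exists>A\<in>Bis. c \<in> A"
proof -
  assume c: "c \<in> topspace (arr C)"
  then obtain A B where "openin (arr C) A" "c \<in> A" "inj_on (dom C) A" "openin (arr C) B" "c \<in> B" "inj_on (cod C) B"
    using etale local_homeomorphismD(2) unfolding etale_def by metis
  then show ?thesis unfolding bis_iff by (intro bexI[of _ "A \<inter> B"]) (auto simp: bis_iff intro: inj_on_subset)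
qed

lemma proj_iff: "A \<in> Proj (bisections C) \<longleftrightarrow> openin (arr C) A \<and> A \<subseteq> units"
  by (simp add: bisections_def)

lemma units_open: "openin (arr C) units" using open_unit by auto

lemma units_bis: "units \<in> Bis"
  using units_open unfolding bis_iff by (auto intro!: inj_onI)

lemma proj_bis: "A \<in> Proj (bisections C) \<Longrightarrow> A \<in> Bis"
  using bis_subset units_bis proj_iff by blast

lemma unit_eq: "c \<in> units \<Longrightarrow> unit C (dom C c) = c" "c \<in> units \<Longrightarrow> unit C (cod C c) = c"
  by auto

lemma bmult_iff: "x \<in> A \<cdot> B \<longleftrightarrow> (\<exists>a\<in>A. \<exists>b\<in>B. dom C a = cod C b \<and> x = comp C a b)"
  by (auto simp: bisections_def)

lemma one_bis [simp]: "\<one>\<^bsub>bisections C\<^esub> = units"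
  and lam_bis [simp]: "lam (bisections C) A = unit C ` dom C ` A"
  and rho_bis [simp]: "rho (bisections C) A = unit C ` cod C ` A"
  by (simp_all add: bisections_def)

lemma bmult_bis:
  assumes A: "A \<in> Bis" and B: "B \<in> Bis"
  shows "A \<cdot> B \<in> Bis"
  unfolding bis_iff
proof (intro conjI inj_onI)
  show "openin (arr C) (A \<cdot> B)" using open_comp A B unfolding bis_iff by (simp add: bisections_def)
  fix x y assume "x \<in> A \<cdot> B" "y \<in> A \<cdot> B"
  then obtain a b a' b' where x: "a \<in> A" "b \<in> B" "dom C a = cod C b" "x = comp C a b"
    and y: "a' \<in> A" "b' \<in> B" "dom C a' = cod C b'" "y = comp C a' b'" unfolding bmult_iff by blast
  note t = bis_sub[OF A x(1)] bis_sub[OF A y(1)] bis_sub[OF B x(2)] bis_sub[OF B y(2)]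
  show "x = y" if "dom C x = dom C y"
  proof -
    have "b = b'" using that bis_dom[OF B x(2) y(2)] t x y by simp
    then show ?thesis using bis_dom[OF A x(1) y(1)] x y by simp
  qed
  show "x = y" if "cod C x = cod C y"
  proof -
    have "a = a'" using that bis_cod[OF A x(1) y(1)] t x y by simp
    then show ?thesis using bis_cod[OF B x(2) y(2)] x y by simp
  qed
qed

text \<open>Projections are sets of units, so multiplying by one restricts the domain or the range. All
  axioms of a restriction monoid come down to this.\<close>

lemma bmult_proj:
  assumes A: "A \<in> Bis" and e: "e \<in> Proj (bisections C)"
  shows "A \<cdot> e = {a \<in> A. unit C (dom C a) \<in> e}" "e \<cdot> A = {a \<in> A. unit C (cod C a) \<in> e}"
proof -
  have eu: "\<And>u. u \<in> e \<Longrightarrow> u \<in> units" using e proj_iff by blast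
  show "A \<cdot> e = {a \<in> A. unit C (dom C a) \<in> e}"
  proof (intro equalityI subsetI)
    fix x assume "x \<in> A \<cdot> e"
    then obtain a u where a: "a \<in> A" "u \<in> e" "dom C a = cod C u" "x = comp C a u" unfolding bmult_iff by blast
    then have u: "u = unit C (dom C a)" using eu unit_eq by metis
    then have "x = a" using a(4) cat(6)[OF bis_sub[OF A a(1)]] by simp
    then show "x \<in> {a \<in> A. unit C (dom C a) \<in> e}" using a(1,2) u by simp
  next
    fix a assume a: "a \<in> {a \<in> A. unit C (dom C a) \<in> e}"
    then have "a \<in> topspace (arr C)" using bis_sub[OF A] by blast
    then show "a \<in> A \<cdot> e" unfolding bmult_iff using a by (intro bexI[of _ a] bexI[of _ "unit C (dom C a)"]) auto
  qed
  show "e \<cdot> A = {a \<in> A. unit C (cod C a) \<in> e}"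
  proof (intro equalityI subsetI)
    fix x assume "x \<in> e \<cdot> A"
    then obtain a u where a: "a \<in> A" "u \<in> e" "dom C u = cod C a" "x = comp C u a" unfolding bmult_iff by blast
    then have u: "u = unit C (cod C a)" using eu unit_eq by metis
    then have "x = a" using a(4) cat(7)[OF bis_sub[OF A a(1)]] by simp
    then show "x \<in> {a \<in> A. unit C (cod C a) \<in> e}" using a(1,2) u by simp
  next
    fix a assume a: "a \<in> {a \<in> A. unit C (cod C a) \<in> e}"
    then have "a \<in> topspace (arr C)" using bis_sub[OF A] by blast
    then show "a \<in> e \<cdot> A" unfolding bmult_iff using a by (intro bexI[of _ a] bexI[of _ "unit C (cod C a)"]) auto
  qed
qed

lemma lam_proj: "A \<in> Bis \<Longrightarrow> unit C ` dom C ` A \<in> Proj (bisections C)"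
  and rho_proj: "A \<in> Bis \<Longrightarrow> unit C ` cod C ` A \<in> Proj (bisections C)"
  unfolding proj_iff using open_unit open_dom open_cod bis_sub unfolding bis_iff
  by (auto intro!: imageI cat(2,3) dest: openin_subset)

lemma unit_inj: "x \<in> topspace (obj C) \<Longrightarrow> y \<in> topspace (obj C) \<Longrightarrow> unit C x = unit C y \<longleftrightarrow> x = y"
  using cat(4) by metis

lemma bmult_lam:
  assumes A: "A \<in> Bis" and B: "B \<in> Bis"
  shows "A \<cdot> (unit C ` dom C ` B) = {a \<in> A. dom C a \<in> dom C ` B}"
    "(unit C ` dom C ` B) \<cdot> A = {a \<in> A. cod C a \<in> dom C ` B}"
    "A \<cdot> (unit C ` cod C ` B) = {a \<in> A. dom C a \<in> cod C ` B}"
    "(unit C ` cod C ` B) \<cdot> A = {a \<in> A. cod C a \<in> cod C ` B}"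
  using bmult_proj[OF A lam_proj[OF B]] bmult_proj[OF A rho_proj[OF B]] unit_inj bis_sub[OF A] bis_sub[OF B]
  by auto

lemma bmult_assoc:
  assumes A: "A \<in> Bis" and B: "B \<in> Bis" and D: "D \<in> Bis"
  shows "(A \<cdot> B) \<cdot> D = A \<cdot> (B \<cdot> D)"
proof (intro equalityI subsetI)
  fix x assume "x \<in> (A \<cdot> B) \<cdot> D"
  then obtain y d where y: "y \<in> A \<cdot> B" "d \<in> D" "dom C y = cod C d" "x = comp C y d"
    using bmult_iff[of x "A \<cdot> B" D] by blast
  then obtain a b where a: "a \<in> A" "b \<in> B" "d \<in> D" "dom C a = cod C b" "dom C (comp C a b) = cod C d"
    "x = comp C (comp C a b) d" using bmult_iff[of y A B] by blast
  note t = bis_sub[OF A a(1)] bis_sub[OF B a(2)] bis_sub[OF D a(3)]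
  have d: "dom C b = cod C d" using a t by simp
  then have "x = comp C a (comp C b d)" "dom C a = cod C (comp C b d)" using a t comp_assoc by auto
  moreover have "comp C b d \<in> B \<cdot> D" using a d bmult_iff by blast
  ultimately show "x \<in> A \<cdot> (B \<cdot> D)" using bmult_iff[of x A "B \<cdot> D"] a by blast
next
  fix x assume "x \<in> A \<cdot> (B \<cdot> D)"
  then obtain a y where y: "a \<in> A" "y \<in> B \<cdot> D" "dom C a = cod C y" "x = comp C a y"
    using bmult_iff[of x A "B \<cdot> D"] by blast
  then obtain b d where a: "a \<in> A" "b \<in> B" "d \<in> D" "dom C b = cod C d" "dom C a = cod C (comp C b d)"
    "x = comp C a (comp C b d)" using bmult_iff[of y B D] by blast
  note t = bis_sub[OF A a(1)] bis_sub[OF B a(2)] bis_sub[OF D a(3)]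
  have d: "dom C a = cod C b" using a t by simp
  then have "x = comp C (comp C a b) d" "dom C (comp C a b) = cod C d" using a t comp_assoc by auto
  moreover have "comp C a b \<in> A \<cdot> B" using a d bmult_iff by blast
  ultimately show "x \<in> (A \<cdot> B) \<cdot> D" using bmult_iff[of x "A \<cdot> B" D] a by blast
qed

lemma restriction_monoid_bisections: "restriction_monoid (bisections C)"
proof -
  have u: "units \<in> Proj (bisections C)" using units_open proj_iff by blast
  have "monoid (bisections C)"
    by (rule monoidI) (auto simp: units_bis bmult_bis bmult_assoc bmult_proj[OF _ u] dest: bis_sub)
  moreover have "ehresmann (bisections C)"
    unfolding ehresmann_def
  proof (intro conjI ballI)
    show "Proj (bisections C) \<noteq> {}" "Proj (bisections C) \<subseteq> Bis" using u proj_bis by auto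
    show "lam (bisections C) \<in> Bis \<rightarrow> Proj (bisections C)" "rho (bisections C) \<in> Bis \<rightarrow> Proj (bisections C)"
      using lam_proj rho_proj by auto
  next
    fix e assume e: "e \<in> Proj (bisections C)"
    then have eu: "\<And>u. u \<in> e \<Longrightarrow> u \<in> units" using proj_iff by blast
    show "e \<cdot> e = e" using bmult_proj(1)[OF proj_bis[OF e] e] eu unit_eq(1) by auto
    have "unit C (dom C u) = u" "unit C (cod C u) = u" if "u \<in> e" for u using eu[OF that] unit_eq by auto
    then have "unit C ` dom C ` e = e" "unit C ` cod C ` e = e" by (force simp: image_iff)+
    then show "lam (bisections C) e = e" "rho (bisections C) e = e" by auto
    fix f assume f: "f \<in> Proj (bisections C)"
    have ef: "e \<cdot> f = e \<inter> f" "f \<cdot> e = e \<inter> f"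
      using bmult_proj[OF proj_bis[OF e] f] eu unit_eq by auto
    show "e \<cdot> f = f \<cdot> e" "e \<cdot> f \<in> Proj (bisections C)"
      using ef e f proj_iff by auto
  next
    fix A assume A: "A \<in> Bis"
    show "A \<cdot> lam (bisections C) A = A" "rho (bisections C) A \<cdot> A = A"
      using bmult_proj(1)[OF A lam_proj[OF A]] bmult_proj(2)[OF A rho_proj[OF A]] by auto
    fix B assume B: "B \<in> Bis"
    note t = bis_sub[OF A] bis_sub[OF B]
    have "dom C ` (lam (bisections C) A \<cdot> B) = dom C ` (A \<cdot> B)"
    proof -
      have "lam (bisections C) A \<cdot> B = {b \<in> B. cod C b \<in> dom C ` A}"
        using bmult_lam(2)[OF B A] by simp
      moreover have "dom C ` {b \<in> B. cod C b \<in> dom C ` A} = dom C ` (A \<cdot> B)"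
      proof (intro equalityI subsetI)
        fix x assume "x \<in> dom C ` {b \<in> B. cod C b \<in> dom C ` A}"
        then obtain a b where "a \<in> A" "b \<in> B" "dom C a = cod C b" "x = dom C b" by force
        then show "x \<in> dom C ` (A \<cdot> B)" using t by (intro image_eqI[of _ _ "comp C a b"]) (auto simp: bmult_iff)
      next
        fix x assume "x \<in> dom C ` (A \<cdot> B)"
        then obtain a b where "a \<in> A" "b \<in> B" "dom C a = cod C b" "x = dom C (comp C a b)"
          by (auto simp: bmult_iff)
        then show "x \<in> dom C ` {b \<in> B. cod C b \<in> dom C ` A}" using t by (auto intro!: imageI) (metis imageI)
      qed
      ultimately show ?thesis by simp
    qed
    then show "lam (bisections C) (lam (bisections C) A \<cdot> B) = lam (bisections C) (A \<cdot> B)" by simp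
    have "cod C ` (A \<cdot> rho (bisections C) B) = cod C ` (A \<cdot> B)"
    proof -
      have "A \<cdot> rho (bisections C) B = {a \<in> A. dom C a \<in> cod C ` B}"
        using bmult_lam(3)[OF A B] by simp
      moreover have "cod C ` {a \<in> A. dom C a \<in> cod C ` B} = cod C ` (A \<cdot> B)"
      proof (intro equalityI subsetI)
        fix x assume "x \<in> cod C ` {a \<in> A. dom C a \<in> cod C ` B}"
        then obtain a b where "a \<in> A" "b \<in> B" "dom C a = cod C b" "x = cod C a" by force
        then show "x \<in> cod C ` (A \<cdot> B)" using t by (intro image_eqI[of _ _ "comp C a b"]) (auto simp: bmult_iff)
      next
        fix x assume "x \<in> cod C ` (A \<cdot> B)"
        then obtain a b where "a \<in> A" "b \<in> B" "dom C a = cod C b" "x = cod C (comp C a b)"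
          by (auto simp: bmult_iff)
        then show "x \<in> cod C ` {a \<in> A. dom C a \<in> cod C ` B}" using t by (auto intro!: imageI)
      qed
      ultimately show ?thesis by simp
    qed
    then show "rho (bisections C) (A \<cdot> rho (bisections C) B) = rho (bisections C) (A \<cdot> B)" by simp
  qed
  moreover have "f \<cdot> A = A \<cdot> lam (bisections C) (f \<cdot> A)" "A \<cdot> f = rho (bisections C) (A \<cdot> f) \<cdot> A"
    if A: "A \<in> Bis" and f: "f \<in> Proj (bisections C)" for A f
  proof -
    have b: "f \<cdot> A \<in> Bis" "A \<cdot> f \<in> Bis" using bmult_bis A f proj_bis by auto
    have "A \<cdot> lam (bisections C) (f \<cdot> A) = {a \<in> A. dom C a \<in> dom C ` (f \<cdot> A)}"
      using bmult_lam(1)[OF A b(1)] by simp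
    also have "\<dots> = f \<cdot> A" unfolding bmult_proj[OF A f] using bis_dom[OF A] by auto
    finally show "f \<cdot> A = A \<cdot> lam (bisections C) (f \<cdot> A)" by simp
    have "rho (bisections C) (A \<cdot> f) \<cdot> A = {a \<in> A. cod C a \<in> cod C ` (A \<cdot> f)}"
      using bmult_lam(4)[OF A b(2)] by simp
    also have "\<dots> = A \<cdot> f" unfolding bmult_proj[OF A f] using bis_cod[OF A] by auto
    finally show "A \<cdot> f = rho (bisections C) (A \<cdot> f) \<cdot> A" by simp
  qed
  ultimately show ?thesis unfolding restriction_monoid_def by blast
qed

lemma bis_le: "A \<in> Bis \<Longrightarrow> B \<in> Bis \<Longrightarrow> natural_le (bisections C) A B \<longleftrightarrow> A \<subseteq> B"
proof -
  assume A: "A \<in> Bis" and B: "B \<in> Bis"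
  interpret M: restriction_mon "bisections C" by unfold_locales (rule restriction_monoid_bisections)
  have "natural_le (bisections C) A B \<longleftrightarrow> A = B \<cdot> (unit C ` dom C ` A)"
    using M.le_l[OF A B] by simp
  also have "B \<cdot> (unit C ` dom C ` A) = {b \<in> B. dom C b \<in> dom C ` A}"
    by (rule bmult_lam(1)[OF B A])
  also have "A = \<dots> \<longleftrightarrow> A \<subseteq> B" using bis_dom[OF B] by (auto simp: image_iff)
  finally show ?thesis .
qed

text \<open>If \<open>D \<cdot> A = D \<cdot> B\<close> then each product of an arrow \<open>d\<close> in \<open>D\<close> with an arrow in \<open>A\<close> is also a
  product of an arrow in \<open>D\<close> with one in \<open>B\<close>. The arrow in \<open>D\<close> is again \<open>d\<close>, having the same codomain,
  so that it can be cancelled.\<close>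

lemma left_ample_bisections:
  assumes "left_cancellative C" shows "left_ample (bisections C)"
  unfolding left_ample_def
proof (intro ballI impI)
  have *: "lam (bisections C) D \<cdot> A \<subseteq> lam (bisections C) D \<cdot> B"
    if A: "A \<in> Bis" and B: "B \<in> Bis" and D: "D \<in> Bis" and e: "D \<cdot> A = D \<cdot> B" for A B D
  proof
    fix a assume "a \<in> lam (bisections C) D \<cdot> A"
    then obtain d where a: "a \<in> A" "d \<in> D" "dom C d = cod C a"
      using bmult_lam(2)[OF A D] by auto
    then have "comp C d a \<in> D \<cdot> B" using e bmult_iff by blast
    then obtain d' b where b: "d' \<in> D" "b \<in> B" "dom C d' = cod C b" "comp C d a = comp C d' b"
      unfolding bmult_iff by blast
    note t = bis_sub[OF A a(1)] bis_sub[OF B b(2)] bis_sub[OF D a(2)] bis_sub[OF D b(1)]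
    have "cod C d = cod C (comp C d a)" using a t by simp
    also have "\<dots> = cod C d'" unfolding b(4) using b(3) t by simp
    finally have "cod C d = cod C d'" .
    then have "d = d'" using bis_cod[OF D a(2) b(1)] by simp
    then have "a = b" using assms a b t unfolding left_cancellative_def by metis
    moreover have "cod C a \<in> dom C ` D" using a by force
    ultimately show "a \<in> lam (bisections C) D \<cdot> B"
      using b(2) bmult_lam(2)[OF B D] by auto
  qed
  fix A B D assume "A \<in> Bis" "B \<in> Bis" "D \<in> Bis" "D \<cdot> A = D \<cdot> B"
  then show "lam (bisections C) D \<cdot> A = lam (bisections C) D \<cdot> B" using * by (intro equalityI) auto
qed

lemma right_ample_bisections:
  assumes "right_cancellative C" shows "right_ample (bisections C)"
  unfolding right_ample_def
proof (intro ballI impI)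
  have *: "A \<cdot> rho (bisections C) D \<subseteq> B \<cdot> rho (bisections C) D"
    if A: "A \<in> Bis" and B: "B \<in> Bis" and D: "D \<in> Bis" and e: "A \<cdot> D = B \<cdot> D" for A B D
  proof
    fix a assume "a \<in> A \<cdot> rho (bisections C) D"
    then obtain d where a: "a \<in> A" "d \<in> D" "dom C a = cod C d"
      using bmult_lam(3)[OF A D] by auto
    then have "comp C a d \<in> B \<cdot> D" using e bmult_iff by blast
    then obtain d' b where b: "d' \<in> D" "b \<in> B" "dom C b = cod C d'" "comp C a d = comp C b d'"
      unfolding bmult_iff by blast
    note t = bis_sub[OF A a(1)] bis_sub[OF B b(2)] bis_sub[OF D a(2)] bis_sub[OF D b(1)]
    have "dom C d = dom C (comp C a d)" using a t by simp
    also have "\<dots> = dom C d'" unfolding b(4) using b(3) t by simp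
    finally have "dom C d = dom C d'" .
    then have "d = d'" using bis_dom[OF D a(2) b(1)] by simp
    then have "a = b" using assms a b t unfolding right_cancellative_def by metis
    then show "a \<in> B \<cdot> rho (bisections C) D"
      using a b bmult_lam(3)[OF B D] by auto
  qed
  fix A B D assume "A \<in> Bis" "B \<in> Bis" "D \<in> Bis" "A \<cdot> D = B \<cdot> D"
  then show "A \<cdot> rho (bisections C) D = B \<cdot> rho (bisections C) D" using * by (intro equalityI) auto
qed

text \<open>Compatible bisections agree over each object of their common domain and over each object
  of their common range, so their union is again a bisection.\<close>

lemma Union_compatible_bis:
  assumes X: "X \<subseteq> Bis" and c: "\<And>A B. A \<in> X \<Longrightarrow> B \<in> X \<Longrightarrow> compatible (bisections C) A B"
  shows "\<Union>X \<in> Bis"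
  unfolding bis_iff
proof (intro conjI inj_onI)
  show "openin (arr C) (\<Union>X)" using X bis_iff by blast
  fix a b assume "a \<in> \<Union>X" "b \<in> \<Union>X"
  then obtain A B where A: "A \<in> X" "a \<in> A" "A \<in> Bis" and B: "B \<in> X" "b \<in> B" "B \<in> Bis" using X by blast
  have e: "A \<cdot> (unit C ` dom C ` B) = B \<cdot> (unit C ` dom C ` A)"
    "(unit C ` cod C ` B) \<cdot> A = (unit C ` cod C ` A) \<cdot> B"
    using c[OF A(1) B(1)] unfolding compatible_def by auto
  show "a = b" if "dom C a = dom C b"
  proof -
    have "a \<in> A \<cdot> (unit C ` dom C ` B)" using bmult_lam(1)[OF A(3) B(3)] A B that by auto
    then have "a \<in> B" using e bmult_lam(1)[OF B(3) A(3)] by auto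
    then show ?thesis using bis_dom B that by blast
  qed
  show "a = b" if "cod C a = cod C b"
  proof -
    have "a \<in> (unit C ` cod C ` B) \<cdot> A" using bmult_lam(4)[OF A(3) B(3)] A B that by auto
    then have "a \<in> B" using e bmult_lam(4)[OF B(3) A(3)] by auto
    then show ?thesis using bis_cod B that by blast
  qed
qed

end

text \<open>The isomorphic copy, on the codes of subsets of \<open>D\<close>, of a monoid whose elements are such
  subsets.\<close>

definition encode_crm :: "('c set \<Rightarrow> 'b) \<Rightarrow> 'c set \<Rightarrow> 'c set crm \<Rightarrow> 'b crm" where
  "encode_crm j D S = \<lparr>carrier = j ` carrier S,
     mult = (\<lambda>x y. j (decode j D x \<otimes>\<^bsub>S\<^esub> decode j D y)), one = j \<one>\<^bsub>S\<^esub>, Proj = j ` Proj S,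
     lam = (\<lambda>x. j (lam S (decode j D x))), rho = (\<lambda>x. j (rho S (decode j D x)))\<rparr>"

lemma encode_crm_simps [simp]:
  "carrier (encode_crm j D S) = j ` carrier S"
  "x \<otimes>\<^bsub>encode_crm j D S\<^esub> y = j (decode j D x \<otimes>\<^bsub>S\<^esub> decode j D y)"
  "\<one>\<^bsub>encode_crm j D S\<^esub> = j \<one>\<^bsub>S\<^esub>" "Proj (encode_crm j D S) = j ` Proj S"
  "lam (encode_crm j D S) x = j (lam S (decode j D x))"
  "rho (encode_crm j D S) x = j (rho S (decode j D x))"
  by (simp_all add: encode_crm_def)

lemma encode_crm_iso:
  assumes j: "inj_on j (Pow D)" and S: "carrier S \<subseteq> Pow D" and r: "restriction_monoid S"
  shows "restriction_monoid (encode_crm j D S)" "crm_iso (encode_crm j D S) S (decode j D)"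
    and "A \<in> carrier S \<Longrightarrow> B \<in> carrier S \<Longrightarrow> natural_le (encode_crm j D S) (j A) (j B) \<longleftrightarrow> natural_le S A B"
    and "left_ample S \<Longrightarrow> left_ample (encode_crm j D S)" "right_ample S \<Longrightarrow> right_ample (encode_crm j D S)"
proof -
  interpret restriction_mon S by unfold_locales fact
  have d: "decode j D (j A) = A" if "A \<in> carrier S" for A using that S j by auto
  have ji: "j A = j B \<longleftrightarrow> A = B" if "A \<in> carrier S" "B \<in> carrier S" for A B using that d by metis
  have "monoid (encode_crm j D S)" by (rule monoidI) (auto simp: d assoc)
  moreover have "ehresmann (encode_crm j D S)"
    unfolding ehresmann_def using one_E by (auto simp: d E_comm l_mult r_mult simp del: one_E)
  moreover have "f \<otimes>\<^bsub>S\<^esub> a = a \<otimes>\<^bsub>S\<^esub> l (f \<otimes>\<^bsub>S\<^esub> a)" "a \<otimes>\<^bsub>S\<^esub> f = r (a \<otimes>\<^bsub>S\<^esub> f) \<otimes>\<^bsub>S\<^esub> a" if "a \<in> carrier S" "f \<in> E" for a f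
    using push_l push_r that by auto
  ultimately show "restriction_monoid (encode_crm j D S)"
    unfolding restriction_monoid_def by (auto simp: d)
  show "crm_iso (encode_crm j D S) S (decode j D)"
    unfolding crm_iso_def iso_def hom_def bij_betw_def
    by (auto simp: d inj_on_def image_image)
  show "natural_le (encode_crm j D S) (j A) (j B) \<longleftrightarrow> natural_le S A B"
    if "A \<in> carrier S" "B \<in> carrier S" for A B
    using that unfolding natural_le_def by (simp add: d ji)
  have "left_ample (encode_crm j D S) \<longleftrightarrow> left_ample S"
    "right_ample (encode_crm j D S) \<longleftrightarrow> right_ample S"
    unfolding left_ample_def right_ample_def by (simp_all add: d ji)
  then show "left_ample S \<Longrightarrow> left_ample (encode_crm j D S)" "right_ample S \<Longrightarrow> right_ample (encode_crm j D S)"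
    by blast+
qed

locale bisection_monoid = etale_category C for C :: "('c, 'o) tcat" +
  fixes j :: "'c set \<Rightarrow> 'b"
  assumes j: "inj_on j (Pow (topspace (arr C)))"
begin

abbreviation "GC \<equiv> encode_crm j (topspace (arr C)) (bisections C)"
abbreviation "dec \<equiv> decode j (topspace (arr C))"

lemma bis_pow: "Bis \<subseteq> Pow (topspace (arr C))" using bis_sub by blast

lemma dec_j [simp]: "A \<in> Bis \<Longrightarrow> dec (j A) = A"
  using j bis_pow by (intro decode) auto

lemma GC_iso: "crm_iso GC (bisections C) dec"
  using encode_crm_iso(2)[OF j bis_pow restriction_monoid_bisections] .

lemma GC_le [simp]: "A \<in> Bis \<Longrightarrow> B \<in> Bis \<Longrightarrow> natural_le GC (j A) (j B) \<longleftrightarrow> A \<subseteq> B"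
  using encode_crm_iso(3)[OF j bis_pow restriction_monoid_bisections] bis_le by simp

lemma dec_bis [simp]: "x \<in> carrier GC \<Longrightarrow> dec x \<in> Bis" "x \<in> carrier GC \<Longrightarrow> j (dec x) = x"
  by auto

lemma dec_proj: "e \<in> Proj GC \<Longrightarrow> dec e \<in> Proj (bisections C)"
  using proj_bis by auto

lemma proj_inter: "e \<in> Proj (bisections C) \<Longrightarrow> f \<in> Proj (bisections C) \<Longrightarrow> e \<cdot> f = e \<inter> f"
  using bmult_proj(1)[OF proj_bis, of e f] unit_eq(1) proj_iff by fastforce

lemma Union_proj: "F \<subseteq> Proj GC \<Longrightarrow> \<Union>(dec ` F) \<in> Proj (bisections C)"
  using dec_proj unfolding proj_iff by blast

lemma frame_GC: "is_frame (proj_order GC)"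
  and Lub_GC: "F \<subseteq> Proj GC \<Longrightarrow> \<Squnion>\<^bsub>proj_order GC\<^esub> F = j (\<Union>(dec ` F))"
proof -
  have r: "restriction_monoid GC"
    using encode_crm_iso(1)[OF j bis_pow restriction_monoid_bisections] .
  have 1: "j (\<Union>(dec ` F)) \<in> Proj GC \<and> (\<forall>e\<in>Proj GC. natural_le GC (j (\<Union>(dec ` F))) e \<longleftrightarrow> (\<forall>a\<in>F. natural_le GC a e))"
    if F: "F \<subseteq> Proj GC" for F
  proof (intro conjI ballI)
    show "j (\<Union>(dec ` F)) \<in> Proj GC" using Union_proj[OF F] by simp
    fix e assume "e \<in> Proj GC"
    then obtain X where X: "e = j X" "X \<in> Bis" using proj_bis by auto
    have "natural_le GC a e \<longleftrightarrow> dec a \<subseteq> X" if "a \<in> F" for a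
    proof -
      have "a \<in> carrier GC" using F that proj_bis by auto
      then show ?thesis using X GC_le[of "dec a" X] dec_bis by metis
    qed
    then show "natural_le GC (j (\<Union>(dec ` F))) e \<longleftrightarrow> (\<forall>a\<in>F. natural_le GC a e)"
      using X Union_proj[OF F] proj_bis by auto
  qed
  have 2: "e \<otimes>\<^bsub>GC\<^esub> j (\<Union>(dec ` F)) = j (\<Union>(dec ` ((\<lambda>a. e \<otimes>\<^bsub>GC\<^esub> a) ` F)))" if F: "F \<subseteq> Proj GC" and e: "e \<in> Proj GC" for F e
  proof -
    have "dec (e \<otimes>\<^bsub>GC\<^esub> a) = dec e \<inter> dec a" if "a \<in> F" for a
    proof -
      have p: "dec e \<in> Proj (bisections C)" "dec a \<in> Proj (bisections C)"
        using dec_proj[OF e] dec_proj[of a] that F by blast+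
      have "dec (e \<otimes>\<^bsub>GC\<^esub> a) = dec e \<cdot> dec a" using bmult_bis p[THEN proj_bis] by simp
      then show ?thesis using proj_inter[OF p] by simp
    qed
    then have "(\<lambda>a. dec (e \<otimes>\<^bsub>GC\<^esub> a)) ` F = (\<lambda>a. dec e \<inter> dec a) ` F" by (intro image_cong) auto
    then have "\<Union>(dec ` ((\<lambda>a. e \<otimes>\<^bsub>GC\<^esub> a) ` F)) = dec e \<inter> \<Union>(dec ` F)" by (simp add: image_image)
    moreover have "dec e \<cdot> \<Union>(dec ` F) = dec e \<inter> \<Union>(dec ` F)"
      using proj_inter dec_proj[OF e] Union_proj[OF F] by simp
    ultimately show ?thesis using Union_proj[OF F] proj_bis by simp
  qed
  show "is_frame (proj_order GC)" by (rule is_frame_criterion(1)[OF r 1 2])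
  show "\<Squnion>\<^bsub>proj_order GC\<^esub> F = j (\<Union>(dec ` F))" if "F \<subseteq> Proj GC"
    using is_frame_criterion(2)[OF r 1 2 that] by simp
qed

lemma join_GC:
  assumes X: "X \<subseteq> carrier GC" and u: "\<Union>(dec ` X) \<in> Bis"
  shows "is_join GC t X \<longleftrightarrow> t = j (\<Union>(dec ` X))"
proof -
  have le: "natural_le GC x (j B) \<longleftrightarrow> dec x \<subseteq> B" if "x \<in> X" "B \<in> Bis" for x B
    using X that GC_le[of "dec x" B] dec_bis[of x] by (metis subset_iff)
  let ?u = "j (\<Union>(dec ` X))"
  have uc: "?u \<in> carrier GC" "\<forall>x\<in>X. natural_le GC x ?u" using u le by auto
  show ?thesis
  proof
    assume "is_join GC t X"
    then have t: "t \<in> carrier GC" "\<forall>x\<in>X. natural_le GC x t"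
      "\<And>u. u \<in> carrier GC \<Longrightarrow> (\<forall>x\<in>X. natural_le GC x u) \<Longrightarrow> natural_le GC t u"
      using is_join_iff[OF X] by blast+
    then obtain B where B: "t = j B" "B \<in> Bis" by auto
    have "\<Union>(dec ` X) \<subseteq> B" using t(2) B le by blast
    moreover have "natural_le GC t ?u" using t(3)[OF uc] .
    then have "B \<subseteq> \<Union>(dec ` X)" using GC_le[OF B(2) u] unfolding B(1) by blast
    ultimately have "B = \<Union>(dec ` X)" by blast
    then show "t = ?u" using B(1) by (metis (no_types))
  next
    assume t: "t = j (\<Union>(dec ` X))"
    have "natural_le GC ?u v" if "v \<in> carrier GC" "\<forall>x\<in>X. natural_le GC x v" for v
    proof -
      obtain B where "v = j B" "B \<in> Bis" using \<open>v \<in> carrier GC\<close> by auto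
      then show ?thesis using that(2) le u by auto
    qed
    then show "is_join GC t X"
      unfolding is_join_iff[OF X] using t uc by blast
  qed
qed

lemma complete_GC: "complete_restriction_monoid GC"
  unfolding complete_restriction_monoid_def
proof (intro conjI allI impI frame_GC)
  show "restriction_monoid GC"
    using encode_crm_iso(1)[OF j bis_pow restriction_monoid_bisections] .
  fix X assume X: "X \<subseteq> carrier GC" and c: "X \<noteq> {} \<and> (\<forall>a\<in>X. \<forall>b\<in>X. compatible GC a b)"
  have "compatible (bisections C) (dec a) (dec b)" if "a \<in> X" "b \<in> X" for a b
  proof -
    have ab: "dec a \<in> Bis" "dec b \<in> Bis" "a = j (dec a)" "b = j (dec b)" using X that dec_bis by (metis subset_iff)+
    have "compatible GC (j (dec a)) (j (dec b))" using c that ab by metis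
    moreover have m: "dec (j (A \<cdot> B)) = A \<cdot> B" if "A \<in> Bis" "B \<in> Bis" for A B
      using bmult_bis that by simp
    moreover have p: "unit C ` dom C ` A \<in> Bis" "unit C ` cod C ` A \<in> Bis" if "A \<in> Bis" for A
      using lam_proj rho_proj proj_bis that by auto
    moreover have "j A = j B \<longleftrightarrow> A = B" if "A \<in> Bis" "B \<in> Bis" for A B using that dec_j by metis
    ultimately show ?thesis using ab(1,2) bmult_bis unfolding compatible_def by simp
  qed
  moreover have "dec ` X \<subseteq> Bis" using X dec_bis(1) by blast
  ultimately have "\<Union>(dec ` X) \<in> Bis" using Union_compatible_bis[of "dec ` X"] by blast
  then show "\<exists>t. is_join GC t X" using join_GC[OF X] by blast
qed

sublocale G: complete_restriction_mon GC
  by (rule complete_restriction_monI[OF complete_GC])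

lemma bis_inter: "A \<in> Bis \<Longrightarrow> B \<in> Bis \<Longrightarrow> A \<inter> B \<in> Bis"
  using bis_subset[of A "A \<inter> B"] bis_iff by auto

text \<open>Any two bisections have a common lower bound, at worst the empty set, so that the meet is
  always a genuine one.\<close>

lemma wedge_GC [simp]: "A \<in> Bis \<Longrightarrow> B \<in> Bis \<Longrightarrow> wedge GC (j A) (j B) = j (A \<inter> B)"
proof -
  assume A: "A \<in> Bis" and B: "B \<in> Bis"
  then have i: "A \<inter> B \<in> Bis" using bis_inter by blast
  have "is_meet GC (wedge GC (j A) (j B)) {j A, j B}"
    by (rule G.meet_exists[of _ _ "j (A \<inter> B)"]) (use A B i in auto)
  then have "wedge GC (j A) (j B) \<in> carrier GC" "natural_le GC (wedge GC (j A) (j B)) (j A)"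
    "natural_le GC (wedge GC (j A) (j B)) (j B)" "natural_le GC (j (A \<inter> B)) (wedge GC (j A) (j B))"
    using is_meet_iff[of "j A" GC "j B"] A B i by auto
  then obtain D where "wedge GC (j A) (j B) = j D" "D \<in> Bis" "D \<subseteq> A" "D \<subseteq> B" "A \<inter> B \<subseteq> D"
    using A B i by auto
  then show ?thesis by (metis Int_greatest subset_antisym)
qed

text \<open>Joins of bisections are unions and bisections form a base, so covering each bisection by
  values of \<open>\<phi>\<close> amounts to covering each arrow. Properness thus corresponds to the condition that
  a relational covering relates each arrow to at least one arrow.\<close>

lemma proper_iff_cover:
  assumes "\<phi> \<in> carrier S \<rightarrow> carrier GC"
  shows "proper_morphism S GC \<phi> \<longleftrightarrow> (\<forall>c\<in>topspace (arr C). \<exists>s\<in>carrier S. c \<in> dec (\<phi> s))"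
proof
  assume p: "proper_morphism S GC \<phi>"
  show "\<forall>c\<in>topspace (arr C). \<exists>s\<in>carrier S. c \<in> dec (\<phi> s)"
  proof
    fix c assume "c \<in> topspace (arr C)"
    then obtain B where B: "B \<in> Bis" "c \<in> B" using ex_bis by blast
    then obtain X where X: "X \<subseteq> carrier GC" "is_join GC (j B) X" "\<forall>x\<in>X. \<exists>s\<in>carrier S. natural_le GC x (\<phi> s)"
      using p unfolding proper_morphism_def by auto
    have sub: "dec x \<subseteq> B" if "x \<in> X" for x
    proof -
      have "natural_le GC x (j B)" using X that unfolding is_join_iff[OF X(1)] by blast
      moreover have "x \<in> carrier GC" using that X by blast
      ultimately show ?thesis using B GC_le[of "dec x" B] dec_bis by metis
    qed
    have "openin (arr C) (dec x)" if "x \<in> X" for x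
      using subsetD[OF X(1) that] dec_bis(1) bis_iff by blast
    then have "openin (arr C) (\<Union>(dec ` X))" by (intro openin_Union) auto
    then have u: "\<Union>(dec ` X) \<in> Bis" using bis_subset[OF B(1)] sub by blast
    then have "B = \<Union>(dec ` X)" using join_GC[OF X(1) u] X(2) B(1) by (metis dec_j)
    then obtain x where x: "x \<in> X" "c \<in> dec x" using B by blast
    then obtain s where s: "s \<in> carrier S" "natural_le GC x (\<phi> s)" using X by blast
    have "x \<in> carrier GC" "\<phi> s \<in> carrier GC" using x X s assms by auto
    then have "dec x \<subseteq> dec (\<phi> s)" using s GC_le[of "dec x" "dec (\<phi> s)"] dec_bis by metis
    then show "\<exists>s\<in>carrier S. c \<in> dec (\<phi> s)" using x s by blast
  qed
next
  assume c: "\<forall>c\<in>topspace (arr C). \<exists>s\<in>carrier S. c \<in> dec (\<phi> s)"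
  show "proper_morphism S GC \<phi>" unfolding proper_morphism_def
  proof
    fix t assume "t \<in> carrier GC"
    then obtain B where B: "t = j B" "B \<in> Bis" by auto
    let ?X = "(\<lambda>s. j (B \<inter> dec (\<phi> s))) ` carrier S"
    have b: "B \<inter> dec (\<phi> s) \<in> Bis" "\<phi> s \<in> carrier GC" if "s \<in> carrier S" for s
    proof -
      show "\<phi> s \<in> carrier GC" using assms that by blast
      then show "B \<inter> dec (\<phi> s) \<in> Bis" using bis_inter B(2) dec_bis(1) by blast
    qed
    have X: "?X \<subseteq> carrier GC" using b by auto
    have "dec ` ?X = (\<lambda>s. B \<inter> dec (\<phi> s)) ` carrier S"
      unfolding image_image using b by (intro image_cong) auto
    then have "\<Union>(dec ` ?X) = B" using c bis_sub[OF B(2)] by auto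
    then have "is_join GC t ?X" using join_GC[OF X] B by simp
    moreover have "natural_le GC (j (B \<inter> dec (\<phi> s))) (\<phi> s)" if "s \<in> carrier S" for s
    proof -
      have "natural_le GC (j (B \<inter> dec (\<phi> s))) (j (dec (\<phi> s)))"
        using GC_le[OF b(1)[OF that] dec_bis(1)[OF b(2)[OF that]]] by blast
      then show ?thesis by (simp only: dec_bis(2)[OF b(2)[OF that]])
    qed
    ultimately show "\<exists>X\<subseteq>carrier GC. is_join GC t X \<and> (\<forall>x\<in>X. \<exists>s\<in>carrier S. natural_le GC x (\<phi> s))"
      using X by (intro exI[of _ ?X]) auto
  qed
qed

end

section \<open>The two categories\<close>

text \<open>Meets of projections are products and the top projection is the unit. For a homomorphism
  commuting with \<open>\<lambda>\<close> and \<open>\<rho>\<close>, being a frame morphism therefore reduces to preserving the unit and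
  joins.\<close>

lemma crm_morphism_iff:
  assumes "complete_restriction_monoid S" "complete_restriction_monoid T"
  shows "crm_morphism S T \<phi> \<longleftrightarrow> \<phi> \<in> carrier S \<rightarrow> carrier T \<and>
    (\<forall>a\<in>carrier S. \<forall>b\<in>carrier S. \<phi> (a \<otimes>\<^bsub>S\<^esub> b) = \<phi> a \<otimes>\<^bsub>T\<^esub> \<phi> b) \<and>
    (\<forall>a\<in>carrier S. \<phi> (lam S a) = lam T (\<phi> a) \<and> \<phi> (rho S a) = rho T (\<phi> a)) \<and>
    \<phi> \<one>\<^bsub>S\<^esub> = \<one>\<^bsub>T\<^esub> \<and> (\<forall>F\<subseteq>Proj S. \<phi> (\<Squnion>\<^bsub>proj_order S\<^esub> F) = \<Squnion>\<^bsub>proj_order T\<^esub> (\<phi> ` F))"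
    (is "?L \<longleftrightarrow> ?R")
proof -
  interpret S: complete_restriction_mon S using assms(1) by (rule complete_restriction_monI)
  interpret T: complete_restriction_mon T using assms(2) by (rule complete_restriction_monI)
  have c: "carrier (proj_order S) = Proj S" "carrier (proj_order T) = Proj T"
    by (simp_all add: proj_order_def)
  show ?thesis
  proof
    assume ?L
    then show ?R unfolding crm_morphism_def frame_morphism_def c S.top_E T.top_E hom_def by blast
  next
    assume R: ?R
    have E: "\<phi> e \<in> Proj T" if "e \<in> Proj S" for e
    proof -
      have "\<phi> e \<in> carrier T" "\<phi> (lam S e) = lam T (\<phi> e)" using R S.E_carrier[OF that] by blast+
      then have "\<phi> e \<in> carrier T" "\<phi> e = lam T (\<phi> e)" using S.lr_E(1)[OF that] by auto
      then show ?thesis using T.lr_closed(1) by metis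
    qed
    have "\<phi> (x \<sqinter>\<^bsub>proj_order S\<^esub> y) = \<phi> x \<sqinter>\<^bsub>proj_order T\<^esub> \<phi> y" if "x \<in> Proj S" "y \<in> Proj S" for x y
      using R E that by (simp add: S.meet_E T.meet_E)
    then show ?L
      unfolding crm_morphism_def frame_morphism_def c S.top_E T.top_E hom_def using R E by auto
  qed
qed

locale crm_hom = S: complete_restriction_mon S + T: complete_restriction_mon T
  for S :: "'a crm" and T :: "'b crm" + fixes \<phi>
  assumes hom: "crm_morphism S T \<phi>"
begin

lemma
  shows map [simp]: "a \<in> carrier S \<Longrightarrow> \<phi> a \<in> carrier T"
    and mult: "a \<in> carrier S \<Longrightarrow> b \<in> carrier S \<Longrightarrow> \<phi> (a \<otimes>\<^bsub>S\<^esub> b) = \<phi> a \<otimes>\<^bsub>T\<^esub> \<phi> b"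
    and lam: "a \<in> carrier S \<Longrightarrow> \<phi> (lam S a) = lam T (\<phi> a)"
    and rho: "a \<in> carrier S \<Longrightarrow> \<phi> (rho S a) = rho T (\<phi> a)"
    and one: "\<phi> \<one>\<^bsub>S\<^esub> = \<one>\<^bsub>T\<^esub>"
    and Lub: "F \<subseteq> Proj S \<Longrightarrow> \<phi> (\<Squnion>\<^bsub>proj_order S\<^esub> F) = \<Squnion>\<^bsub>proj_order T\<^esub> (\<phi> ` F)"
  using hom unfolding crm_morphism_iff[OF S.crm T.crm] by auto

lemma proj [simp]: "e \<in> Proj S \<Longrightarrow> \<phi> e \<in> Proj T"
  using lam[of e] T.lr_closed(1)[of "\<phi> e"] by simp

lemma mono: "natural_le S a b \<Longrightarrow> b \<in> carrier S \<Longrightarrow> natural_le T (\<phi> a) (\<phi> b)"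
  using S.le_iff_l[of b a] mult[of _ b] by auto

text \<open>\<open>D t\<close> is the largest candidate for the set of which \<open>t\<close> is to be the join, and whether it
  works is decided in the frame of projections. It cannot be empty: the join of the empty set lies
  below the bottom projection, which is a value of \<open>\<phi>\<close>.\<close>

lemma proper_iff:
  defines "D t \<equiv> {x. natural_le T x t \<and> (\<exists>s\<in>carrier S. natural_le T x (\<phi> s))}"
  shows "proper_morphism S T \<phi> \<longleftrightarrow>
    (\<forall>t\<in>carrier T. D t \<noteq> {} \<and> natural_le T (rho T t) (\<Squnion>\<^bsub>proj_order T\<^esub> (rho T ` D t)))"
proof -
  have Dc: "D t \<subseteq> carrier T" if "t \<in> carrier T" for t using that T.le_closed D_def by blast
  have rD: "rho T ` D t \<subseteq> Proj T" if "t \<in> carrier T" for t using Dc[OF that] by auto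
  show ?thesis
  proof (intro iffI ballI)
    fix t assume p: "proper_morphism S T \<phi>" and t: "t \<in> carrier T"
    then obtain X where X: "X \<subseteq> carrier T" "is_join T t X" "\<forall>x\<in>X. \<exists>s\<in>carrier S. natural_le T x (\<phi> s)"
      unfolding proper_morphism_def by blast
    note j = X(2)[unfolded is_join_iff[OF X(1)]]
    have XD: "X \<subseteq> D t" using X(3) j unfolding D_def by blast
    have "D t \<noteq> {}"
    proof (cases "X = {}")
      case True
      let ?o = "\<Squnion>\<^bsub>proj_order S\<^esub> {}"
      have o: "?o \<in> Proj S" "\<phi> ?o = \<Squnion>\<^bsub>proj_order T\<^esub> {}" using Lub[of "{}"] by auto
      have "natural_le T t (\<phi> ?o)" using j True o by auto
      then have "t \<in> D t" using t o(1) S.E_carrier[OF o(1)] unfolding D_def by auto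
      then show ?thesis by blast
    qed (use XD in blast)
    moreover have "\<Squnion>\<^bsub>proj_order T\<^esub> (rho T ` X) = rho T t" using T.Lub_of_join X by blast
    moreover have "natural_le T (\<Squnion>\<^bsub>proj_order T\<^esub> (rho T ` X)) (\<Squnion>\<^bsub>proj_order T\<^esub> (rho T ` D t))"
    proof -
      have "rho T ` X \<subseteq> Proj T" using XD rD[OF t] by blast
      then show ?thesis using XD T.Lub_upper[OF rD[OF t]] T.Lub_closed[OF rD[OF t]]
        by (subst T.Lub_le_iff) auto
    qed
    ultimately show "D t \<noteq> {} \<and> natural_le T (rho T t) (\<Squnion>\<^bsub>proj_order T\<^esub> (rho T ` D t))" by simp
  next
    assume a: "\<forall>t\<in>carrier T. D t \<noteq> {} \<and> natural_le T (rho T t) (\<Squnion>\<^bsub>proj_order T\<^esub> (rho T ` D t))"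
    have "is_join T t (D t)" if "t \<in> carrier T" for t
      using a that by (intro T.join_of_Lub) (auto simp: D_def)
    moreover have "\<forall>x\<in>D t. \<exists>s\<in>carrier S. natural_le T x (\<phi> s)" for t unfolding D_def by blast
    ultimately show "proper_morphism S T \<phi>" unfolding proper_morphism_def using Dc by meson
  qed
qed

end

lemma crm_morphism_cong:
  assumes c: "complete_restriction_monoid S" "complete_restriction_monoid T"
    and e: "\<And>a. a \<in> carrier S \<Longrightarrow> \<phi> a = \<psi> a"
  shows "crm_morphism S T \<phi> \<longleftrightarrow> crm_morphism S T \<psi>"
proof -
  interpret S: complete_restriction_mon S using c(1) by (rule complete_restriction_monI)
  have "\<phi> ` F = \<psi> ` F" if "F \<subseteq> Proj S" for F using e that by (intro image_cong) auto
  then show ?thesis unfolding crm_morphism_iff[OF c] using e by (auto simp: Pi_iff)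
qed

text \<open>Let \<open>x \<le> \<psi> t\<close> be one of the elements covering \<open>u\<close>, and let the elements \<open>y \<le> \<phi> s\<close> cover \<open>t\<close>.
  Since \<open>\<psi>\<close> preserves joins of projections, the restrictions of \<open>x\<close> to the projections
  \<open>\<psi> (rho T y)\<close> cover \<open>x\<close>; each lies below \<open>\<psi> y\<close> and hence below a value of the composite.\<close>

lemma proper_morphism_comp:
  assumes "crm_hom S T \<phi>" "crm_hom T U \<psi>" "crm_hom S U \<theta>" and \<theta>: "\<And>a. a \<in> carrier S \<Longrightarrow> \<theta> a = \<psi> (\<phi> a)"
    and p: "proper_morphism S T \<phi>" "proper_morphism T U \<psi>"
  shows "proper_morphism S U \<theta>"
proof -
  interpret \<phi>: crm_hom S T \<phi> by fact
  interpret \<psi>: crm_hom T U \<psi> by fact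
  interpret \<theta>: crm_hom S U \<theta> by fact
  define D where "D t = {x. natural_le T x t \<and> (\<exists>s\<in>carrier S. natural_le T x (\<phi> s))}" for t
  define D' where "D' u = {x. natural_le U x u \<and> (\<exists>t\<in>carrier T. natural_le U x (\<psi> t))}" for u
  define D'' where "D'' u = {x. natural_le U x u \<and> (\<exists>s\<in>carrier S. natural_le U x (\<theta> s))}" for u
  show ?thesis
    unfolding \<theta>.proper_iff D''_def[symmetric]
  proof
    fix u assume u: "u \<in> carrier U"
    have Dc: "x \<in> carrier U" if "x \<in> D' u \<or> x \<in> D'' u" for x
      using that u \<psi>.T.le_closed unfolding D'_def D''_def by blast
    have rD: "rho U ` D' u \<subseteq> Proj U" "rho U ` D'' u \<subseteq> Proj U" using Dc by auto
    have D': "D' u \<noteq> {}" "natural_le U (rho U u) (\<Squnion>\<^bsub>proj_order U\<^esub> (rho U ` D' u))"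
      using p(2) u unfolding \<psi>.proper_iff D'_def by blast+
    have key: "D'' u \<noteq> {} \<and> natural_le U (rho U x) (\<Squnion>\<^bsub>proj_order U\<^esub> (rho U ` D'' u))" if x: "x \<in> D' u" for x
    proof -
      have xc: "x \<in> carrier U" using Dc x by blast
      obtain t where t: "t \<in> carrier T" "natural_le U x (\<psi> t)" and xu: "natural_le U x u" using x unfolding D'_def by blast
      have D: "D t \<noteq> {}" "natural_le T (rho T t) (\<Squnion>\<^bsub>proj_order T\<^esub> (rho T ` D t))"
        using p(1) t unfolding \<phi>.proper_iff D_def by blast+
      have Dt: "y \<in> carrier T" if "y \<in> D t" for y using that t \<phi>.T.le_closed unfolding D_def by blast
      then have rDt: "rho T ` D t \<subseteq> Proj T" by auto
      have m: "\<psi> (rho T y) \<otimes>\<^bsub>U\<^esub> x \<in> D'' u" if y: "y \<in> D t" for y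
      proof -
        obtain s where s: "s \<in> carrier S" "natural_le T y (\<phi> s)" "natural_le T y t" using y unfolding D_def by blast
        have r: "\<psi> (rho T y) \<in> Proj U" using Dt[OF y] by simp
        have "natural_le U (\<psi> (rho T y) \<otimes>\<^bsub>U\<^esub> x) u"
          using \<psi>.T.le_trans[OF \<psi>.T.mult_le_l[OF xc r] xu u] .
        moreover have "natural_le U (\<psi> (rho T y) \<otimes>\<^bsub>U\<^esub> x) (\<theta> s)"
        proof -
          have "rho T y \<otimes>\<^bsub>T\<^esub> t = y" using \<phi>.T.le_r[OF Dt[OF y] t(1)] s by simp
          then have "\<psi> (rho T y) \<otimes>\<^bsub>U\<^esub> \<psi> t = \<psi> y" using \<psi>.mult[of "rho T y" t] t(1) Dt[OF y] by simp
          then have "natural_le U (\<psi> (rho T y) \<otimes>\<^bsub>U\<^esub> x) (\<psi> y)"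
            using \<psi>.T.mult_mono[of "\<psi> (rho T y)" "\<psi> (rho T y)" x "\<psi> t"] r t by simp
          moreover have "natural_le U (\<psi> y) (\<psi> (\<phi> s))" using \<psi>.mono[OF s(2)] s by simp
          ultimately have "natural_le U (\<psi> (rho T y) \<otimes>\<^bsub>U\<^esub> x) (\<psi> (\<phi> s))"
            by (rule \<psi>.T.le_trans) (use s in simp)
          then show ?thesis using \<theta> s by simp
        qed
        ultimately show ?thesis unfolding D''_def using s by blast
      qed
      let ?F = "\<psi> ` rho T ` D t"
      have F: "?F \<subseteq> Proj U" using rDt by auto
      have "natural_le U (rho U x) (rho U (\<psi> t))" using \<psi>.T.r_mono t by simp
      also have "rho U (\<psi> t) = \<psi> (rho T t)" using \<psi>.rho t by simp
      finally have "natural_le U (rho U x) (\<psi> (rho T t))" .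
      moreover have "natural_le U (\<psi> (rho T t)) (\<Squnion>\<^bsub>proj_order U\<^esub> ?F)"
        using \<psi>.mono[OF D(2)] \<psi>.Lub[OF rDt] rDt by simp
      ultimately have "natural_le U (rho U x) (\<Squnion>\<^bsub>proj_order U\<^esub> ?F)"
        using \<psi>.T.le_trans F by (meson \<psi>.T.E_carrier \<psi>.T.Lub_closed)
      then have "rho U x = rho U x \<otimes>\<^bsub>U\<^esub> \<Squnion>\<^bsub>proj_order U\<^esub> ?F"
        using \<psi>.T.le_E_iff xc F by simp
      also have "\<dots> = \<Squnion>\<^bsub>proj_order U\<^esub> ((\<lambda>a. rho U x \<otimes>\<^bsub>U\<^esub> a) ` ?F)"
        using \<psi>.T.Lub_dist F xc by simp
      finally have eq: "rho U x = \<Squnion>\<^bsub>proj_order U\<^esub> ((\<lambda>a. rho U x \<otimes>\<^bsub>U\<^esub> a) ` ?F)" .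
      have sub: "(\<lambda>a. rho U x \<otimes>\<^bsub>U\<^esub> a) ` ?F \<subseteq> rho U ` D'' u"
      proof (intro subsetI, elim imageE)
        fix v a b y assume v: "v = rho U x \<otimes>\<^bsub>U\<^esub> a" "a = \<psi> b" "b = rho T y" "y \<in> D t"
        have "rho U (\<psi> (rho T y) \<otimes>\<^bsub>U\<^esub> x) = v"
          using v xc Dt[OF v(4)] \<psi>.T.E_comm by simp
        then show "v \<in> rho U ` D'' u" using m[OF v(4)] by blast
      qed
      have "natural_le U (\<Squnion>\<^bsub>proj_order U\<^esub> ((\<lambda>a. rho U x \<otimes>\<^bsub>U\<^esub> a) ` ?F)) (\<Squnion>\<^bsub>proj_order U\<^esub> (rho U ` D'' u))"
        using sub rD(2) \<psi>.T.Lub_upper[OF rD(2)] by (subst \<psi>.T.Lub_le_iff) auto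
      then show ?thesis using eq m D(1) by auto
    qed
    have "natural_le U (\<Squnion>\<^bsub>proj_order U\<^esub> (rho U ` D' u)) (\<Squnion>\<^bsub>proj_order U\<^esub> (rho U ` D'' u))"
      using key rD by (subst \<psi>.T.Lub_le_iff) auto
    then show "D'' u \<noteq> {} \<and> natural_le U (rho U u) (\<Squnion>\<^bsub>proj_order U\<^esub> (rho U ` D'' u))"
      using D' key \<psi>.T.le_trans rD by (metis \<psi>.T.E_carrier \<psi>.T.Lub_closed ex_in_conv)
  qed
qed

lemma crm_morD:
  assumes "\<phi> \<in> crm_mor k S T"
  shows "crm_morphism S T \<phi>" "\<phi> \<in> extensional (carrier S)" "k \<in> {2, 4} \<Longrightarrow> proper_morphism S T \<phi>"
    "k \<in> {3, 4} \<Longrightarrow> wedge_morphism S T \<phi>"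
  using assms unfolding crm_mor_def by blast+

lemma crm_mor_comp:
  assumes c: "complete_restriction_monoid S" "complete_restriction_monoid T" "complete_restriction_monoid U"
    and \<phi>: "\<phi> \<in> crm_mor k S T" and \<psi>: "\<psi> \<in> crm_mor k T U"
  shows "compose (carrier S) \<psi> \<phi> \<in> crm_mor k S U"
proof -
  interpret S: complete_restriction_mon S using c(1) by (rule complete_restriction_monI)
  interpret T: complete_restriction_mon T using c(2) by (rule complete_restriction_monI)
  interpret U: complete_restriction_mon U using c(3) by (rule complete_restriction_monI)
  interpret \<phi>: crm_hom S T \<phi> by unfold_locales (rule crm_morD(1)[OF \<phi>])
  interpret \<psi>: crm_hom T U \<psi> by unfold_locales (rule crm_morD(1)[OF \<psi>])
  let ?\<theta> = "compose (carrier S) \<psi> \<phi>"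
  have e: "?\<theta> a = \<psi> (\<phi> a)" if "a \<in> carrier S" for a using that by (simp add: compose_def)
  have "crm_morphism S U (\<lambda>a. \<psi> (\<phi> a))"
    unfolding crm_morphism_iff[OF c(1,3)]
  proof (intro conjI allI impI ballI)
    fix F assume F: "F \<subseteq> Proj S"
    then have "\<phi> ` F \<subseteq> Proj T" by auto
    then show "\<psi> (\<phi> (\<Squnion>\<^bsub>proj_order S\<^esub> F)) = \<Squnion>\<^bsub>proj_order U\<^esub> ((\<lambda>a. \<psi> (\<phi> a)) ` F)"
      using \<phi>.Lub[OF F] \<psi>.Lub by (simp add: image_image)
  qed (auto simp: \<phi>.mult \<psi>.mult \<phi>.lam \<psi>.lam \<phi>.rho \<psi>.rho \<phi>.one \<psi>.one)
  then have m: "crm_morphism S U ?\<theta>" using crm_morphism_cong[OF c(1,3)] e by metis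
  have "wedge_morphism S U ?\<theta>" if "wedge_morphism S T \<phi>" "wedge_morphism T U \<psi>"
    unfolding wedge_morphism_def
  proof (intro ballI)
    fix a b assume ab: "a \<in> carrier S" "b \<in> carrier S"
    have w: "wedge S a b \<in> carrier S"
      using S.wedge_cases[OF ab] is_meet_iff[OF ab] S.Lub_closed[of "{}"] by auto
    show "?\<theta> (wedge S a b) = wedge U (?\<theta> a) (?\<theta> b)"
      using that ab w by (simp add: e wedge_morphism_def)
  qed
  moreover have "proper_morphism S U ?\<theta>" if "proper_morphism S T \<phi>" "proper_morphism T U \<psi>"
  proof (rule proper_morphism_comp[OF _ _ _ e that])
    show "crm_hom S T \<phi>" "crm_hom T U \<psi>" "crm_hom S U ?\<theta>"
      using m by unfold_locales
  qed
  ultimately show ?thesis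
    unfolding crm_mor_def using m crm_morD[OF \<phi>] crm_morD[OF \<psi>] by auto
qed

lemma crm_mor_id:
  assumes c: "complete_restriction_monoid S"
  shows "restrict id (carrier S) \<in> crm_mor k S S"
proof -
  interpret S: complete_restriction_mon S using c by (rule complete_restriction_monI)
  have "crm_morphism S S (\<lambda>a. a)" unfolding crm_morphism_iff[OF c c] by auto
  then have m: "crm_morphism S S (restrict id (carrier S))" by (subst crm_morphism_cong[OF c c]) auto
  have w: "wedge S a b \<in> carrier S" if "a \<in> carrier S" "b \<in> carrier S" for a b
    using S.wedge_cases[OF that] is_meet_iff[OF that] S.Lub_closed[of "{}"] by auto
  have "is_join S t {t}" if "t \<in> carrier S" for t using is_join_iff[of "{t}" S t] that by auto
  then have "proper_morphism S S (restrict id (carrier S))"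
    unfolding proper_morphism_def
    by (intro ballI) (metis S.le_refl empty_subsetI id_apply insert_subset restrict_apply' singletonD)
  then show ?thesis unfolding crm_mor_def wedge_morphism_def using m w by auto
qed

lemma is_category_CRM: "is_category (CRM small P k)"
proof -
  have a: "compose (carrier W) (compose (carrier X) h g) f = compose (carrier W) h (compose (carrier W) g f)"
    if "f \<in> crm_mor k W X" for W X f g h
    using crm_morD(1)[OF that] unfolding crm_morphism_def hom_def compose_def
    by (auto simp: fun_eq_iff restrict_def)
  have i: "compose (carrier X) f (restrict id (carrier X)) = f" "compose (carrier X) (restrict id (carrier Y)) f = f"
    if "f \<in> crm_mor k X Y" for X Y f
  proof -
    have "f \<in> carrier X \<rightarrow> carrier Y" "f \<in> extensional (carrier X)"
      using crm_morD(1,2)[OF that] unfolding crm_morphism_def hom_def by auto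
    then show "compose (carrier X) f (restrict id (carrier X)) = f" "compose (carrier X) (restrict id (carrier Y)) f = f"
      unfolding compose_def by (auto simp: fun_eq_iff restrict_def extensional_def)
  qed
  show ?thesis
    unfolding is_category_def CRM_def
    by (intro conjI ballI) (auto simp: crm_mor_id crm_mor_comp a i)
qed

locale rel_covering = C: etale_category C + D: etale_category D
  for C :: "('c, 'o) tcat" and D :: "('d, 'p) tcat" + fixes f1 f0
  assumes rc: "relational_covering C D (f1, f0)"
begin

lemma clauses:
  shows "continuous_map (obj C) (obj D) f0"
    and "\<forall>a\<in>topspace (arr C). f1 a \<subseteq> topspace (arr D)"
    and "\<forall>a\<in>topspace (arr C). \<forall>b\<in>f1 a. dom D b = f0 (dom C a) \<and> cod D b = f0 (cod C a)"
    and "\<forall>(a, b)\<in>topspace (composable C). \<forall>(s, t)\<in>topspace (composable D).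
        s \<in> f1 a \<and> t \<in> f1 b \<longrightarrow> comp D s t \<in> f1 (comp C a b)"
    and "\<forall>a\<in>topspace (arr C). \<forall>b\<in>topspace (arr C).
        (dom C a = dom C b \<or> cod C a = cod C b) \<and> f1 a \<inter> f1 b \<noteq> {} \<longrightarrow> a = b"
    and "\<forall>q\<in>topspace (obj C). \<forall>s\<in>topspace (arr D).
        (dom D s = f0 q \<longrightarrow> (\<exists>t\<in>topspace (arr C). dom C t = q \<and> s \<in> f1 t)) \<and>
        (cod D s = f0 q \<longrightarrow> (\<exists>t\<in>topspace (arr C). cod C t = q \<and> s \<in> f1 t))"
    and "\<forall>A. openin (arr D) A \<longrightarrow> openin (arr C) {x \<in> topspace (arr C). f1 x \<inter> A \<noteq> {}}"
    and "\<forall>t\<in>topspace (obj C). unit D (f0 t) \<in> f1 (unit C t)"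
  by (insert rc, unfold relational_covering_def prod.case) (elim conjE, assumption)+

lemma
  shows cont0: "continuous_map (obj C) (obj D) f0"
    and f1_arr: "a \<in> topspace (arr C) \<Longrightarrow> b \<in> f1 a \<Longrightarrow> b \<in> topspace (arr D)"
    and f1_dom: "a \<in> topspace (arr C) \<Longrightarrow> b \<in> f1 a \<Longrightarrow> dom D b = f0 (dom C a)"
    and f1_cod: "a \<in> topspace (arr C) \<Longrightarrow> b \<in> f1 a \<Longrightarrow> cod D b = f0 (cod C a)"
    and lift_dom: "q \<in> topspace (obj C) \<Longrightarrow> s \<in> topspace (arr D) \<Longrightarrow> dom D s = f0 q \<Longrightarrow>
      \<exists>t\<in>topspace (arr C). dom C t = q \<and> s \<in> f1 t"
    and lift_cod: "q \<in> topspace (obj C) \<Longrightarrow> s \<in> topspace (arr D) \<Longrightarrow> cod D s = f0 q \<Longrightarrow>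
      \<exists>t\<in>topspace (arr C). cod C t = q \<and> s \<in> f1 t"
    and f1_open: "openin (arr D) A \<Longrightarrow> openin (arr C) {x \<in> topspace (arr C). f1 x \<inter> A \<noteq> {}}"
    and f1_unit: "t \<in> topspace (obj C) \<Longrightarrow> unit D (f0 t) \<in> f1 (unit C t)"
  subgoal by (rule clauses(1))
  subgoal using clauses(2) by blast
  subgoal using clauses(3) by blast
  subgoal using clauses(3) by blast
  subgoal using clauses(6) by blast
  subgoal using clauses(6) by blast
  subgoal using clauses(7) by blast
  subgoal using clauses(8) by blast
  done

lemma f0 [simp]: "x \<in> topspace (obj C) \<Longrightarrow> f0 x \<in> topspace (obj D)"
  using continuous_map_image_subset_topspace[OF cont0] by auto

lemma f1_mult:
  "a \<in> topspace (arr C) \<Longrightarrow> b \<in> topspace (arr C) \<Longrightarrow> dom C a = cod C b \<Longrightarrow> s \<in> f1 a \<Longrightarrow> t \<in> f1 b \<Longrightarrow>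
    comp D s t \<in> f1 (comp C a b)"
proof -
  assume a: "a \<in> topspace (arr C)" "b \<in> topspace (arr C)" "dom C a = cod C b" "s \<in> f1 a" "t \<in> f1 b"
  then have "(a, b) \<in> topspace (composable C)" "(s, t) \<in> topspace (composable D)"
    using f1_arr f1_dom f1_cod by (auto simp: C.topspace_composable D.topspace_composable)
  then show ?thesis using clauses(4) a(4,5) by blast
qed

lemma f1_inj: "a \<in> topspace (arr C) \<Longrightarrow> b \<in> topspace (arr C) \<Longrightarrow> dom C a = dom C b \<or> cod C a = cod C b \<Longrightarrow>
    s \<in> f1 a \<Longrightarrow> s \<in> f1 b \<Longrightarrow> a = b"
  using clauses(5) by blast

definition pre :: "'d set \<Rightarrow> 'c set" where
  "pre A = {c \<in> topspace (arr C). f1 c \<inter> A \<noteq> {}}"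

lemma pre_bis:
  assumes A: "A \<in> D.Bis" shows "pre A \<in> C.Bis"
  unfolding C.bis_iff
proof (intro conjI inj_onI)
  show "openin (arr C) (pre A)" unfolding pre_def using A f1_open D.bis_iff by blast
  fix x y assume "x \<in> pre A" "y \<in> pre A"
  then obtain s t where s: "x \<in> topspace (arr C)" "y \<in> topspace (arr C)" "s \<in> f1 x" "t \<in> f1 y" "s \<in> A" "t \<in> A"
    unfolding pre_def by blast
  show "x = y" if e: "dom C x = dom C y"
    using D.bis_dom[OF A s(5,6)] f1_dom[OF s(1,3)] f1_dom[OF s(2,4)] f1_inj[OF s(1,2)] s e by metis
  show "x = y" if e: "cod C x = cod C y"
    using D.bis_cod[OF A s(5,6)] f1_cod[OF s(1,3)] f1_cod[OF s(2,4)] f1_inj[OF s(1,2)] s e by metis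
qed

text \<open>An arrow related to a product \<open>a b\<close> factors because \<open>b\<close>, and then \<open>a\<close>, lifts along the given
  endpoints; the product of the lifts is the original arrow, as both are related to \<open>a b\<close> and have
  the same domain.\<close>

lemma pre_mult:
  assumes A: "A \<in> D.Bis" and B: "B \<in> D.Bis"
  shows "pre (A \<otimes>\<^bsub>bisections D\<^esub> B) = pre A \<otimes>\<^bsub>bisections C\<^esub> pre B"
proof (intro equalityI subsetI)
  fix c assume "c \<in> pre (A \<otimes>\<^bsub>bisections D\<^esub> B)"
  then obtain s where s: "c \<in> topspace (arr C)" "s \<in> f1 c" "s \<in> A \<otimes>\<^bsub>bisections D\<^esub> B"
    unfolding pre_def by blast
  obtain a b where "a \<in> A" "b \<in> B" "dom D a = cod D b" "s = comp D a b"
    using s(3) unfolding D.bmult_iff by blast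
  with s have c: "c \<in> topspace (arr C)" "a \<in> A" "b \<in> B" "dom D a = cod D b" "comp D a b \<in> f1 c" by auto
  note t = D.bis_sub[OF A c(2)] D.bis_sub[OF B c(3)]
  have "dom D b = f0 (dom C c)" using f1_dom[OF c(1,5)] t c by simp
  then obtain y where y: "y \<in> topspace (arr C)" "dom C y = dom C c" "b \<in> f1 y"
    using lift_dom[of "dom C c" b] c t by auto
  have "dom D a = f0 (cod C y)" using f1_cod y c by simp
  then obtain x where x: "x \<in> topspace (arr C)" "dom C x = cod C y" "a \<in> f1 x"
    using lift_dom[of "cod C y" a] y t by auto
  have "comp C x y = c" using f1_inj[OF _ c(1) _ f1_mult[OF x(1) y(1) x(2) x(3) y(3)] c(5)] x y by simp
  moreover have "x \<in> pre A" "y \<in> pre B" unfolding pre_def using x y c by blast+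
  ultimately show "c \<in> pre A \<otimes>\<^bsub>bisections C\<^esub> pre B"
    unfolding C.bmult_iff using x(2) by blast
next
  fix c assume "c \<in> pre A \<otimes>\<^bsub>bisections C\<^esub> pre B"
  then obtain x y where "x \<in> pre A" "y \<in> pre B" and xy: "dom C x = cod C y" "c = comp C x y"
    unfolding C.bmult_iff by blast
  then obtain a b where x: "x \<in> topspace (arr C)" "y \<in> topspace (arr C)" "a \<in> f1 x" "b \<in> f1 y" "a \<in> A" "b \<in> B"
    unfolding pre_def by blast
  have "dom D a = cod D b" using f1_dom[OF x(1,3)] f1_cod[OF x(2,4)] xy(1) by simp
  then have "comp D a b \<in> A \<otimes>\<^bsub>bisections D\<^esub> B"
    using x(5,6) unfolding D.bmult_iff by blast
  then show "c \<in> pre (A \<otimes>\<^bsub>bisections D\<^esub> B)"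
    unfolding pre_def using f1_mult[OF x(1,2) xy(1) x(3,4)] xy x by auto
qed

text \<open>An arrow related to a unit must be a unit, for the unit at its domain is related to the same
  arrow.\<close>

lemma pre_unit:
  assumes X: "X \<subseteq> topspace (obj D)"
  shows "pre (unit D ` X) = unit C ` {q \<in> topspace (obj C). f0 q \<in> X}"
proof (intro equalityI subsetI)
  fix c assume "c \<in> pre (unit D ` X)"
  then obtain x where c: "c \<in> topspace (arr C)" "x \<in> X" "unit D x \<in> f1 c" unfolding pre_def by blast
  then have x: "x = f0 (dom C c)" using f1_dom[OF c(1,3)] X by auto
  then have "c = unit C (dom C c)" using f1_inj[OF c(1) _ _ c(3)] f1_unit[of "dom C c"] c by simp
  then show "c \<in> unit C ` {q \<in> topspace (obj C). f0 q \<in> X}" using c x C.cat(2)[OF c(1)] by blast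
next
  fix c assume "c \<in> unit C ` {q \<in> topspace (obj C). f0 q \<in> X}"
  then show "c \<in> pre (unit D ` X)" unfolding pre_def using f1_unit by auto
qed

lemma pre_units: "pre D.units = C.units"
  using pre_unit[of "topspace (obj D)"] f0 by (auto simp: image_iff)

lemma pre_lam:
  assumes A: "A \<in> D.Bis"
  shows "pre (unit D ` dom D ` A) = unit C ` dom C ` pre A" "pre (unit D ` cod D ` A) = unit C ` cod C ` pre A"
proof -
  have "dom D ` A \<subseteq> topspace (obj D)" "cod D ` A \<subseteq> topspace (obj D)" using D.bis_sub[OF A] by auto
  note p = pre_unit[OF this(1)] pre_unit[OF this(2)]
  have "{q \<in> topspace (obj C). f0 q \<in> dom D ` A} = dom C ` pre A"
  proof (intro equalityI subsetI)
    fix q assume "q \<in> {q \<in> topspace (obj C). f0 q \<in> dom D ` A}"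
    then obtain a where a: "q \<in> topspace (obj C)" "a \<in> A" "dom D a = f0 q" by auto
    then show "q \<in> dom C ` pre A" using lift_dom[OF a(1) D.bis_sub[OF A a(2)] a(3)] unfolding pre_def by blast
  next
    fix q assume "q \<in> dom C ` pre A"
    then obtain c a where "c \<in> topspace (arr C)" "q = dom C c" "a \<in> f1 c" "a \<in> A" unfolding pre_def by blast
    then show "q \<in> {q \<in> topspace (obj C). f0 q \<in> dom D ` A}" using f1_dom by force
  qed
  then show "pre (unit D ` dom D ` A) = unit C ` dom C ` pre A" using p by simp
  have "{q \<in> topspace (obj C). f0 q \<in> cod D ` A} = cod C ` pre A"
  proof (intro equalityI subsetI)
    fix q assume "q \<in> {q \<in> topspace (obj C). f0 q \<in> cod D ` A}"
    then obtain a where a: "q \<in> topspace (obj C)" "a \<in> A" "cod D a = f0 q" by auto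
    then show "q \<in> cod C ` pre A" using lift_cod[OF a(1) D.bis_sub[OF A a(2)] a(3)] unfolding pre_def by blast
  next
    fix q assume "q \<in> cod C ` pre A"
    then obtain c a where "c \<in> topspace (arr C)" "q = cod C c" "a \<in> f1 c" "a \<in> A" unfolding pre_def by blast
    then show "q \<in> {q \<in> topspace (obj C). f0 q \<in> cod D ` A}" using f1_cod by force
  qed
  then show "pre (unit D ` cod D ` A) = unit C ` cod C ` pre A" using p by simp
qed

lemma pre_Union: "pre (\<Union>F) = \<Union>(pre ` F)"
  unfolding pre_def by blast

end

lemma etale_morD:
  assumes "f \<in> etale_mor k C D"
  shows "relational_covering C D (fst f, snd f)"
    and "fst f \<in> extensional (topspace (arr C))" "snd f \<in> extensional (topspace (obj C))"
    and "k \<in> {2, 4} \<Longrightarrow> c \<in> topspace (arr C) \<Longrightarrow> fst f c \<noteq> {}"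
    and "k \<in> {3, 4} \<Longrightarrow> c \<in> topspace (arr C) \<Longrightarrow> s \<in> fst f c \<Longrightarrow> t \<in> fst f c \<Longrightarrow> s = t"
  using assms unfolding etale_mor_def by auto

lemma etale_mor_covering:
  assumes "etale C" "etale D" "f \<in> etale_mor k C D"
  shows "rel_covering C D (fst f) (snd f)"
  by unfold_locales (use assms etale_morD(1)[OF assms(3)] in simp_all)

text \<open>Each clause for the composite follows from the same clause for the factors, because arrows of
  \<open>D\<close> related to composable arrows of \<open>C\<close> are composable, and those related to arrows with a common
  endpoint have a common endpoint.\<close>

lemma etale_mor_comp:
  assumes e: "etale C" "etale D" "etale E" and f: "f \<in> etale_mor k C D" and g: "g \<in> etale_mor k D E"
  shows "rel_comp C g f \<in> etale_mor k C E"
proof -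
  interpret f: rel_covering C D "fst f" "snd f" using etale_mor_covering e f by blast
  interpret g: rel_covering D E "fst g" "snd g" using etale_mor_covering e g by blast
  let ?h1 = "restrict (\<lambda>a. \<Union>b\<in>fst f a. fst g b) (topspace (arr C))"
  let ?h0 = "compose (topspace (obj C)) (snd g) (snd f)"
  have h1: "s \<in> ?h1 a \<longleftrightarrow> (\<exists>b\<in>fst f a. s \<in> fst g b)" if "a \<in> topspace (arr C)" for a s
    using that by auto
  have h0: "?h0 x = snd g (snd f x)" if "x \<in> topspace (obj C)" for x using that by (simp add: compose_def)
  have "relational_covering C E (?h1, ?h0)"
    unfolding relational_covering_def prod.case
  proof (intro conjI)
    show "continuous_map (obj C) (obj E) ?h0"
      using continuous_map_compose[OF f.cont0 g.cont0] by (rule continuous_map_eq) (auto simp: h0)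
    show "\<forall>a\<in>topspace (arr C). ?h1 a \<subseteq> topspace (arr E)"
      using f.f1_arr g.f1_arr by (auto simp: h1)
    show "\<forall>a\<in>topspace (arr C). \<forall>b\<in>?h1 a. dom E b = ?h0 (dom C a) \<and> cod E b = ?h0 (cod C a)"
    proof (intro ballI)
      fix a s assume a: "a \<in> topspace (arr C)" "s \<in> ?h1 a"
      then obtain b where b: "b \<in> fst f a" "s \<in> fst g b" using h1 by blast
      have "b \<in> topspace (arr D)" using f.f1_arr a b by blast
      then show "dom E s = ?h0 (dom C a) \<and> cod E s = ?h0 (cod C a)"
        using a b f.f1_dom f.f1_cod g.f1_dom g.f1_cod by (simp add: h0)
    qed
    show "\<forall>(a, b)\<in>topspace (composable C). \<forall>(s, t)\<in>topspace (composable E).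
        s \<in> ?h1 a \<and> t \<in> ?h1 b \<longrightarrow> comp E s t \<in> ?h1 (comp C a b)"
    proof (intro ballI, clarsimp simp: f.C.topspace_composable g.D.topspace_composable)
      fix a b s t x y
      assume a: "a \<in> topspace (arr C)" "b \<in> topspace (arr C)" "dom C a = cod C b"
        and x: "x \<in> fst f a" "s \<in> fst g x" and y: "y \<in> fst f b" "t \<in> fst g y"
      have xy: "x \<in> topspace (arr D)" "y \<in> topspace (arr D)" "dom D x = cod D y"
        using f.f1_arr f.f1_dom f.f1_cod a x y by auto
      show "\<exists>z\<in>fst f (comp C a b). comp E s t \<in> fst g z"
        using f.f1_mult[OF a x(1) y(1)] g.f1_mult[OF xy x(2) y(2)] by blast
    qed
    show "\<forall>a\<in>topspace (arr C). \<forall>b\<in>topspace (arr C).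
        (dom C a = dom C b \<or> cod C a = cod C b) \<and> ?h1 a \<inter> ?h1 b \<noteq> {} \<longrightarrow> a = b"
    proof (intro ballI impI)
      fix a b assume a: "a \<in> topspace (arr C)" "b \<in> topspace (arr C)"
        and ab: "(dom C a = dom C b \<or> cod C a = cod C b) \<and> ?h1 a \<inter> ?h1 b \<noteq> {}"
      then obtain s where "s \<in> ?h1 a" "s \<in> ?h1 b" by blast
      then obtain x y where x: "x \<in> fst f a" "s \<in> fst g x" and y: "y \<in> fst f b" "s \<in> fst g y"
        using h1[OF a(1)] h1[OF a(2)] by blast
      have "x \<in> topspace (arr D)" "y \<in> topspace (arr D)" "dom D x = dom D y \<or> cod D x = cod D y"
        using f.f1_arr f.f1_dom f.f1_cod a x y ab by auto
      then have "x = y" using g.f1_inj x y by blast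
      then show "a = b" using f.f1_inj[OF a] ab x y by blast
    qed
    show "\<forall>q\<in>topspace (obj C). \<forall>s\<in>topspace (arr E).
        (dom E s = ?h0 q \<longrightarrow> (\<exists>t\<in>topspace (arr C). dom C t = q \<and> s \<in> ?h1 t)) \<and>
        (cod E s = ?h0 q \<longrightarrow> (\<exists>t\<in>topspace (arr C). cod C t = q \<and> s \<in> ?h1 t))"
    proof (intro ballI conjI impI)
      fix q s assume q: "q \<in> topspace (obj C)" and s: "s \<in> topspace (arr E)"
      show "\<exists>t\<in>topspace (arr C). dom C t = q \<and> s \<in> ?h1 t" if e: "dom E s = ?h0 q"
      proof -
        have "dom E s = snd g (snd f q)" using e h0[OF q] by simp
        then obtain t where t: "t \<in> topspace (arr D)" "dom D t = snd f q" "s \<in> fst g t"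
          using g.lift_dom[OF f.f0[OF q] s] by blast
        then obtain c where "c \<in> topspace (arr C)" "dom C c = q" "t \<in> fst f c" using f.lift_dom[OF q t(1)] by blast
        then show ?thesis using t h1 by blast
      qed
      show "\<exists>t\<in>topspace (arr C). cod C t = q \<and> s \<in> ?h1 t" if e: "cod E s = ?h0 q"
      proof -
        have "cod E s = snd g (snd f q)" using e h0[OF q] by simp
        then obtain t where t: "t \<in> topspace (arr D)" "cod D t = snd f q" "s \<in> fst g t"
          using g.lift_cod[OF f.f0[OF q] s] by blast
        then obtain c where "c \<in> topspace (arr C)" "cod C c = q" "t \<in> fst f c" using f.lift_cod[OF q t(1)] by blast
        then show ?thesis using t h1 by blast
      qed
    qed
    show "\<forall>A. openin (arr E) A \<longrightarrow> openin (arr C) {x \<in> topspace (arr C). ?h1 x \<inter> A \<noteq> {}}"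
    proof (intro allI impI)
      fix A assume "openin (arr E) A"
      then have "openin (arr C) {x \<in> topspace (arr C). fst f x \<inter> {y \<in> topspace (arr D). fst g y \<inter> A \<noteq> {}} \<noteq> {}}"
        using f.f1_open g.f1_open by blast
      also have "{x \<in> topspace (arr C). fst f x \<inter> {y \<in> topspace (arr D). fst g y \<inter> A \<noteq> {}} \<noteq> {}}
          = {x \<in> topspace (arr C). ?h1 x \<inter> A \<noteq> {}}"
        using f.f1_arr h1 by blast
      finally show "openin (arr C) {x \<in> topspace (arr C). ?h1 x \<inter> A \<noteq> {}}" .
    qed
    show "\<forall>t\<in>topspace (obj C). unit E (?h0 t) \<in> ?h1 (unit C t)"
    proof
      fix t assume t: "t \<in> topspace (obj C)"
      show "unit E (?h0 t) \<in> ?h1 (unit C t)"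
        using f.f1_unit[OF t] g.f1_unit[OF f.f0[OF t]] h0[OF t] h1[OF f.C.cat(1)[OF t]] by auto
    qed
  qed
  moreover have "?h1 c \<noteq> {}" if k: "k \<in> {2, 4}" and c: "c \<in> topspace (arr C)" for c
  proof -
    obtain b where "b \<in> fst f c" using etale_morD(4)[OF f k c] by blast
    moreover from this have "fst g b \<noteq> {}" using etale_morD(4)[OF g k] f.f1_arr c by blast
    ultimately show ?thesis using h1[OF c] by blast
  qed
  moreover have "s = t" if k: "k \<in> {3, 4}" and c: "c \<in> topspace (arr C)" and st: "s \<in> ?h1 c" "t \<in> ?h1 c" for c s t
  proof -
    obtain x y where x: "x \<in> fst f c" "s \<in> fst g x" "y \<in> fst f c" "t \<in> fst g y" using st h1[OF c] by blast
    then have "x = y" using etale_morD(5)[OF f k c] by blast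
    then show ?thesis using etale_morD(5)[OF g k] x f.f1_arr[OF c] by blast
  qed
  ultimately show ?thesis
    unfolding etale_mor_def rel_comp_def by (simp add: compose_def)
qed

lemma etale_mor_id:
  assumes "etale C" shows "rel_ide C \<in> etale_mor k C C"
proof -
  interpret C: etale_category C by unfold_locales fact
  define i1 i0 where "i1 = restrict (\<lambda>a. {a}) (topspace (arr C))" and "i0 = restrict id (topspace (obj C))"
  have i1: "i1 a = {a}" if "a \<in> topspace (arr C)" for a using that by (simp add: i1_def)
  have i0: "i0 x = x" if "x \<in> topspace (obj C)" for x using that by (simp add: i0_def)
  have "relational_covering C C (i1, i0)"
    unfolding relational_covering_def prod.case
  proof (intro conjI)
    show "continuous_map (obj C) (obj C) i0"
      by (rule continuous_map_eq[of _ _ id]) (auto simp: i0)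
    show "\<forall>A. openin (arr C) A \<longrightarrow> openin (arr C) {x \<in> topspace (arr C). i1 x \<inter> A \<noteq> {}}"
    proof (intro allI impI)
      fix A assume A: "openin (arr C) A"
      have "(i1 x \<inter> A \<noteq> {}) = (x \<in> A)" if "x \<in> topspace (arr C)" for x using i1[OF that] by simp
      then have "{x \<in> topspace (arr C). i1 x \<inter> A \<noteq> {}} = A" using openin_subset[OF A] by blast
      then show "openin (arr C) {x \<in> topspace (arr C). i1 x \<inter> A \<noteq> {}}" using A by simp
    qed
    show "\<forall>(a, b)\<in>topspace (composable C). \<forall>(s, t)\<in>topspace (composable C).
        s \<in> i1 a \<and> t \<in> i1 b \<longrightarrow> comp C s t \<in> i1 (comp C a b)"
    proof (intro ballI, clarify)
      fix a b s t assume "(a, b) \<in> topspace (composable C)" and st: "s \<in> i1 a" "t \<in> i1 b"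
      then have ab: "a \<in> topspace (arr C)" "b \<in> topspace (arr C)" "dom C a = cod C b"
        unfolding C.topspace_composable by auto
      then have "s = a" "t = b" using st i1 by auto
      then show "comp C s t \<in> i1 (comp C a b)" using i1[OF C.comp(1)[OF ab]] by simp
    qed
  qed (auto simp: i1 i0)
  moreover have "i1 \<in> extensional (topspace (arr C))" "i0 \<in> extensional (topspace (obj C))"
    by (simp_all add: i1_def i0_def)
  ultimately have "(i1, i0) \<in> etale_mor k C C" unfolding etale_mor_def using i1 by auto
  then show ?thesis unfolding rel_ide_def i1_def i0_def .
qed

lemma is_category_ETALE: "is_category (ETALE small Q k)"
proof -
  have a: "rel_comp W h (rel_comp W g f) = rel_comp W (rel_comp X h g) f"
    if "etale W" "etale X" "f \<in> etale_mor k W X" for W X :: "('a, 'a) tcat" and f g h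
  proof -
    interpret f: rel_covering W X "fst f" "snd f" using etale_mor_covering that by blast
    show ?thesis
      unfolding rel_comp_def compose_def using f.f1_arr
      by (auto simp: fun_eq_iff restrict_def)
  qed
  have i: "rel_comp X f (rel_ide X) = f" "rel_comp X (rel_ide Y) f = f"
    if "etale X" "etale Y" "f \<in> etale_mor k X Y" for X Y :: "('a, 'a) tcat" and f
  proof -
    interpret f: rel_covering X Y "fst f" "snd f" using etale_mor_covering that by blast
    note e = etale_morD(2,3)[OF that(3)]
    have "(\<Union>b\<in>fst f a. restrict (\<lambda>a. {a}) (topspace (arr Y)) b) = fst f a" if "a \<in> topspace (arr X)" for a
      using f.f1_arr[OF that] by auto
    then show "rel_comp X f (rel_ide X) = f" "rel_comp X (rel_ide Y) f = f"
      using e unfolding rel_comp_def rel_ide_def compose_def extensional_def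
      by (auto simp: prod_eq_iff fun_eq_iff restrict_def)
  qed
  show ?thesis
    unfolding is_category_def ETALE_def
    by (intro conjI ballI) (auto simp: etale_mor_id etale_mor_comp a i)
qed

section \<open>The functor of bisections\<close>

text \<open>The inverse image of bisections along \<open>f\<close>, as a map between codes.\<close>

definition preimage :: "('c set \<Rightarrow> 'b) \<Rightarrow> ('d set \<Rightarrow> 'a) \<Rightarrow> ('c, 'o) tcat \<Rightarrow> ('d, 'p) tcat \<Rightarrow>
    ('c, 'o, 'd, 'p) rel_mor \<Rightarrow> 'a \<Rightarrow> 'b" where
  "preimage i j C D f = restrict
     (\<lambda>x. i {c \<in> topspace (arr C). fst f c \<inter> decode j (topspace (arr D)) x \<noteq> {}})
     (j ` carrier (bisections D))"

lemma preimage_crm_mor: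
  assumes e: "etale C" "etale D" and f: "f \<in> etale_mor k C D"
    and i: "inj_on i (Pow (topspace (arr C)))" and j: "inj_on j (Pow (topspace (arr D)))"
  shows "preimage i j C D f \<in> crm_mor k (encode_crm j (topspace (arr D)) (bisections D))
           (encode_crm i (topspace (arr C)) (bisections C))"
proof -
  interpret f: rel_covering C D "fst f" "snd f" using etale_mor_covering e f by blast
  interpret C: bisection_monoid C i by unfold_locales (fact i)
  interpret D: bisection_monoid D j by unfold_locales (fact j)
  let ?p = "preimage i j C D f"
  have p: "?p (j A) = i (f.pre A)" if "A \<in> f.D.Bis" for A
    using that D.dec_j unfolding preimage_def f.pre_def by simp
  have inj: "inj_on i (Pow (topspace (arr C)))" by (fact i)
  have dp: "C.dec (i (f.pre A)) = f.pre A" if "A \<in> f.D.Bis" for A using f.pre_bis that by simp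
  have "crm_morphism D.GC C.GC ?p"
    unfolding crm_morphism_iff[OF D.complete_GC C.complete_GC]
  proof (intro conjI ballI allI impI)
    show "?p \<in> carrier D.GC \<rightarrow> carrier C.GC" using p f.pre_bis by auto
    show "?p \<one>\<^bsub>D.GC\<^esub> = \<one>\<^bsub>C.GC\<^esub>" using p f.D.units_bis f.pre_units by simp
  next
    fix F assume F: "F \<subseteq> Proj D.GC"
    have U: "\<Union>(D.dec ` F) \<in> f.D.Bis" using D.Union_proj[OF F] f.D.proj_bis by blast
    have pF: "?p ` F \<subseteq> Proj C.GC"
    proof
      fix y assume "y \<in> ?p ` F"
      then obtain A where A: "A \<in> Proj (bisections D)" "y = ?p (j A)" using F by auto
      then have "A \<in> f.D.Bis" "unit D ` dom D ` A = A"
      proof -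
        show "A \<in> f.D.Bis" using f.D.proj_bis A by blast
        have "unit D (dom D u) = u" if "u \<in> A" for u
          using f.D.unit_eq(1)[of u] A(1) that unfolding f.D.proj_iff by blast
        then show "unit D ` dom D ` A = A" unfolding image_image by simp
      qed
      then have "y = i (f.pre A)" "f.pre A \<in> Proj (bisections C)"
        using A p f.pre_lam(1)[of A] f.C.lam_proj[OF f.pre_bis[of A]] by auto
      then show "y \<in> Proj C.GC" by simp
    qed
    have "C.dec ` ?p ` F = f.pre ` D.dec ` F"
      unfolding image_image
    proof (rule image_cong)
      fix x assume "x \<in> F"
      then obtain A where "x = j A" "A \<in> f.D.Bis" using F f.D.proj_bis by auto
      then show "C.dec (?p x) = f.pre (D.dec x)" using p dp by simp
    qed simp
    then have "f.pre (\<Union>(D.dec ` F)) = \<Union>(C.dec ` ?p ` F)" by (simp add: f.pre_Union)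
    then show "?p (\<Squnion>\<^bsub>proj_order D.GC\<^esub> F) = \<Squnion>\<^bsub>proj_order C.GC\<^esub> (?p ` F)"
      unfolding D.Lub_GC[OF F] C.Lub_GC[OF pF] p[OF U] by simp
  next
    fix x assume "x \<in> carrier D.GC"
    then obtain A where A: "x = j A" "A \<in> f.D.Bis" by auto
    have b: "unit D ` dom D ` A \<in> f.D.Bis" "unit D ` cod D ` A \<in> f.D.Bis"
      using f.D.lam_proj f.D.rho_proj f.D.proj_bis A by auto
    show "?p (lam D.GC x) = lam C.GC (?p x)" "?p (rho D.GC x) = rho C.GC (?p x)"
      using A b p dp f.pre_lam[OF A(2)] by auto
    fix y assume "y \<in> carrier D.GC"
    then obtain B where B: "y = j B" "B \<in> f.D.Bis" by auto
    show "?p (x \<otimes>\<^bsub>D.GC\<^esub> y) = ?p x \<otimes>\<^bsub>C.GC\<^esub> ?p y"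
      using A B p dp f.pre_mult[OF A(2) B(2)] f.D.bmult_bis[OF A(2) B(2)] by simp
  qed
  moreover have "proper_morphism D.GC C.GC ?p" if k: "k \<in> {2, 4}"
  proof -
    have "?p \<in> carrier D.GC \<rightarrow> carrier C.GC" using p f.pre_bis by auto
    moreover have "\<exists>s\<in>carrier D.GC. c \<in> C.dec (?p s)" if c: "c \<in> topspace (arr C)" for c
    proof -
      obtain s where s: "s \<in> fst f c" using etale_morD(4)[OF f k c] by blast
      then obtain A where A: "A \<in> f.D.Bis" "s \<in> A" using f.D.ex_bis f.f1_arr[OF c] by blast
      then have "c \<in> f.pre A" unfolding f.pre_def using c s by blast
      then show ?thesis using A p dp by (intro bexI[of _ "j A"]) auto
    qed
    ultimately show ?thesis using C.proper_iff_cover by blast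
  qed
  moreover have "wedge_morphism D.GC C.GC ?p" if k: "k \<in> {3, 4}"
    unfolding wedge_morphism_def
  proof (intro ballI)
    fix x y assume "x \<in> carrier D.GC" "y \<in> carrier D.GC"
    then obtain A B where A: "x = j A" "A \<in> f.D.Bis" and B: "y = j B" "B \<in> f.D.Bis" by auto
    have "f.pre (A \<inter> B) = f.pre A \<inter> f.pre B"
      unfolding f.pre_def using etale_morD(5)[OF f k] by blast
    then show "?p (wedge D.GC x y) = wedge C.GC (?p x) (?p y)"
      using A B p f.pre_bis D.bis_inter by simp
  qed
  moreover have "?p \<in> extensional (carrier D.GC)" unfolding preimage_def by simp
  ultimately show ?thesis unfolding crm_mor_def by blast
qed

lemma preimage_id:
  assumes "etale C" and i: "inj_on i (Pow (topspace (arr C)))"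
  shows "preimage i i C C (rel_ide C) = restrict id (carrier (encode_crm i (topspace (arr C)) (bisections C)))"
proof -
  interpret bisection_monoid C i by unfold_locales (fact assms)+
  have "{c \<in> topspace (arr C). fst (rel_ide C) c \<inter> A \<noteq> {}} = A" if "A \<in> Bis" for A
    using bis_sub[OF that] by (auto simp: rel_ide_def)
  then show ?thesis unfolding preimage_def by (auto simp: fun_eq_iff restrict_def)
qed

lemma preimage_comp:
  assumes e: "etale C" "etale D" "etale E" and f: "f \<in> etale_mor k C D" and g: "g \<in> etale_mor k D E"
    and ijh: "inj_on i (Pow (topspace (arr C)))" "inj_on j (Pow (topspace (arr D)))" "inj_on h (Pow (topspace (arr E)))"
  shows "preimage i h C E (rel_comp C g f) =
    compose (carrier (encode_crm h (topspace (arr E)) (bisections E))) (preimage i j C D f) (preimage j h D E g)"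
proof
  fix x
  interpret f: rel_covering C D "fst f" "snd f" using etale_mor_covering e f by blast
  interpret g: rel_covering D E "fst g" "snd g" using etale_mor_covering e g by blast
  interpret D: bisection_monoid D j by unfold_locales (fact ijh)
  interpret E: bisection_monoid E h by unfold_locales (fact ijh)
  show "preimage i h C E (rel_comp C g f) x =
    compose (carrier E.GC) (preimage i j C D f) (preimage j h D E g) x"
  proof (cases "x \<in> carrier E.GC")
    case True
    then obtain A where A: "A \<in> g.D.Bis" "x = h A" by auto
    have gx: "preimage j h D E g x = j (g.pre A)" using A by (simp add: preimage_def g.pre_def)
    have "preimage i j C D f (j (g.pre A)) = i (f.pre (g.pre A))"
      using g.pre_bis[OF A(1)] by (simp add: preimage_def f.pre_def)
    moreover have "{c \<in> topspace (arr C). fst (rel_comp C g f) c \<inter> A \<noteq> {}} = f.pre (g.pre A)"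
      unfolding f.pre_def g.pre_def rel_comp_def using f.f1_arr by auto
    moreover have "preimage i h C E (rel_comp C g f) x
        = i {c \<in> topspace (arr C). fst (rel_comp C g f) c \<inter> A \<noteq> {}}"
      using A by (simp add: preimage_def)
    moreover have "compose (carrier E.GC) (preimage i j C D f) (preimage j h D E g) x
        = preimage i j C D f (preimage j h D E g x)"
      using True by (simp only: compose_def restrict_apply' o_apply)
    ultimately show ?thesis using gx by (simp only:)
  qed (simp add: preimage_def compose_def)
qed

section \<open>The universal arrow\<close>

text \<open>The unit of the adjunction sends \<open>s\<close> to the bisection of all germs of \<open>s\<close>.\<close>

definition eta :: "('b set \<Rightarrow> 'c) \<Rightarrow> ('a set \<Rightarrow> 'b) \<Rightarrow> 'a crm \<Rightarrow> 'a \<Rightarrow> 'c" where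
  "eta h j S = restrict (\<lambda>s. h (j ` {A. is_germ S A \<and> s \<in> A})) (carrier S)"

context germs
begin

lemma U_bis: "s \<in> carrier S \<Longrightarrow> U s \<in> carrier (bisections C)"
  unfolding bisections_def using open_U inj_dom_U inj_cod_U by simp

text \<open>A germ containing \<open>\<Or> F\<close> is the unit at a filter containing \<open>\<Or> F\<close>. As the filter is
  completely prime, it contains some \<open>e \<in> F\<close>, and then so does the germ.\<close>

lemma U_Lub: "F \<subseteq> E \<Longrightarrow> U (\<Or> F) = \<Union>(U ` F)"
proof (intro equalityI subsetI)
  fix x assume F: "F \<subseteq> E" and "x \<in> U (\<Or> F)"
  then obtain A where A: "is_germ S A" "x = j A" "\<Or> F \<in> A" by blast
  note g = germ_of_projection[OF A(1,3) Lub_closed[OF F]]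
  obtain e where e: "e \<in> F" "e \<in> src S A" using filterD(5)[OF is_germD(1)[OF A(1)] F g(2)] by blast
  then have "e \<in> A" using germ_one(4)[OF is_germD(1)[OF A(1)]] g(1) by blast
  then show "x \<in> \<Union>(U ` F)" using A e by blast
next
  fix x assume F: "F \<subseteq> E" and "x \<in> \<Union>(U ` F)"
  then obtain A e where A: "is_germ S A" "x = j A" "e \<in> A" "e \<in> F" by blast
  then have "\<Or> F \<in> A" using is_germD(8) Lub_upper[OF F] Lub_closed[OF F] E_carrier by blast
  then show "x \<in> U (\<Or> F)" using A by blast
qed

text \<open>A germ containing \<open>s\<close> and \<open>t\<close> contains a common lower bound of them. If there is none, no
  germ contains both, and none contains the bottom projection either: this is what makes the
  convention for missing meets harmless.\<close>

lemma U_wedge: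
  assumes s: "s \<in> carrier S" and t: "t \<in> carrier S"
  shows "U (wedge S s t) = U s \<inter> U t"
proof -
  from wedge_cases[OF s t] show ?thesis
  proof
    assume m: "is_meet S (wedge S s t) {s, t}"
    note m = m[unfolded is_meet_iff[OF s t]]
    show ?thesis
    proof (intro equalityI subsetI)
      fix x assume "x \<in> U (wedge S s t)"
      then show "x \<in> U s \<inter> U t" using m is_germD(8) s t by blast
    next
      fix x assume "x \<in> U s \<inter> U t"
      then obtain A where A: "is_germ S A" "x = j A" "s \<in> A" "t \<in> A" using in_U by blast
      then obtain c where c: "c \<in> A" "c \<preceq> s" "c \<preceq> t" using germ_meet by blast
      then have "wedge S s t \<in> A" using m is_germD(4,8)[OF A(1)] by blast
      then show "x \<in> U (wedge S s t)" using A by blast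
    qed
  next
    assume m: "(\<nexists>c. c \<preceq> s \<and> c \<preceq> t) \<and> wedge S s t = \<Or> {}"
    then have "U (wedge S s t) = {}" using U_Lub[of "{}"] by simp
    moreover have "U s \<inter> U t = {}" using m in_U germ_meet by blast
    ultimately show ?thesis by simp
  qed
qed

lemma U_one: "U \<one> = unit C ` topspace (obj C)"
proof -
  have "V \<one> = topspace (obj C)" using filterD(2) by auto
  then show ?thesis using unit_V[OF one_E] by simp
qed

lemma eta_crm_mor:
  assumes h: "inj_on h (Pow (topspace (arr C)))"
  shows "eta h j S \<in> crm_mor k S (encode_crm h (topspace (arr C)) (bisections C))"
proof -
  interpret B: bisection_monoid C h by unfold_locales (use h etale_germ_cat in auto)
  \<comment> \<open>decoding is recognised by the arrow space it refers to, which must not be rewritten\<close>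
  note [simp del] = topspace_C
  have eta: "eta h j S s = h (U s)" if "s \<in> carrier S" for s using that by (simp add: eta_def)
  have dU: "B.dec (h (U s)) = U s" if "s \<in> carrier S" for s using U_bis[OF that] by (rule B.dec_j)
  have b: "U s \<in> B.Bis" if "s \<in> carrier S" for s using U_bis that by simp
  have lr: "unit C ` dom C ` U s = U (l s)" "unit C ` cod C ` U s = U (r s)" if "s \<in> carrier S" for s
    using dom_U[OF that] cod_U[OF that] unit_V lr_closed that by simp_all
  have "crm_morphism S B.GC (eta h j S)"
    unfolding crm_morphism_iff[OF crm B.complete_GC]
  proof (intro conjI ballI allI impI)
    show "eta h j S \<in> carrier S \<rightarrow> carrier B.GC" using eta b by auto
    show "eta h j S \<one> = \<one>\<^bsub>B.GC\<^esub>" using eta U_one by simp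
  next
    fix F assume F: "F \<subseteq> E"
    have c: "f \<in> carrier S" if "f \<in> F" for f using F that by auto
    have "h (U f) \<in> Proj B.GC" if "f \<in> F" for f
    proof -
      have "f \<in> E" using F that by blast
      then have "U f = unit C ` dom C ` U f" using lr(1)[of f] by simp
      then have "U f \<in> Proj (bisections C)" using B.lam_proj[OF b[OF c[OF that]]] by simp
      then show ?thesis by simp
    qed
    then have P: "eta h j S ` F \<subseteq> Proj B.GC" using eta c by auto
    have "B.dec ` eta h j S ` F = U ` F"
      unfolding image_image by (intro image_cong refl) (simp add: eta c dU)
    then show "eta h j S (\<Or> F) = \<Squnion>\<^bsub>proj_order B.GC\<^esub> (eta h j S ` F)"
      unfolding B.Lub_GC[OF P] using eta U_Lub[OF F] F by simp
  next
    fix s assume s: "s \<in> carrier S"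
    show "eta h j S (l s) = lam B.GC (eta h j S s)" "eta h j S (r s) = rho B.GC (eta h j S s)"
      using s eta dU lr by simp_all
    fix t assume t: "t \<in> carrier S"
    have "U s \<otimes>\<^bsub>bisections C\<^esub> U t = U (s \<otimes> t)"
      unfolding comp_U[OF s t, symmetric] B.topspace_composable
      using B.bis_sub[OF b[OF s]] B.bis_sub[OF b[OF t]]
      by (auto simp: bisections_def image_iff)
    then show "eta h j S (s \<otimes> t) = eta h j S s \<otimes>\<^bsub>B.GC\<^esub> eta h j S t"
      using s t eta dU by simp
  qed
  moreover have "proper_morphism S B.GC (eta h j S)"
  proof -
    have "eta h j S \<in> carrier S \<rightarrow> carrier B.GC" using eta b by auto
    moreover have "\<exists>s\<in>carrier S. c \<in> B.dec (eta h j S s)" if "c \<in> topspace (arr C)" for c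
      using ex_U[OF that] eta dU by auto
    ultimately show ?thesis using B.proper_iff_cover by blast
  qed
  moreover have "wedge_morphism S B.GC (eta h j S)"
    unfolding wedge_morphism_def
  proof (intro ballI)
    fix s t assume s: "s \<in> carrier S" and t: "t \<in> carrier S"
    have "wedge S s t \<in> carrier S"
      using wedge_cases[OF s t] is_meet_iff[OF s t] Lub_closed[of "{}"] by auto
    then show "eta h j S (wedge S s t) = wedge B.GC (eta h j S s) (eta h j S t)"
      using s t eta b U_wedge by simp
  qed
  moreover have "eta h j S \<in> extensional (carrier S)" by (simp add: eta_def)
  ultimately show ?thesis unfolding crm_mor_def by blast
qed

end

text \<open>A morphism \<open>\<phi>\<close> from \<open>S\<close> to the bisections of \<open>D\<close> assigns to an object \<open>q\<close> the filter of those
  projections whose value contains the unit at \<open>q\<close>, and to an arrow \<open>c\<close> the germs, at the filter of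
  its domain, of those elements \<open>s\<close> whose value contains \<open>c\<close>. As \<open>\<phi>\<close> need not preserve meets, there
  may be several such germs, and as it need not be proper, there may be none.\<close>

locale into_bisections = germs S j + D: bisection_monoid D i
  for S :: "'a crm" and j :: "'a set \<Rightarrow> 'b" and D :: "('c, 'o) tcat" and i :: "'c set \<Rightarrow> 'd" +
  fixes \<phi>
  assumes \<phi>: "crm_morphism S (encode_crm i (topspace (arr D)) (bisections D)) \<phi>"
begin

sublocale H: crm_hom S D.GC \<phi>
  by unfold_locales (fact \<phi>)

definition \<psi> where "\<psi> s = D.dec (\<phi> s)"
definition pt where "pt q = {e \<in> Proj S. unit D q \<in> \<psi> e}"
definition germs_of where
  "germs_of c = {A. is_germ S A \<and> src S A = pt (dom D c) \<and> (\<exists>s\<in>A. c \<in> \<psi> s)}"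

lemma \<psi>_bis: "s \<in> carrier S \<Longrightarrow> \<psi> s \<in> D.Bis"
  using H.map D.dec_bis(1) unfolding \<psi>_def by blast

lemma \<phi>_\<psi>: "s \<in> carrier S \<Longrightarrow> \<phi> s = i (\<psi> s)"
  using H.map D.dec_bis(2) unfolding \<psi>_def by simp

lemma \<psi>_mult: "s \<in> carrier S \<Longrightarrow> t \<in> carrier S \<Longrightarrow> \<psi> (s \<otimes>\<^bsub>S\<^esub> t) = \<psi> s \<otimes>\<^bsub>bisections D\<^esub> \<psi> t"
  using H.mult \<psi>_bis D.bmult_bis by (simp add: \<psi>_def)

lemma \<psi>_l: "s \<in> carrier S \<Longrightarrow> \<psi> (lam S s) = unit D ` dom D ` \<psi> s"
  using H.lam[of s] D.lam_proj[OF \<psi>_bis[of s], THEN D.proj_bis] by (simp add: \<psi>_def)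

lemma \<psi>_r: "s \<in> carrier S \<Longrightarrow> \<psi> (rho S s) = unit D ` cod D ` \<psi> s"
  using H.rho[of s] D.rho_proj[OF \<psi>_bis[of s], THEN D.proj_bis] by (simp add: \<psi>_def)

lemma \<psi>_one: "\<psi> \<one>\<^bsub>S\<^esub> = D.units"
  using H.one D.units_bis by (simp add: \<psi>_def)

lemma \<psi>_proj: "e \<in> Proj S \<Longrightarrow> \<psi> e \<in> Proj (bisections D)"
  using H.proj D.dec_proj unfolding \<psi>_def by blast

lemma \<psi>_Lub: "F \<subseteq> Proj S \<Longrightarrow> \<psi> (\<Squnion>\<^bsub>proj_order S\<^esub> F) = \<Union>(\<psi> ` F)"
proof -
  assume F: "F \<subseteq> Proj S"
  then have P: "\<phi> ` F \<subseteq> Proj D.GC" using H.proj by blast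
  have "\<Union>(D.dec ` \<phi> ` F) \<in> D.Bis" using D.Union_proj[OF P] D.proj_bis by blast
  then show ?thesis unfolding \<psi>_def H.Lub[OF F] D.Lub_GC[OF P] by (simp add: image_image)
qed

lemma \<psi>_mono: "natural_le S s t \<Longrightarrow> t \<in> carrier S \<Longrightarrow> \<psi> s \<subseteq> \<psi> t"
  using H.mono[of s t] \<phi>_\<psi>[of s] \<phi>_\<psi>[of t] \<psi>_bis[of s] \<psi>_bis[of t] le_closed[of s t] by simp

lemma pt_filter:
  assumes q: "q \<in> topspace (obj D)" shows "cprime_filter S (pt q)"
  unfolding cprime_filter_def
proof (intro conjI ballI allI impI)
  show "\<one>\<^bsub>S\<^esub> \<in> pt q" using q \<psi>_one by (simp add: pt_def)
next
  fix e f assume "e \<in> pt q" "f \<in> pt q"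
  then show "e \<otimes>\<^bsub>S\<^esub> f \<in> pt q"
    using \<psi>_mult[of e f] D.proj_inter[OF \<psi>_proj[of e] \<psi>_proj[of f]] by (simp add: pt_def)
next
  fix e f assume "e \<in> pt q" "f \<in> Proj S" "natural_le S e f"
  then show "f \<in> pt q" using \<psi>_mono[of e f] by (auto simp: pt_def)
next
  fix F assume F: "F \<subseteq> Proj S" "\<Squnion>\<^bsub>proj_order S\<^esub> F \<in> pt q"
  then show "\<exists>e\<in>F. e \<in> pt q" using \<psi>_Lub[OF F(1)] by (auto simp: pt_def)
qed (auto simp: pt_def)

lemma l_pt: "s \<in> carrier S \<Longrightarrow> q \<in> topspace (obj D) \<Longrightarrow> lam S s \<in> pt q \<longleftrightarrow> (\<exists>c\<in>\<psi> s. dom D c = q)"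
  unfolding pt_def using \<psi>_l[of s] D.bis_sub[OF \<psi>_bis[of s]] D.unit_inj by auto

lemma r_pt: "s \<in> carrier S \<Longrightarrow> q \<in> topspace (obj D) \<Longrightarrow> rho S s \<in> pt q \<longleftrightarrow> (\<exists>c\<in>\<psi> s. cod D c = q)"
  unfolding pt_def using \<psi>_r[of s] D.bis_sub[OF \<psi>_bis[of s]] D.unit_inj by auto

text \<open>If \<open>s\<close> and \<open>b\<close> agree near \<open>pt (dom D c)\<close>, then their values agree near \<open>dom D c\<close>; so whether
  \<open>c\<close> lies in the value of a representative depends only on the germ.\<close>

lemma germs_of_all:
  assumes c: "c \<in> topspace (arr D)" and A: "A \<in> germs_of c" and b: "b \<in> A"
  shows "c \<in> \<psi> b"
proof -
  obtain s where g: "is_germ S A" "src S A = pt (dom D c)" and s: "s \<in> A" "c \<in> \<psi> s"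
    using A unfolding germs_of_def by blast
  have sc: "s \<in> carrier S" "b \<in> carrier S" using is_germD(4)[OF g(1)] s b by auto
  have "b \<in> germ S (pt (dom D c)) s" using is_germD(6)[OF g(1) s(1)] b g(2) by simp
  then obtain e where e: "e \<in> Proj S" "unit D (dom D c) \<in> \<psi> e" "s \<otimes>\<^bsub>S\<^esub> e = b \<otimes>\<^bsub>S\<^esub> e"
    unfolding germ_def pt_def by blast
  have "c \<in> \<psi> s \<otimes>\<^bsub>bisections D\<^esub> \<psi> e"
    using D.bmult_proj(1)[OF \<psi>_bis[OF sc(1)] \<psi>_proj[OF e(1)]] s e by simp
  then have "c \<in> \<psi> b \<otimes>\<^bsub>bisections D\<^esub> \<psi> e" using \<psi>_mult[of s e] \<psi>_mult[of b e] sc e by simp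
  then show ?thesis using D.bmult_proj(1)[OF \<psi>_bis[OF sc(2)] \<psi>_proj[OF e(1)]] by simp
qed

lemma germs_of_tgt:
  assumes c: "c \<in> topspace (arr D)" and A: "A \<in> germs_of c"
  shows "tgt S A = pt (cod D c)"
proof -
  obtain s where g: "is_germ S A" "src S A = pt (dom D c)" and s: "s \<in> A" "c \<in> \<psi> s"
    using A unfolding germs_of_def by blast
  have sc: "s \<in> carrier S" using is_germD(4)[OF g(1)] s by auto
  have "lam S (f \<otimes>\<^bsub>S\<^esub> s) \<in> pt (dom D c) \<longleftrightarrow> unit D (cod D c) \<in> \<psi> f" if f: "f \<in> Proj S" for f
  proof -
    have "lam S (f \<otimes>\<^bsub>S\<^esub> s) \<in> pt (dom D c) \<longleftrightarrow> (\<exists>x\<in>\<psi> s. unit D (cod D x) \<in> \<psi> f \<and> dom D x = dom D c)"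
      using l_pt[of "f \<otimes>\<^bsub>S\<^esub> s" "dom D c"] \<psi>_mult[of f s] f sc c
        D.bmult_proj(2)[OF \<psi>_bis[OF sc] \<psi>_proj[OF f]] by auto
    also have "\<dots> \<longleftrightarrow> unit D (cod D c) \<in> \<psi> f" using D.bis_dom[OF \<psi>_bis[OF sc]] s(2) by blast
    finally show ?thesis .
  qed
  then show ?thesis unfolding is_germD(7)[OF g(1) s(1)] g(2) by (auto simp: pt_def)
qed

lemma germ_in_germs_of:
  assumes s: "s \<in> carrier S" and c: "c \<in> \<psi> s"
  shows "germ S (pt (dom D c)) s \<in> germs_of c"
proof -
  have ca: "c \<in> topspace (arr D)" using D.bis_sub[OF \<psi>_bis[OF s] c] .
  have p: "cprime_filter S (pt (dom D c))" using pt_filter ca by simp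
  have "lam S s \<in> pt (dom D c)" using l_pt[OF s, of "dom D c"] ca c by auto
  then show ?thesis
    unfolding germs_of_def using germ_isI[OF p s] src_germ[OF p s] germ_self[OF p s] c by auto
qed

definition lift :: "('c, 'o, 'b, 'b) rel_mor" where
  "lift = (restrict (\<lambda>c. j ` germs_of c) (topspace (arr D)), restrict (\<lambda>q. j (pt q)) (topspace (obj D)))"

lemma lift1: "c \<in> topspace (arr D) \<Longrightarrow> fst lift c = j ` germs_of c"
  and lift0: "q \<in> topspace (obj D) \<Longrightarrow> snd lift q = j (pt q)"
  by (simp_all add: lift_def)

lemma lift_U: "c \<in> topspace (arr D) \<Longrightarrow> s \<in> carrier S \<Longrightarrow> fst lift c \<inter> U s \<noteq> {} \<longleftrightarrow> c \<in> \<psi> s"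
proof
  assume c: "c \<in> topspace (arr D)" and s: "s \<in> carrier S" and "fst lift c \<inter> U s \<noteq> {}"
  then obtain x where x: "x \<in> fst lift c" "x \<in> U s" by blast
  then obtain A where A: "A \<in> germs_of c" "j A \<in> U s" unfolding lift1[OF c] by blast
  moreover have "is_germ S A" using A(1) unfolding germs_of_def by blast
  ultimately have "s \<in> A" using in_U by blast
  then show "c \<in> \<psi> s" using germs_of_all[OF c A(1)] by blast
next
  assume c: "c \<in> topspace (arr D)" and s: "s \<in> carrier S" and "c \<in> \<psi> s"
  then have g: "germ S (pt (dom D c)) s \<in> germs_of c" using germ_in_germs_of by blast
  moreover have "s \<in> germ S (pt (dom D c)) s" using germ_self[OF pt_filter s] c by simp
  ultimately have "j (germ S (pt (dom D c)) s) \<in> fst lift c \<inter> U s"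
    using lift1[OF c] unfolding germs_of_def by blast
  then show "fst lift c \<inter> U s \<noteq> {}" by blast
qed

text \<open>Existence of lifts is where \<open>\<phi>\<close> has to commute with \<open>\<lambda>\<close> and \<open>\<rho>\<close>: there is a germ of
  \<open>s\<close> with source \<open>pt q\<close> exactly when \<open>q\<close> is the domain of an arrow in the value of \<open>s\<close>, and
  dually for targets. Uniqueness of lifts holds because the values of \<open>\<phi>\<close> are bisections.\<close>

lemma lift_covering: "relational_covering D C lift"
proof -
  define f1 f0 where "f1 = fst lift" and "f0 = snd lift"
  have f1: "f1 c = j ` germs_of c" if "c \<in> topspace (arr D)" for c using lift1 that f1_def by simp
  have f0: "f0 q = j (pt q)" if "q \<in> topspace (obj D)" for q using lift0 that f0_def by simp
  have g: "is_germ S A" "src S A = pt (dom D c)" if "A \<in> germs_of c" for A c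
    using that unfolding germs_of_def by auto
  have "relational_covering D C (f1, f0)"
    unfolding relational_covering_def prod.case
  proof (intro conjI)
    show "continuous_map (obj D) (obj C) f0"
      unfolding obj_C
    proof (rule continuous_map_baseI[OF base_V])
      show "f0 \<in> topspace (obj D) \<rightarrow> j ` {p. cprime_filter S p}" using f0 pt_filter by auto
      fix N q assume "N \<in> V ` Proj S" and q: "q \<in> topspace (obj D)" "f0 q \<in> N"
      then obtain e where e: "e \<in> Proj S" "N = V e" by blast
      have "j (pt q) \<in> V e" using q f0 e by simp
      then have "e \<in> pt q" using in_V[OF pt_filter[OF q(1)]] by blast
      then have u: "unit D q \<in> \<psi> e" by (simp add: pt_def)
      have eb: "openin (arr D) (\<psi> e)" "\<psi> e \<subseteq> D.units" using \<psi>_proj[OF e(1)] D.proj_iff by auto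
      have "f0 (dom D c) \<in> V e" if "c \<in> \<psi> e" for c
      proof -
        have "unit D (dom D c) = c" "dom D c \<in> topspace (obj D)" using that eb by auto
        moreover from this have "e \<in> pt (dom D c)" using that e(1) by (simp add: pt_def)
        ultimately show ?thesis using f0 in_V[OF pt_filter] by simp
      qed
      moreover have "q \<in> dom D ` \<psi> e" using u q by (intro image_eqI[of _ _ "unit D q"]) auto
      ultimately show "\<exists>M. openin (obj D) M \<and> q \<in> M \<and> f0 ` M \<subseteq> N"
        using D.open_dom[OF eb(1)] e(2) by (intro exI[of _ "dom D ` \<psi> e"]) auto
    qed
    show "\<forall>c\<in>topspace (arr D). f1 c \<subseteq> topspace (arr C)" using f1 g by auto
    show "\<forall>c\<in>topspace (arr D). \<forall>b\<in>f1 c. dom C b = f0 (dom D c) \<and> cod C b = f0 (cod D c)"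
      using f1 f0 g germs_of_tgt C_simps(2,3) by auto
    show "\<forall>(a, b)\<in>topspace (composable D). \<forall>(s, t)\<in>topspace (composable C).
        s \<in> f1 a \<and> t \<in> f1 b \<longrightarrow> comp C s t \<in> f1 (comp D a b)"
    proof (intro ballI, clarify)
      fix a b x y assume "(a, b) \<in> topspace (composable D)" and xy: "x \<in> f1 a" "y \<in> f1 b"
      then have ab: "a \<in> topspace (arr D)" "b \<in> topspace (arr D)" "dom D a = cod D b"
        unfolding D.topspace_composable by auto
      then obtain A B where A: "A \<in> germs_of a" "x = j A" and B: "B \<in> germs_of b" "y = j B"
        using xy f1 by blast
      note gA = g[OF A(1)] and gB = g[OF B(1)]
      have AB: "src S A = tgt S B" using gA(2) germs_of_tgt[OF ab(2) B(1)] ab(3) by simp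
      note m = germ_mult_is_germ[OF gA(1) gB(1) AB]
      obtain s t where s: "s \<in> A" "a \<in> \<psi> s" and t: "t \<in> B" "b \<in> \<psi> t"
        using A(1) B(1) unfolding germs_of_def by blast
      have "comp D a b \<in> \<psi> s \<otimes>\<^bsub>bisections D\<^esub> \<psi> t" using D.bmult_iff s t ab(3) by blast
      then have "comp D a b \<in> \<psi> (s \<otimes>\<^bsub>S\<^esub> t)"
        using \<psi>_mult[OF is_germD(4)[OF gA(1) s(1)] is_germD(4)[OF gB(1) t(1)]] by simp
      then have "germ_mult S A B \<in> germs_of (comp D a b)"
        unfolding germs_of_def using m(1,2) m(4)[OF s(1) t(1)] gB(2) ab by auto
      then show "comp C x y \<in> f1 (comp D a b)"
        using f1[OF D.comp(1)[OF ab]] C_simps(4)[OF gA(1) gB(1)] A B by simp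
    qed
    show "\<forall>a\<in>topspace (arr D). \<forall>b\<in>topspace (arr D).
        (dom D a = dom D b \<or> cod D a = cod D b) \<and> f1 a \<inter> f1 b \<noteq> {} \<longrightarrow> a = b"
    proof (intro ballI impI)
      fix a b assume a: "a \<in> topspace (arr D)" and b: "b \<in> topspace (arr D)"
        and ab: "(dom D a = dom D b \<or> cod D a = cod D b) \<and> f1 a \<inter> f1 b \<noteq> {}"
      then have "j ` germs_of a \<inter> j ` germs_of b \<noteq> {}" unfolding f1[OF a] f1[OF b] by blast
      then obtain A B where A: "A \<in> germs_of a" "B \<in> germs_of b" "j A = j B" by blast
      have "A = B" using j_germ_eq[OF g(1)[OF A(1)] g(1)[OF A(2)]] A(3) by blast
      obtain s where s: "s \<in> A" using is_germD(2)[OF g(1)[OF A(1)]] by blast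
      have "a \<in> \<psi> s" "b \<in> \<psi> s"
        using germs_of_all[OF a A(1) s] germs_of_all[OF b A(2)] s \<open>A = B\<close> by auto
      then show "a = b"
        using ab D.bis_dom D.bis_cod \<psi>_bis[OF is_germD(4)[OF g(1)[OF A(1)] s]] by blast
    qed
    show "\<forall>q\<in>topspace (obj D). \<forall>s\<in>topspace (arr C).
        (dom C s = f0 q \<longrightarrow> (\<exists>t\<in>topspace (arr D). dom D t = q \<and> s \<in> f1 t)) \<and>
        (cod C s = f0 q \<longrightarrow> (\<exists>t\<in>topspace (arr D). cod D t = q \<and> s \<in> f1 t))"
    proof (intro ballI conjI impI)
      fix q x assume q: "q \<in> topspace (obj D)" and "x \<in> topspace (arr C)"
      then obtain A where A: "is_germ S A" "x = j A" by auto
      obtain s where s: "s \<in> A" "s \<in> carrier S" using is_germD(2,4)[OF A(1)] by blast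
      show "\<exists>t\<in>topspace (arr D). dom D t = q \<and> x \<in> f1 t" if "dom C x = f0 q"
      proof -
        have sA: "src S A = pt q"
          using that A C_simps(2) f0[OF q] j_filter_eq[OF is_germD(1)[OF A(1)] pt_filter[OF q]] by simp
        then have "lam S s \<in> pt q" using is_germD(5)[OF A(1) s(1)] by simp
        then obtain c where c: "c \<in> \<psi> s" "dom D c = q" using l_pt[OF s(2) q] by blast
        then have "A \<in> germs_of c" unfolding germs_of_def using A sA s by blast
        then show ?thesis using c A f1 D.bis_sub[OF \<psi>_bis[OF s(2)] c(1)] by blast
      qed
      show "\<exists>t\<in>topspace (arr D). cod D t = q \<and> x \<in> f1 t" if "cod C x = f0 q"
      proof -
        have tA: "tgt S A = pt q"
          using that A C_simps(3) f0[OF q] j_filter_eq[OF is_germD(3)[OF A(1)] pt_filter[OF q]] by simp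
        then have "rho S s \<in> pt q" using r_tgt[OF A(1) s(1)] by simp
        then obtain c where c: "c \<in> \<psi> s" "cod D c = q" using r_pt[OF s(2) q] by blast
        have ca: "c \<in> topspace (arr D)" using D.bis_sub[OF \<psi>_bis[OF s(2)] c(1)] .
        let ?B = "germ S (pt (dom D c)) s"
        have B: "?B \<in> germs_of c" using germ_in_germs_of[OF s(2) c(1)] .
        have "s \<in> ?B" using germ_self[OF pt_filter s(2)] ca by simp
        then have "A = ?B" using germ_eq_tgt[OF A(1) g(1)[OF B] s(1)] germs_of_tgt[OF ca B] tA c(2) by simp
        then show ?thesis using c A f1[OF ca] ca B by blast
      qed
    qed
    show "\<forall>W. openin (arr C) W \<longrightarrow> openin (arr D) {x \<in> topspace (arr D). f1 x \<inter> W \<noteq> {}}"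
    proof (intro allI impI, subst openin_subopen, intro ballI)
      fix W c assume W: "openin (arr C) W" and "c \<in> {x \<in> topspace (arr D). f1 x \<inter> W \<noteq> {}}"
      then obtain x where c: "c \<in> topspace (arr D)" "x \<in> f1 c" "x \<in> W" by blast
      then obtain s where s: "s \<in> carrier S" "x \<in> U s" "U s \<subseteq> W"
        using W unfolding arr_C openin_base_topology[OF base_U] by blast
      have "c \<in> \<psi> s" using lift_U[OF c(1) s(1)] c s f1_def by blast
      moreover have "\<psi> s \<subseteq> {x \<in> topspace (arr D). f1 x \<inter> W \<noteq> {}}"
      proof
        fix y assume y: "y \<in> \<psi> s"
        then have "y \<in> topspace (arr D)" using D.bis_sub[OF \<psi>_bis[OF s(1)]] by blast
        then show "y \<in> {x \<in> topspace (arr D). f1 x \<inter> W \<noteq> {}}"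
          using lift_U[of y s] y s f1_def by blast
      qed
      ultimately show "\<exists>T. openin (arr D) T \<and> c \<in> T \<and> T \<subseteq> {x \<in> topspace (arr D). f1 x \<inter> W \<noteq> {}}"
        using \<psi>_bis[OF s(1)] D.bis_iff by blast
    qed
    show "\<forall>t\<in>topspace (obj D). unit C (f0 t) \<in> f1 (unit D t)"
    proof
      fix t assume t: "t \<in> topspace (obj D)"
      have "germ S (pt t) \<one>\<^bsub>S\<^esub> \<in> germs_of (unit D t)"
        using germ_in_germs_of[of "\<one>\<^bsub>S\<^esub>" "unit D t"] t \<psi>_one by simp
      then show "unit C (f0 t) \<in> f1 (unit D t)"
        using t f0 f1 C_simps(1)[OF pt_filter[OF t]] by simp
    qed
  qed
  then show ?thesis by (simp add: f1_def f0_def)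
qed

lemma lift_proper:
  assumes "proper_morphism S D.GC \<phi>" "c \<in> topspace (arr D)"
  shows "fst lift c \<noteq> {}"
proof -
  have "\<phi> \<in> carrier S \<rightarrow> carrier D.GC" using H.map by blast
  then obtain s where "s \<in> carrier S" "c \<in> \<psi> s" using assms D.proper_iff_cover unfolding \<psi>_def by blast
  then show ?thesis using lift_U[OF assms(2)] by blast
qed

text \<open>Suppose germs of \<open>s\<close> and of \<open>t\<close> are both related to \<open>c\<close>. Then \<open>c\<close> lies in the value of the
  meet of \<open>s\<close> and \<open>t\<close>. As the value of the bottom projection is empty, the meet is a genuine one,
  and its germ at \<open>pt (dom D c)\<close> contains both \<open>s\<close> and \<open>t\<close>.\<close>

lemma lift_wedge:
  assumes w: "wedge_morphism S D.GC \<phi>" and c: "c \<in> topspace (arr D)" and x: "x \<in> fst lift c" "y \<in> fst lift c"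
  shows "x = y"
proof -
  obtain A B where A: "A \<in> germs_of c" "x = j A" and B: "B \<in> germs_of c" "y = j B" using x lift1[OF c] by blast
  have g: "is_germ S A" "is_germ S B" "src S A = pt (dom D c)" "src S B = pt (dom D c)"
    using A B unfolding germs_of_def by auto
  obtain s t where s: "s \<in> A" "t \<in> B" using is_germD(2) g by blast
  then have sc: "s \<in> carrier S" "t \<in> carrier S" using is_germD(4) g by auto
  have "c \<in> \<psi> s" "c \<in> \<psi> t" using germs_of_all c A B s by auto
  moreover have "\<psi> (wedge S s t) = \<psi> s \<inter> \<psi> t"
  proof -
    have "\<phi> (wedge S s t) = i (\<psi> s \<inter> \<psi> t)"
      using w sc \<phi>_\<psi> \<psi>_bis unfolding wedge_morphism_def by simp
    then show ?thesis using D.bis_inter \<psi>_bis sc unfolding \<psi>_def[of "wedge S s t"] by simp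
  qed
  ultimately have cw: "c \<in> \<psi> (wedge S s t)" by simp
  have "\<psi> (\<Squnion>\<^bsub>proj_order S\<^esub> {}) = {}" using \<psi>_Lub[of "{}"] by simp
  then have m: "is_meet S (wedge S s t) {s, t}" using wedge_cases[OF sc] cw by auto
  note m = m[unfolded is_meet_iff[OF sc]]
  let ?G = "germ S (pt (dom D c)) (wedge S s t)"
  have G: "?G \<in> germs_of c" using germ_in_germs_of m cw by blast
  then have G': "is_germ S ?G" "src S ?G = pt (dom D c)" unfolding germs_of_def by auto
  have "wedge S s t \<in> ?G" using germ_self pt_filter m c by simp
  then have "s \<in> ?G" "t \<in> ?G" using is_germD(8)[OF G'(1)] m sc by blast+
  then have "A = ?G" "B = ?G" using germ_eq_src[OF g(1) G'(1) s(1)] germ_eq_src[OF g(2) G'(1) s(2)] g G' by auto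
  then show "x = y" using A B by simp
qed

text \<open>The preimages of the sets \<open>U e\<close> determine which projections belong to the filter \<open>g\<close> assigns
  to an object. This fixes the sources of the germs related to an arrow \<open>c\<close>, and the preimages
  of the sets \<open>U s\<close> determine which elements they contain.\<close>

lemma lift_unique:
  assumes g: "rel_covering D C (fst g) (snd g)"
    and ext: "fst g \<in> extensional (topspace (arr D))" "snd g \<in> extensional (topspace (obj D))"
    and gU: "\<And>s. s \<in> carrier S \<Longrightarrow> {c \<in> topspace (arr D). fst g c \<inter> U s \<noteq> {}} = \<psi> s"
  shows "g = lift"
proof -
  interpret g: rel_covering D C "fst g" "snd g" by fact
  have mem: "c \<in> \<psi> s \<longleftrightarrow> (\<exists>A. is_germ S A \<and> j A \<in> fst g c \<and> s \<in> A)"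
    if c: "c \<in> topspace (arr D)" and s: "s \<in> carrier S" for c s
  proof -
    have "c \<in> \<psi> s \<longleftrightarrow> fst g c \<inter> U s \<noteq> {}" unfolding gU[OF s, symmetric] using c by simp
    also have "\<dots> \<longleftrightarrow> (\<exists>A. is_germ S A \<and> j A \<in> fst g c \<and> s \<in> A)" by blast
    finally show ?thesis .
  qed
  have ob: "snd g q = j (pt q)" if q: "q \<in> topspace (obj D)" for q
  proof -
    obtain p where p: "cprime_filter S p" "snd g q = j p" using g.f0[OF q] by auto
    have "e \<in> p \<longleftrightarrow> e \<in> pt q" if e: "e \<in> Proj S" for e
    proof
      assume ep: "e \<in> p"
      have "j (germ S p \<one>\<^bsub>S\<^esub>) \<in> fst g (unit D q)" using g.f1_unit[OF q] p C_simps(1) by simp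
      then have "unit D q \<in> \<psi> e" using mem[of "unit D q" e] q e germ_one[OF p(1)] ep by auto
      then show "e \<in> pt q" using e by (simp add: pt_def)
    next
      assume "e \<in> pt q"
      then have "unit D q \<in> \<psi> e" by (simp add: pt_def)
      then obtain A where A: "is_germ S A" "j A \<in> fst g (unit D q)" "e \<in> A" using mem[of "unit D q" e] q e by auto
      have "dom C (j A) = j p" using g.f1_dom[OF _ A(2)] q p by simp
      then have "src S A = p" using C_simps(2)[OF A(1)] j_filter_eq[OF is_germD(1)[OF A(1)] p(1)] by simp
      then show "e \<in> p" using germ_of_projection(2)[OF A(1,3) e] by simp
    qed
    then have "p = pt q" using filterD(1)[OF p(1)] by (auto simp: pt_def)
    then show ?thesis using p by simp
  qed
  have src: "src S A = pt (dom D c)" if c: "c \<in> topspace (arr D)" and A: "is_germ S A" "j A \<in> fst g c" for c A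
  proof -
    have "j (src S A) = j (pt (dom D c))" using g.f1_dom[OF c A(2)] C_simps(2)[OF A(1)] ob c by simp
    then show ?thesis using j_filter_eq[OF is_germD(1)[OF A(1)] pt_filter] c by simp
  qed
  have ar: "fst g c = j ` germs_of c" if c: "c \<in> topspace (arr D)" for c
  proof (intro equalityI subsetI)
    fix x assume x: "x \<in> fst g c"
    then obtain A where A: "is_germ S A" "x = j A" using g.f1_arr[OF c] by auto
    then obtain s where s: "s \<in> A" "s \<in> carrier S" using is_germD(2,4)[OF A(1)] by blast
    then have "c \<in> \<psi> s" using mem[OF c s(2)] A x by blast
    then show "x \<in> j ` germs_of c" unfolding germs_of_def using A s src[OF c A(1)] x by blast
  next
    fix x assume "x \<in> j ` germs_of c"
    then obtain A s where A: "is_germ S A" "src S A = pt (dom D c)" "x = j A" "s \<in> A" "c \<in> \<psi> s"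
      unfolding germs_of_def by blast
    then obtain B where B: "is_germ S B" "j B \<in> fst g c" "s \<in> B" using mem[OF c is_germD(4)[OF A(1,4)]] by blast
    then have "A = B" using germ_eq_src[OF A(1) B(1) A(4) B(3)] A(2) src[OF c B(1,2)] by simp
    then show "x \<in> fst g c" using A B by simp
  qed
  have "fst g = fst lift"
    by (rule extensionalityI[OF ext(1)]) (simp_all add: lift_def ar)
  moreover have "snd g = snd lift"
    by (rule extensionalityI[OF ext(2)]) (simp_all add: lift_def ob)
  ultimately show ?thesis by (simp add: prod_eq_iff)
qed

end

lemma eta_universal:
  fixes D :: "('c, 'o) tcat"
  assumes S: "complete_restriction_monoid S" and j: "inj_on j (Pow (carrier S))"
    and D: "etale D" and i: "inj_on i (Pow (topspace (arr D)))"
    and h: "inj_on h (Pow (topspace (arr (germ_cat j S))))"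
    and \<phi>: "\<phi> \<in> crm_mor k S (encode_crm i (topspace (arr D)) (bisections D))"
  shows "\<exists>!f. f \<in> etale_mor k D (germ_cat j S) \<and>
    compose (carrier S) (preimage i h D (germ_cat j S) f) (eta h j S) = \<phi>"
proof -
  interpret S: complete_restriction_mon S by (rule complete_restriction_monI[OF S])
  interpret germs S j by unfold_locales (fact j)
  interpret D: bisection_monoid D i by unfold_locales (fact D, fact i)
  interpret I: into_bisections S j D i \<phi> by unfold_locales (rule crm_morD(1)[OF \<phi>])
  interpret B: bisection_monoid C h by unfold_locales (fact etale_germ_cat, fact h)
  have co: "compose (carrier S) (preimage i h D C f) (eta h j S) = \<phi> \<longleftrightarrow>
      (\<forall>s\<in>carrier S. {c \<in> topspace (arr D). fst f c \<inter> U s \<noteq> {}} = I.\<psi> s)" (is "?L = ?R") for f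
  proof -
    have v: "compose (carrier S) (preimage i h D C f) (eta h j S) s = i {c \<in> topspace (arr D). fst f c \<inter> U s \<noteq> {}}"
      if "s \<in> carrier S" for s
    proof -
      have "B.dec (h (U s)) = U s" using U_bis[OF that] by (rule B.dec_j)
      then show ?thesis
        using that U_bis[OF that] by (simp add: compose_def preimage_def eta_def del: topspace_C)
    qed
    have p: "{c \<in> topspace (arr D). fst f c \<inter> U s \<noteq> {}} \<in> Pow (topspace (arr D))" for s by blast
    have q: "I.\<psi> s \<in> Pow (topspace (arr D))" if "s \<in> carrier S" for s
      using D.bis_pow I.\<psi>_bis[OF that] by blast
    have "?L \<longleftrightarrow> (\<forall>s\<in>carrier S. compose (carrier S) (preimage i h D C f) (eta h j S) s = \<phi> s)"
    proof
      assume "\<forall>s\<in>carrier S. compose (carrier S) (preimage i h D C f) (eta h j S) s = \<phi> s"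
      then show ?L
        by (intro extensionalityI[OF compose_extensional crm_morD(2)[OF \<phi>]]) auto
    qed auto
    also have "\<dots> \<longleftrightarrow> ?R"
    proof (intro ball_cong refl)
      fix s assume s: "s \<in> carrier S"
      show "(compose (carrier S) (preimage i h D C f) (eta h j S) s = \<phi> s) =
        ({c \<in> topspace (arr D). fst f c \<inter> U s \<noteq> {}} = I.\<psi> s)"
        unfolding v[OF s] I.\<phi>_\<psi>[OF s] by (rule inj_on_eq_iff[OF i p q[OF s]])
    qed
    finally show ?thesis .
  qed
  have "I.lift \<in> etale_mor k D C"
    unfolding etale_mor_def
    using I.lift_covering I.lift_proper I.lift_wedge crm_morD(3,4)[OF \<phi>]
    by (auto simp: I.lift_def split_beta)
  moreover have "compose (carrier S) (preimage i h D C I.lift) (eta h j S) = \<phi>"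
    unfolding co
  proof
    fix s assume s: "s \<in> carrier S"
    show "{c \<in> topspace (arr D). fst I.lift c \<inter> U s \<noteq> {}} = I.\<psi> s"
      using I.lift_U[OF _ s] D.bis_sub[OF I.\<psi>_bis[OF s]] by blast
  qed
  moreover have "g = I.lift"
    if "g \<in> etale_mor k D C" "compose (carrier S) (preimage i h D C g) (eta h j S) = \<phi>" for g
    by (rule I.lift_unique)
      (use that co etale_mor_covering[OF D etale_germ_cat that(1)] etale_morD(2,3)[OF that(1)] in auto)
  ultimately show ?thesis by blast
qed

theorem corollary7p23:
  fixes small :: "'u set \<Rightarrow> bool"
    and k :: nat
    and P :: "'u crm \<Rightarrow> bool"
    and Q :: "('u, 'u) tcat \<Rightarrow> bool"
  assumes "universe small"
    and "k \<in> {1, 2, 3, 4}"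
    and "(P, Q) \<in> {(left_ample, left_cancellative),
                   (right_ample, right_cancellative),
                   (ample, cancellative)}"
  shows "\<exists>G Gm F Fm \<Phi>.
           adjunction (ETALE small Q k) (opposite (CRM small P k)) G Gm F Fm \<Phi> \<and>
           is_bisection_functor (ETALE small Q k) G Gm"
proof -
  \<comment> \<open>sets of arrows and sets of elements are coded as points of the ambient type; smallness of
    the set they are taken from makes this possible\<close>
  define enc :: "'u set \<Rightarrow> 'u set \<Rightarrow> 'u"
    where "enc A = (SOME j. inj_on j (Pow A) \<and> small (j ` Pow A))" for A
  have sub: "small B" if "small A" "B \<subseteq> A" for A B
    using assms(1) that unfolding universe_def by blast
  have enc: "inj_on (enc A) (Pow A)" "small (enc A ` Pow A)" if "small A" for A
  proof -
    have "\<exists>j :: 'u set \<Rightarrow> 'u. inj_on j (Pow A) \<and> small (j ` Pow A)"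
      using assms(1) that unfolding universe_def by blast
    from someI_ex[OF this] show "inj_on (enc A) (Pow A)" "small (enc A ` Pow A)"
      unfolding enc_def by auto
  qed
  define G :: "('u, 'u) tcat \<Rightarrow> 'u crm"
    where "G C = encode_crm (enc (topspace (arr C))) (topspace (arr C)) (bisections C)" for C
  define Gm :: "('u, 'u) tcat \<Rightarrow> ('u, 'u) tcat \<Rightarrow> ('u, 'u, 'u, 'u) rel_mor \<Rightarrow> 'u \<Rightarrow> 'u"
    where "Gm C D = preimage (enc (topspace (arr C))) (enc (topspace (arr D))) C D" for C D
  define F :: "'u crm \<Rightarrow> ('u, 'u) tcat" where "F S = germ_cat (enc (carrier S)) S" for S
  define \<eta> where "\<eta> S = eta (enc (topspace (arr (F S)))) (enc (carrier S)) S" for S :: "'u crm"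
  let ?X = "ETALE small Q k" and ?Z = "CRM small P k"
  have X: "C \<in> Obj ?X \<longleftrightarrow> small (topspace (arr C)) \<and> small (topspace (obj C)) \<and> etale C \<and> Q C" for C
    by (simp add: ETALE_def)
  have Z: "S \<in> Obj ?Z \<longleftrightarrow> small (carrier S) \<and> complete_restriction_monoid S \<and> P S" for S
    by (simp add: CRM_def)
  have GO: "G C \<in> Obj ?Z" if "C \<in> Obj ?X" for C
  proof -
    have c: "etale C" "small (topspace (arr C))" "Q C" using that X by auto
    interpret bisection_monoid C "enc (topspace (arr C))" by unfold_locales (use c enc in auto)
    have "small (carrier GC)" using sub[OF enc(2)[OF c(2)]] bis_pow by (simp add: image_mono)
    moreover have "left_cancellative C \<Longrightarrow> left_ample GC" "right_cancellative C \<Longrightarrow> right_ample GC"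
      using encode_crm_iso(4,5)[OF j bis_pow restriction_monoid_bisections]
        left_ample_bisections right_ample_bisections by auto
    then have "P GC" using assms(3) c(3) unfolding ample_def cancellative_def by auto
    ultimately show ?thesis unfolding Z G_def using complete_GC by blast
  qed
  have FO: "F S \<in> Obj ?X" if "S \<in> Obj ?Z" for S
  proof -
    have s: "complete_restriction_monoid S" "small (carrier S)" "P S" using that Z by auto
    interpret complete_restriction_mon S by (rule complete_restriction_monI[OF s(1)])
    interpret germs S "enc (carrier S)" by unfold_locales (rule enc(1)[OF s(2)])
    have "small (topspace (arr C))" "small (topspace (obj C))"
      using germ_sub filter_sub by (auto intro!: sub[OF enc(2)[OF s(2)]] image_mono)
    moreover have "Q C"
      using assms(3) s(3) left_cancellative_germ_cat right_cancellative_germ_cat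
      unfolding ample_def cancellative_def by auto
    ultimately show ?thesis unfolding X F_def using etale_germ_cat by blast
  qed
  have GM: "Gm C D f \<in> Mor ?Z (G D) (G C)" if "C \<in> Obj ?X" "D \<in> Obj ?X" "f \<in> Mor ?X C D" for C D f
  proof -
    have "etale C" "etale D" "small (topspace (arr C))" "small (topspace (arr D))" "f \<in> etale_mor k C D"
      using that unfolding X by (auto simp: ETALE_def)
    then show ?thesis
      using preimage_crm_mor[OF _ _ _ enc(1) enc(1)] unfolding G_def Gm_def by (simp add: CRM_def)
  qed
  have G: "is_functor ?X (opposite ?Z) G Gm"
    unfolding is_functor_def
  proof (intro conjI ballI)
    show "is_category ?X" by (rule is_category_ETALE)
    show "is_category (opposite ?Z)"
      using is_category_CRM[of small P k] unfolding is_category_def opposite_def by simp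
  next
    fix C assume C: "C \<in> Obj ?X"
    then show "G C \<in> Obj (opposite ?Z)" using GO by (simp add: opposite_def)
    show "Gm C C (Ide ?X C) = Ide (opposite ?Z) (G C)"
    proof -
      have "etale C" "small (topspace (arr C))" using C unfolding X by auto
      then show ?thesis
        using preimage_id[OF _ enc(1)] unfolding Gm_def G_def
        by (simp add: opposite_def CRM_def ETALE_def)
    qed
    fix D assume D: "D \<in> Obj ?X"
    show "Gm C D f \<in> Mor (opposite ?Z) (G C) (G D)" if "f \<in> Mor ?X C D" for f
      using GM C D that by (simp add: opposite_def)
    fix E f g assume E: "E \<in> Obj ?X" and f: "f \<in> Mor ?X C D" and g: "g \<in> Mor ?X D E"
    have e: "etale C" "etale D" "etale E" and
      s: "small (topspace (arr C))" "small (topspace (arr D))" "small (topspace (arr E))"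
      using C D E unfolding X by auto
    have fg: "f \<in> etale_mor k C D" "g \<in> etale_mor k D E" using f g by (auto simp: ETALE_def)
    show "Gm C E (Comp ?X C D E g f) = Comp (opposite ?Z) (G C) (G D) (G E) (Gm D E g) (Gm C D f)"
      using preimage_comp[OF e fg enc(1)[OF s(1)] enc(1)[OF s(2)] enc(1)[OF s(3)]] unfolding Gm_def G_def
      by (simp add: opposite_def CRM_def ETALE_def)
  qed
  have univ: "\<exists>!f. f \<in> Mor ?X C (F S) \<and> Comp ?Z S (G (F S)) (G C) (Gm C (F S) f) (\<eta> S) = \<phi>"
    if "C \<in> Obj ?X" "S \<in> Obj ?Z" "\<phi> \<in> Mor ?Z S (G C)" for C S \<phi>
  proof -
    have c: "etale C" "small (topspace (arr C))" using that(1) unfolding X by auto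
    have s: "complete_restriction_monoid S" "small (carrier S)" using that(2) unfolding Z by auto
    have fs: "small (topspace (arr (germ_cat (enc (carrier S)) S)))"
      using FO[OF that(2)] unfolding X F_def by blast
    have m: "\<phi> \<in> crm_mor k S (encode_crm (enc (topspace (arr C))) (topspace (arr C)) (bisections C))"
      using that(3) unfolding G_def by (simp add: CRM_def)
    show ?thesis
      using eta_universal[OF s(1) enc(1)[OF s(2)] c(1) enc(1)[OF c(2)] enc(1)[OF fs] m]
      unfolding F_def Gm_def \<eta>_def by (simp add: CRM_def ETALE_def)
  qed
  have \<eta>: "\<eta> S \<in> Mor ?Z S (G (F S))" if "S \<in> Obj ?Z" for S
  proof -
    have s: "complete_restriction_monoid S" "small (carrier S)" using that Z by auto
    interpret complete_restriction_mon S by (rule complete_restriction_monI[OF s(1)])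
    interpret germs S "enc (carrier S)" by unfold_locales (rule enc(1)[OF s(2)])
    have "small (topspace (arr C))" using FO[OF that] X unfolding F_def by blast
    then show ?thesis using eta_crm_mor[OF enc(1)] unfolding \<eta>_def F_def G_def CRM_def by simp
  qed
  obtain Fm \<Phi> where adj: "adjunction ?X (opposite ?Z) G Gm F Fm \<Phi>"
    using dual_adjunction_of_universal_arrows[OF G is_category_CRM FO \<eta> univ] by blast
  have "is_bisection_functor ?X G Gm"
    unfolding is_bisection_functor_def
  proof (intro exI[of _ "\<lambda>C. decode (enc (topspace (arr C))) (topspace (arr C))"] conjI ballI)
    fix C assume C: "C \<in> Obj ?X"
    interpret C: bisection_monoid C "enc (topspace (arr C))" by unfold_locales (use C X enc in auto)
    show "crm_iso (G C) (bisections C) C.dec" unfolding G_def by (rule C.GC_iso)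
    fix D f x assume D: "D \<in> Obj ?X" and f: "f \<in> Mor ?X C D" and x: "x \<in> carrier (G D)"
    have "Gm C D f x = enc (topspace (arr C)) {c \<in> topspace (arr C). fst f c \<inter> decode (enc (topspace (arr D))) (topspace (arr D)) x \<noteq> {}}"
      using x unfolding Gm_def G_def preimage_def by simp
    then show "C.dec (Gm C D f x) = {c \<in> topspace (arr C). fst f c \<inter> decode (enc (topspace (arr D))) (topspace (arr D)) x \<noteq> {}}"
      using decode[OF C.j] by (simp add: Collect_mono_iff subset_iff)
  qed
  with adj show ?thesis by blast
qed

end
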